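(* Let $n>1$ and let $X=(X_t)_{t\ge 0}$ be a Lévy process on $\mathbf{R}^n$ with Lévy-Khintchine exponent $(a,Q,\mu)$. Suppose there exists a subspace $S$ of $\mathbf{R}^n$ such that $\sqrt{Q}\,\mathbf{R}^n\subsetneq S\subsetneq\mathbf{R}^n$ and $\mu(\mathbf{R}^n\setminus S)<\infty$. Then the following three claims are equivalent: (i) $X$ satisfies (H); (ii) for every nonempty proper subspace $A$ of $\mathbf{R}^n$, the projection process of $X$ on $A$ satisfies (H); (iii) for each $A\in\{S,S^{\perp}\}$, the projection process of $X$ on $A$ satisfies (H).
   Context: Lévy-Khintchine exponent: $E[\exp\{i\langle z,X_t\rangle\}]=\exp\{-t\psi(z)\}$ for $z\in\mathbf{R}^n$, $t\ge0$, with $$\psi(z)=i\langle a,z\rangle+\tfrac12\langle z,Qz\rangle+\int_{\mathbf{R}^n\setminus\{0\}}\left(1-e^{i\langle z,x\rangle}+i\langle z,x\rangle 1_{\{|x|<1\}}\right)\mu(dx),$$ where $a\in\mathbf{R}^n$, $Q$ is a symmetric nonnegative definite $n\times n$ matrix, and $\mu$ (the Lévy measure) is a measure on $\mathbf{R}^n\setminus\{0\}$ with $\int(1\wedge|x|^2)\mu(dx)<\infty$. One writes $(a,Q,\mu)$ for $\psi$. $\sqrt{Q}$ is the nonnegative definite square root of $Q$, and $\sqrt{Q}\,\mathbf{R}^n=\{\sqrt{Q}y:y\in\mathbf{R}^n\}$. $A^\perp$ denotes the orthogonal complement of a subspace $A$. For a subspace $A$ of $\mathbf{R}^n$, the projection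 process of $X$ on $A$ is $(P_AX_t)_{t\ge0}$, where $P_A$ is the orthogonal projection of $\mathbf{R}^n$ onto $A$; it is a Lévy process on $A$ (identified with $\mathbf{R}^{\dim A}$). Hypothesis (H): for a Lévy process $X$ let $P^x$ be the law of $x+X$ (with $X_0=0$ under $P=P^0$), and let $T_D=\inf\{t>0:X_t\in D\}$. A set $C$ is nearly Borel if for each initial distribution $\kappa$ there are Borel sets $B\subset C\subset B'$ with $P^\kappa(X_t\in B'\setminus B\text{ for some }t\ge0)=0$. A set $D$ is thin if there is a nearly Borel set $C\supset D$ with $P^x(T_C=0)=0$ for all $x$; semipolar if it is contained in a countable union of thin sets; polar if there is a nearly Borel set $C\supset D$ with $P^x(T_C<\infty)=0$ for all $x$. $X$ satisfies (H) if every semipolar set of $X$ is polar. *)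

theory Defs
  imports "HOL-Probability.Probability"
begin

section \<open>Levy processes and their exponents\<close>

text \<open>Only the times \<open>t \<ge> 0\<close> matter; the values \<open>X t\<close> for \<open>t < 0\<close> are irrelevant.\<close>

locale levy_process = prob_space M for M :: "'w measure" +
  fixes X :: "real \<Rightarrow> 'w \<Rightarrow> 'a::euclidean_space"
  assumes measurable_X: "\<And>t. 0 \<le> t \<Longrightarrow> X t \<in> borel_measurable M"
    and start_zero: "AE \<omega> in M. X 0 \<omega> = 0"
    and indep_increments: "\<And>(\<tau> :: nat \<Rightarrow> real) m. 0 \<le> \<tau> 0 \<Longrightarrow> mono \<tau> \<Longrightarrow>
          indep_vars (\<lambda>_. borel) (\<lambda>i \<omega>. X (\<tau> (Suc i)) \<omega> - X (\<tau> i) \<omega>) {..<m}"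
    and stationary_increments: "\<And>s h. 0 \<le> s \<Longrightarrow> 0 \<le> h \<Longrightarrow>
          distr M borel (\<lambda>\<omega>. X (s + h) \<omega> - X s \<omega>) = distr M borel (X h)"
    and cadlag_paths: "AE \<omega> in M.
          (\<forall>t\<ge>0. ((\<lambda>s. X s \<omega>) \<longlongrightarrow> X t \<omega>) (at_right t)) \<and>
          (\<forall>t>0. \<exists>l. ((\<lambda>s. X s \<omega>) \<longlongrightarrow> l) (at_left t))"

definition pos_semidef :: "real^'n^'n \<Rightarrow> bool" where
  "pos_semidef Q \<longleftrightarrow> transpose Q = Q \<and> (\<forall>z. 0 \<le> z \<bullet> (Q *v z))"

definition matrix_sqrt :: "real^'n^'n \<Rightarrow> real^'n^'n" where
  "matrix_sqrt Q = (THE R. pos_semidef R \<and> R ** R = Q)"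

text \<open>A Levy measure is a measure whose underlying space is the complement of the origin.\<close>

definition levy_measure :: "(real^'n) measure \<Rightarrow> bool" where
  "levy_measure \<mu> \<longleftrightarrow> sets \<mu> = sets (restrict_space borel (UNIV - {0})) \<and>
     (\<integral>\<^sup>+ x. ennreal (min 1 ((norm x)\<^sup>2)) \<partial>\<mu>) < \<infinity>"

definition levy_exponent ::
  "real^'n \<Rightarrow> real^'n^'n \<Rightarrow> (real^'n) measure \<Rightarrow> real^'n \<Rightarrow> complex" where
  "levy_exponent a Q \<mu> z =
     \<i> * complex_of_real (a \<bullet> z) + complex_of_real (z \<bullet> (Q *v z)) / 2 +
     (\<integral>x. 1 - iexp (z \<bullet> x) + \<i> * complex_of_real (z \<bullet> x) * indicator {x. norm x < 1} x \<partial>\<mu>)"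

definition has_levy_khintchine_exponent :: "'w measure \<Rightarrow> (real \<Rightarrow> 'w \<Rightarrow> real^'n) \<Rightarrow>
    real^'n \<Rightarrow> real^'n^'n \<Rightarrow> (real^'n) measure \<Rightarrow> bool" where
  "has_levy_khintchine_exponent M X a Q \<mu> \<longleftrightarrow> pos_semidef Q \<and> levy_measure \<mu> \<and>
     (\<forall>z. \<forall>t\<ge>0. (\<integral>\<omega>. iexp (z \<bullet> X t \<omega>) \<partial>M)
                  = exp (- (complex_of_real t * levy_exponent a Q \<mu> z)))"


section \<open>Projection processes\<close>

definition orthogonal_projection :: "'a::euclidean_space set \<Rightarrow> 'a \<Rightarrow> 'a" where
  "orthogonal_projection A x = (THE y. y \<in> A \<and> x - y \<in> A\<^sup>\<bottom>)"

lemma orthogonal_projection: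
  assumes "subspace A"
  shows "orthogonal_projection A x \<in> A \<and> x - orthogonal_projection A x \<in> A\<^sup>\<bottom>"
  unfolding orthogonal_projection_def
proof (rule theI')
  show "\<exists>!y. y \<in> A \<and> x - y \<in> A\<^sup>\<bottom>"
  proof (rule ex_ex1I)
    obtain y z where "y \<in> span A" "\<And>w. w \<in> span A \<Longrightarrow> orthogonal z w" "x = y + z"
      using orthogonal_subspace_decomp_exists by blast
    then show "\<exists>y. y \<in> A \<and> x - y \<in> A\<^sup>\<bottom>"
      using assms by (auto simp: orthogonal_comp_def span_eq_iff[THEN iffD2] orthogonal_commute)
  next
    fix y y' assume y: "y \<in> A \<and> x - y \<in> A\<^sup>\<bottom>" and y': "y' \<in> A \<and> x - y' \<in> A\<^sup>\<bottom>"
    have "y - y' \<in> A" using y y' assms by (simp add: subspace_diff)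
    then have "(y - y') \<bullet> (x - y') = 0" "(y - y') \<bullet> (x - y) = 0"
      using y y' by (auto simp: orthogonal_comp_def orthogonal_def)
    then have "(y - y') \<bullet> (y - y') = 0" by (simp add: inner_diff_right)
    then show "y = y'" by simp
  qed
qed

definition projection_process ::
  "'a::euclidean_space set \<Rightarrow> (real \<Rightarrow> 'w \<Rightarrow> 'a) \<Rightarrow> real \<Rightarrow> 'w \<Rightarrow> 'a" where
  "projection_process A X t \<omega> = orthogonal_projection A (X t \<omega>)"


section \<open>Hypothesis (H)\<close>

text \<open>
  All notions below are relative to a state space \<open>V\<close>, a linear subspace in which the
  process \<open>X\<close> takes its values: \<open>V = UNIV\<close> for a process on the whole space, and \<open>V = A\<close>
  for the projection process on \<open>A\<close>.  Starting points, initial distributions and all sets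
  involved live in \<open>V\<close>.  This is the same as transporting the process to Euclidean space of
  dimension \<open>dim V\<close> along a linear isometry.

  The law of \<open>X\<close> started at \<open>x\<close> is the law of \<open>x + X\<close> under \<open>M\<close>; the law with initial
  distribution \<open>\<kappa>\<close> is that of \<open>\<lambda>(x, \<omega>). x + X t \<omega>\<close> under \<open>\<kappa> \<Otimes>\<^sub>M M\<close>.  The events in
  question need not belong to the \<sigma>-algebra at hand; that such an event has probability
  zero means that it is contained in a null set, i.e. that its complement holds \<open>AE\<close>.
\<close>

definition hitting_time :: "'a set \<Rightarrow> (real \<Rightarrow> 'a) \<Rightarrow> ereal" where
  "hitting_time D p = (INF t \<in> {t. 0 < t \<and> p t \<in> D}. ereal t)"

definition nearly_borel ::
  "'w measure \<Rightarrow> 'a::euclidean_space set \<Rightarrow> (real \<Rightarrow> 'w \<Rightarrow> 'a) \<Rightarrow> 'a set \<Rightarrow> bool" where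
  "nearly_borel M V X C \<longleftrightarrow>
     (\<forall>\<kappa>. prob_space \<kappa> \<and> sets \<kappa> = sets (restrict_space borel V) \<longrightarrow>
        (\<exists>B\<in>sets (restrict_space borel V). \<exists>B'\<in>sets (restrict_space borel V).
           B \<subseteq> C \<and> C \<subseteq> B' \<and>
           (AE (x, \<omega>) in \<kappa> \<Otimes>\<^sub>M M. \<not> (\<exists>t\<ge>0. x + X t \<omega> \<in> B' - B))))"

definition thin_set ::
  "'w measure \<Rightarrow> 'a::euclidean_space set \<Rightarrow> (real \<Rightarrow> 'w \<Rightarrow> 'a) \<Rightarrow> 'a set \<Rightarrow> bool" where
  "thin_set M V X D \<longleftrightarrow>
     (\<exists>C. nearly_borel M V X C \<and> D \<subseteq> C \<and>
        (\<forall>x\<in>V. AE \<omega> in M. hitting_time C (\<lambda>t. x + X t \<omega>) \<noteq> 0))"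

definition semipolar_set ::
  "'w measure \<Rightarrow> 'a::euclidean_space set \<Rightarrow> (real \<Rightarrow> 'w \<Rightarrow> 'a) \<Rightarrow> 'a set \<Rightarrow> bool" where
  "semipolar_set M V X D \<longleftrightarrow>
     (\<exists>\<T>. countable \<T> \<and> (\<forall>T\<in>\<T>. thin_set M V X T) \<and> D \<subseteq> \<Union>\<T>)"

definition polar_set ::
  "'w measure \<Rightarrow> 'a::euclidean_space set \<Rightarrow> (real \<Rightarrow> 'w \<Rightarrow> 'a) \<Rightarrow> 'a set \<Rightarrow> bool" where
  "polar_set M V X D \<longleftrightarrow>
     (\<exists>C. nearly_borel M V X C \<and> D \<subseteq> C \<and>
        (\<forall>x\<in>V. AE \<omega> in M. \<not> hitting_time C (\<lambda>t. x + X t \<omega>) < \<infinity>))"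

definition hypothesis_H ::
  "'w measure \<Rightarrow> 'a::euclidean_space set \<Rightarrow> (real \<Rightarrow> 'w \<Rightarrow> 'a) \<Rightarrow> bool" where
  "hypothesis_H M V X \<longleftrightarrow> (\<forall>D. semipolar_set M V X D \<longrightarrow> polar_set M V X D)"

end

theory Submission
  imports Defs
begin

text \<open>
  Hypothesis (H) always passes to projections: pull sets back along the projection.  For the
  converse let \<open>W\<close> be the projection of \<open>X\<close> on the orthogonal complement of \<open>S\<close>.  Since
  \<open>\<mu>\<close> is finite off \<open>S\<close> and \<open>Q\<close> vanishes on the complement, \<open>W\<close> is a compound Poisson process
  with drift.  A nonzero drift would make the origin a thin set that is hit, contradicting (H)
  for \<open>W\<close>; so \<open>W\<close> is a step process.  As long as \<open>W\<close> does not move, \<open>X\<close> is a translate of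
  its projection on \<open>S\<close>.  Hence the slices of a thin set of \<open>X\<close> by translates of \<open>S\<close> are thin
  for that projection, and (H) for the projection shows that a semipolar set is not hit by \<open>X\<close>
  before the first jump of \<open>W\<close>, from any starting point.  Restarting at all rational times gives
  the same between any two jumps.  A jump position is avoided as well, because the jump occurs
  with high probability later than a small time \<open>h\<close>, and \<open>X h\<close> has no mass on translates of the
  set.  Restarting from a random position requires null sets for hitting events of Borel sets;
  these are not events, and measurable projection is what makes Fubini's theorem applicable.
\<close>

section \<open>Measurable projection\<close>

text \<open>That \<open>W\<close> minus its drift is a step process comes straight from the
  exponent: for a coordinate \<open>Y\<close> of the centred increment,
  \<open>1 - E cos (u Y)\<close> is bounded uniformly in \<open>u\<close>, and averaging over wide
  Gaussian \<open>u\<close> bounds the probability that \<open>Y\<close> is nonzero by a multiple of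
  the elapsed time. Every later time is reached from an earlier rational one, either while
  \<open>W\<close> stays put or as its first jump, so countably many restarts at fixed times cover
  all jumps. The main obstacle is the notion of a nearly Borel set. Its Borel sandwich depends on
  the initial law and must be chosen anew for each restart, and null hitting events must be carried
  from one law to another without being measurable. A hitting event is the projection along time of
  a measurable set of times and paths; for each law it contains a measurable set that exhausts it up
  to a null set. Its nullity is therefore decided by the image law and by the sections. Thinness
  pulls back along a projection because \<open>X\<close> from \<open>x\<close> hits the preimage of
  \<open>C\<close> exactly when the projected process from the projection of \<open>x\<close> hits
  \<open>C\<close>.\<close>

text \<open>A subset of \<open>\<real> \<times> space N\<close> is encoded by the function that maps \<open>y\<close> to its section over
  \<open>y\<close>.  Closed-valued simple functions play the role of the finite unions of rectangles
  \<open>K \<times> F\<close> with \<open>K\<close> closed and \<open>F\<close> measurable.\<close>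

definition closed_section_scheme :: "'b measure \<Rightarrow> (nat list \<Rightarrow> 'b \<Rightarrow> real set) \<Rightarrow> bool" where
  "closed_section_scheme N P \<longleftrightarrow> (\<forall>l. simple_function N (P l) \<and> (\<forall>y. closed (P l y)))"

definition suslin_kernel :: "'b measure \<Rightarrow> (nat list \<Rightarrow> 'b \<Rightarrow> real set) \<Rightarrow> (real \<times> 'b) set" where
  "suslin_kernel N P = {(t, y). y \<in> space N \<and> (\<exists>\<sigma>::nat \<Rightarrow> nat. \<forall>n. t \<in> P (map \<sigma> [0..<n]) y)}"

definition suslin_sets :: "'b measure \<Rightarrow> (real \<times> 'b) set set" where
  "suslin_sets N = {suslin_kernel N P | P. closed_section_scheme N P}"

section \<open>Suslin sets: countable operations and rectangles\<close>

lemma simple_function_INT: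
  fixes s :: "'i \<Rightarrow> 'b \<Rightarrow> 'c set"
  assumes "finite I" "\<And>i. i \<in> I \<Longrightarrow> simple_function N (s i)"
  shows "simple_function N (\<lambda>y. \<Inter>i\<in>I. s i y)"
  using assms
proof (induction I rule: finite_induct)
  case (insert i I)
  have "simple_function N (\<lambda>y. s i y \<inter> (\<Inter>i\<in>I. s i y))"
    by (rule simple_function_compose2[OF insert.prems insert.IH]) (use insert.prems in auto)
  then show ?case by simp
qed simp

lemma simple_function_UN:
  fixes s :: "'i \<Rightarrow> 'b \<Rightarrow> 'c set"
  assumes "finite I" "\<And>i. i \<in> I \<Longrightarrow> simple_function N (s i)"
  shows "simple_function N (\<lambda>y. \<Union>i\<in>I. s i y)"
  using assms
proof (induction I rule: finite_induct)
  case (insert i I)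
  have "simple_function N (\<lambda>y. s i y \<union> (\<Union>i\<in>I. s i y))"
    by (rule simple_function_compose2[OF insert.prems insert.IH]) (use insert.prems in auto)
  then show ?case by simp
qed simp

lemma simple_function_nonempty_sets:
  fixes s :: "'b \<Rightarrow> 'c set"
  assumes "simple_function N s"
  shows "{y \<in> space N. s y \<noteq> {}} \<in> sets N"
proof -
  have "s -` {{}} \<inter> space N \<in> sets N" using assms by (rule simple_functionD(2))
  then have "space N - s -` {{}} \<inter> space N \<in> sets N" by auto
  also have "space N - s -` {{}} \<inter> space N = {y \<in> space N. s y \<noteq> {}}" by auto
  finally show ?thesis .
qed

lemma suslin_sets_rectangle:
  assumes "closed K" "F \<in> sets N"
  shows "K \<times> F \<in> suslin_sets N"
proof -
  define P where "P = (\<lambda>(l::nat list) y. if y \<in> F then K else {})"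
  have "closed_section_scheme N P"
    unfolding closed_section_scheme_def P_def using assms
    by (auto intro!: simple_function_If_set)
  moreover have "suslin_kernel N P = K \<times> F"
    using sets.sets_into_space[OF assms(2)] by (auto simp: suslin_kernel_def P_def split: if_splits)
  ultimately show ?thesis by (auto simp: suslin_sets_def)
qed

lemma suslin_sets_UN:
  assumes "\<And>i::nat. H i \<in> suslin_sets N"
  shows "(\<Union>i. H i) \<in> suslin_sets N"
proof -
  have "\<exists>P. \<forall>i. closed_section_scheme N (P i) \<and> H i = suslin_kernel N (P i)"
    using assms by (intro choice) (force simp: suslin_sets_def)
  then obtain P where P: "\<And>i. closed_section_scheme N (P i)" "\<And>i. H i = suslin_kernel N (P i)"
    by blast
  \<comment> \<open>The head of the list codes the index \<open>i\<close> together with the head of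
    the branch for \<open>P i\<close>. At the root \<open>i\<close> is not known yet, so the root
    condition \<open>P i []\<close> is imposed at every later node.\<close>
  define R where "R l y = (case l of [] \<Rightarrow> UNIV
     | x # l' \<Rightarrow> P (fst (prod_decode x)) (snd (prod_decode x) # l') y \<inter> P (fst (prod_decode x)) [] y)"
    for l :: "nat list" and y
  have "closed_section_scheme N R"
    unfolding closed_section_scheme_def
  proof (intro allI conjI)
    fix l
    have *: "simple_function N (P i m)" "closed (P i m y)" for i m y
      using P(1) by (auto simp: closed_section_scheme_def)
    show "simple_function N (R l)"
      using * unfolding R_def by (cases l) (auto intro: simple_function_compose2[where h="(\<inter>)"])
    fix y show "closed (R l y)"
      using * unfolding R_def by (cases l) auto
  qed
  moreover have "suslin_kernel N R = (\<Union>i. H i)"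
  proof safe
    fix t y assume "(t, y) \<in> suslin_kernel N R"
    then obtain \<sigma> where y: "y \<in> space N" and \<sigma>: "\<And>n. t \<in> R (map \<sigma> [0..<n]) y"
      by (auto simp: suslin_kernel_def)
    define i \<tau> where "i = fst (prod_decode (\<sigma> 0))" and "\<tau> = \<sigma>(0 := snd (prod_decode (\<sigma> 0)))"
    have "t \<in> P i (map \<tau> [0..<n]) y" for n
    proof (cases n)
      case 0
      then show ?thesis using \<sigma>[of 1] by (simp add: R_def i_def)
    next
      case (Suc m)
      have eq: "map g [0..<Suc m] = g 0 # map g [Suc 0..<Suc m]" for g :: "nat \<Rightarrow> nat"
        by (subst upt_conv_Cons) auto
      have "map \<sigma> [Suc 0..<Suc m] = map \<tau> [Suc 0..<Suc m]" by (auto simp: \<tau>_def)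
      then show ?thesis using \<sigma>[of n] unfolding Suc eq
        by (auto simp add: R_def i_def \<tau>_def simp del: upt_Suc)
    qed
    then show "(t, y) \<in> (\<Union>i. H i)" using y P by (auto simp: suslin_kernel_def)
  next
    fix t y i assume "(t, y) \<in> H i"
    then obtain \<tau> where y: "y \<in> space N" and \<tau>: "\<And>n. t \<in> P i (map \<tau> [0..<n]) y"
      by (auto simp: suslin_kernel_def P)
    define \<sigma> where "\<sigma> = \<tau>(0 := prod_encode (i, \<tau> 0))"
    have "t \<in> R (map \<sigma> [0..<n]) y" for n
    proof (cases n)
      case 0
      then show ?thesis by (simp add: R_def)
    next
      case (Suc m)
      have eq: "map g [0..<Suc m] = g 0 # map g [Suc 0..<Suc m]" for g :: "nat \<Rightarrow> nat"
        by (subst upt_conv_Cons) auto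
      have e: "map \<sigma> [Suc 0..<Suc m] = map \<tau> [Suc 0..<Suc m]" by (auto simp: \<sigma>_def)
      show ?thesis using \<tau>[of n] \<tau>[of 0] unfolding Suc eq e
        by (auto simp add: R_def \<sigma>_def simp del: upt_Suc)
    qed
    then show "(t, y) \<in> suslin_kernel N R" using y by (auto simp: suslin_kernel_def)
  qed
  ultimately show ?thesis by (auto simp: suslin_sets_def)
qed

lemma suslin_sets_INT:
  assumes "\<And>i::nat. H i \<in> suslin_sets N"
  shows "(\<Inter>i. H i) \<in> suslin_sets N"
proof -
  have "\<exists>P. \<forall>i. closed_section_scheme N (P i) \<and> H i = suslin_kernel N (P i)"
    using assms by (intro choice) (force simp: suslin_sets_def)
  then obtain P where P: "\<And>i. closed_section_scheme N (P i)" "\<And>i. H i = suslin_kernel N (P i)"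
    by blast
  \<comment> \<open>One sequence codes countably many branches through \<open>prod_encode\<close>,
    and \<open>J l\<close> collects the pairs \<open>(j, k)\<close> for which \<open>l\<close>
    already determines the first \<open>k\<close> entries of the branch for \<open>P j\<close>. The
    length bounds keep \<open>J l\<close> finite, so that \<open>R l\<close> is again
    simple.\<close>
  define J where "J l = {(j, k). j \<le> length l \<and> k \<le> length l \<and> (\<forall>i<k. prod_encode (j, i) < length l)}"
    for l :: "nat list"
  define R where "R l y = (\<Inter>(j, k) \<in> J l. P j (map (\<lambda>i. l ! prod_encode (j, i)) [0..<k]) y)"
    for l :: "nat list" and y
  have fin: "finite (J l)" for l
    by (rule finite_subset[of _ "{..length l} \<times> {..length l}"]) (auto simp: J_def)
  have "closed_section_scheme N R"
    unfolding closed_section_scheme_def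
  proof (intro allI conjI)
    fix l
    show "simple_function N (R l)"
      unfolding R_def case_prod_beta
      by (intro simple_function_INT[OF fin]) (use P(1) in \<open>auto simp: closed_section_scheme_def\<close>)
    fix y show "closed (R l y)"
      unfolding R_def case_prod_beta
      by (intro closed_INT) (use P(1) in \<open>auto simp: closed_section_scheme_def\<close>)
  qed
  moreover have "suslin_kernel N R = (\<Inter>i. H i)"
  proof safe
    fix t y j assume "(t, y) \<in> suslin_kernel N R"
    then obtain \<sigma> where y: "y \<in> space N" and \<sigma>: "\<And>n. t \<in> R (map \<sigma> [0..<n]) y"
      by (auto simp: suslin_kernel_def)
    define \<tau> where "\<tau> i = \<sigma> (prod_encode (j, i))" for i
    have "t \<in> P j (map \<tau> [0..<k]) y" for k
    proof -
      \<comment> \<open>\<open>n\<close> exceeds \<open>j\<close>, \<open>k\<close> and every code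
        used by the first \<open>k\<close> entries of branch \<open>j\<close>, which puts
        \<open>(j, k)\<close> into \<open>J\<close>.\<close>
      define n where "n = Suc (Max (insert j (insert k ((\<lambda>i. prod_encode (j, i)) ` {..<k}))))"
      have le: "m < n" if "m \<in> insert j (insert k ((\<lambda>i. prod_encode (j, i)) ` {..<k}))" for m
        unfolding n_def less_Suc_eq_le using that by (intro Max_ge) auto
      have "(j, k) \<in> J (map \<sigma> [0..<n])"
        using le by (force simp: J_def intro: less_imp_le)
      then have "t \<in> P j (map (\<lambda>i. map \<sigma> [0..<n] ! prod_encode (j, i)) [0..<k]) y"
        using \<sigma>[of n] by (auto simp: R_def)
      also have "map (\<lambda>i. map \<sigma> [0..<n] ! prod_encode (j, i)) [0..<k] = map \<tau> [0..<k]"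
        using le by (auto simp: \<tau>_def)
      finally show ?thesis .
    qed
    then show "(t, y) \<in> H j" using y P by (auto simp: suslin_kernel_def)
  next
    fix t y assume *: "(t, y) \<in> (\<Inter>i. H i)"
    then have y: "y \<in> space N" by (auto simp: suslin_kernel_def P)
    have "\<forall>j. \<exists>\<tau>. \<forall>n. t \<in> P j (map \<tau> [0..<n]) y" using * by (auto simp: suslin_kernel_def P)
    then obtain \<tau> where \<tau>: "\<And>j n. t \<in> P j (map (\<tau> j) [0..<n]) y" by metis
    define \<sigma> where "\<sigma> m = (case prod_decode m of (j, i) \<Rightarrow> \<tau> j i)" for m
    have "t \<in> R (map \<sigma> [0..<n]) y" for n
      unfolding R_def
    proof safe
      fix j k assume "(j, k) \<in> J (map \<sigma> [0..<n])"
      then have "map (\<lambda>i. map \<sigma> [0..<n] ! prod_encode (j, i)) [0..<k] = map (\<tau> j) [0..<k]"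
        by (auto simp: J_def \<sigma>_def)
      then show "t \<in> P j (map (\<lambda>i. map \<sigma> [0..<n] ! prod_encode (j, i)) [0..<k]) y"
        using \<tau>[of j k] by (simp only:)
    qed
    then show "(t, y) \<in> suslin_kernel N R" using y by (auto simp: suslin_kernel_def)
  qed
  ultimately show ?thesis by (auto simp: suslin_sets_def)
qed

lemma suslin_sets_empty: "{} \<in> suslin_sets N"
  using suslin_sets_rectangle[of "{}" "{}" N] by simp

lemma suslin_sets_Un:
  assumes "G \<in> suslin_sets N" "H \<in> suslin_sets N"
  shows "G \<union> H \<in> suslin_sets N"
proof -
  have "(\<Union>i::nat. if i = 0 then G else H) \<in> suslin_sets N"
    using assms by (intro suslin_sets_UN) auto
  also have "(\<Union>i::nat. if i = 0 then G else H) = G \<union> H" by (auto split: if_splits)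
  finally show ?thesis .
qed

text \<open>Suslin sets need not be closed under complements. The induction therefore carries a set
  together with its complement; such pairs survive countable unions because Suslin sets admit both
  countable unions and countable intersections.\<close>

lemma suslin_sets_borel_rectangle:
  assumes A: "A \<in> sets borel" and F: "F \<in> sets N"
  shows "A \<times> F \<in> suslin_sets N \<and> (- A) \<times> F \<in> suslin_sets N"
proof -
  have "A \<in> sigma_sets UNIV (range (\<lambda>a::real. {..a}))"
    using A unfolding borel_eq_atMost by (simp only: sets_measure_of subset_UNIV Pow_UNIV)
  then show ?thesis
  proof induction
    case (Basic a)
    then obtain x where a: "a = {..x}" by auto
    have "(\<Union>n::nat. {x + 1 / real (Suc n)..} \<times> F) \<in> suslin_sets N"
      by (intro suslin_sets_UN suslin_sets_rectangle F) auto
    also have "(\<Union>n::nat. {x + 1 / real (Suc n)..} \<times> F) = (- a) \<times> F"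
    proof -
      have "(\<exists>n::nat. x + 1 / real (Suc n) \<le> u) \<longleftrightarrow> x < u" for u
      proof
        assume "\<exists>n::nat. x + 1 / real (Suc n) \<le> u"
        then obtain n :: nat where "x + 1 / real (Suc n) \<le> u" ..
        moreover have "0 < 1 / real (Suc n)" by simp
        ultimately show "x < u" by linarith
      next
        assume "x < u"
        then obtain n where "1 / real (Suc n) < u - x"
          using nat_approx_posE[of "u - x"] by auto
        then show "\<exists>n::nat. x + 1 / real (Suc n) \<le> u" by (intro exI[of _ n]) linarith
      qed
      then show ?thesis by (auto simp: a not_le)
    qed
    finally show ?case using F by (auto simp: a intro: suslin_sets_rectangle)
  next
    case Empty
    then show ?case using F suslin_sets_rectangle[of UNIV F N] by (simp add: suslin_sets_empty)
  next
    case (Compl a)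
    then show ?case unfolding Compl_eq_Diff_UNIV[symmetric] double_compl by blast
  next
    case (Union a)
    have "(\<Union>i. a i \<times> F) \<in> suslin_sets N" "(\<Inter>i. (- a i) \<times> F) \<in> suslin_sets N"
      using Union by (auto intro!: suslin_sets_UN suslin_sets_INT)
    moreover have "(\<Union>i. a i \<times> F) = (\<Union>i. a i) \<times> F" "(\<Inter>i. (- a i) \<times> F) = (- (\<Union>i. a i)) \<times> F"
      by auto
    ultimately show ?case by simp
  qed
qed

lemma sets_pair_subset_suslin_sets:
  assumes "H \<in> sets (borel \<Otimes>\<^sub>M N)"
  shows "H \<in> suslin_sets N"
proof -
  have "H \<in> sigma_sets (UNIV \<times> space N) {a \<times> b | a b. a \<in> sets borel \<and> b \<in> sets N}"
    using assms by (simp add: sets_pair_measure)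
  then have "H \<in> suslin_sets N \<and> (UNIV \<times> space N) - H \<in> suslin_sets N"
  proof induction
    case (Basic H)
    then obtain a b where H: "H = a \<times> b" "a \<in> sets borel" "b \<in> sets N" by auto
    have "UNIV \<times> space N - H = (- a) \<times> space N \<union> UNIV \<times> (space N - b)"
      using H sets.sets_into_space[OF H(3)] by auto
    moreover have "(- a) \<times> space N \<union> UNIV \<times> (space N - b) \<in> suslin_sets N"
    proof (rule suslin_sets_Un)
      show "(- a) \<times> space N \<in> suslin_sets N"
        using suslin_sets_borel_rectangle[OF H(2) sets.top[of N]] by blast
      show "UNIV \<times> (space N - b) \<in> suslin_sets N"
        using H(3) by (intro suslin_sets_rectangle) auto
    qed
    moreover have "H \<in> suslin_sets N"
      unfolding H(1) using suslin_sets_borel_rectangle[OF H(2,3)] by blast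
    ultimately show ?case by simp
  next
    case Empty
    have "UNIV \<times> space N \<in> suslin_sets N" by (intro suslin_sets_rectangle) auto
    then show ?case by (simp add: suslin_sets_empty)
  next
    case (Compl a)
    have "a \<subseteq> UNIV \<times> space N"
      using Compl(1) by (rule sigma_sets_into_sp[rotated]) (auto dest: sets.sets_into_space)
    then have "UNIV \<times> space N - (UNIV \<times> space N - a) = a" by blast
    then show ?case using Compl by metis
  next
    case (Union a)
    have "UNIV \<times> space N - (\<Union>i. a i) = (\<Inter>i. UNIV \<times> space N - a i)" by auto
    moreover have "(\<Union>i. a i) \<in> suslin_sets N" "(\<Inter>i. UNIV \<times> space N - a i) \<in> suslin_sets N"
      using Union by (intro suslin_sets_UN suslin_sets_INT; blast)+
    ultimately show ?case by metis
  qed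
  then show ?thesis ..
qed

section \<open>Capacitability of Suslin sets\<close>

definition bounded_kernel :: "'b measure \<Rightarrow> (nat list \<Rightarrow> 'b \<Rightarrow> real set) \<Rightarrow> nat list \<Rightarrow> (real \<times> 'b) set" where
  "bounded_kernel N P b = {(t, y). y \<in> space N \<and>
     (\<exists>\<sigma>::nat \<Rightarrow> nat. (\<forall>i<length b. \<sigma> i \<le> b ! i) \<and> (\<forall>n. t \<in> P (map \<sigma> [0..<n]) y))}"

lemma bounded_kernel_append:
  "bounded_kernel N P b = (\<Union>j. bounded_kernel N P (b @ [j]))"
proof safe
  fix t y assume "(t, y) \<in> bounded_kernel N P b"
  then obtain \<sigma> where "y \<in> space N" and "\<forall>i<length b. \<sigma> i \<le> b ! i" and "\<forall>n. t \<in> P (map \<sigma> [0..<n]) y"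
    by (auto simp: bounded_kernel_def)
  then have "(t, y) \<in> bounded_kernel N P (b @ [\<sigma> (length b)])"
    by (auto simp: bounded_kernel_def nth_append less_Suc_eq intro!: exI[of _ \<sigma>])
  then show "(t, y) \<in> (\<Union>j. bounded_kernel N P (b @ [j]))" by auto
next
  fix t y j assume "(t, y) \<in> bounded_kernel N P (b @ [j])"
  then obtain \<sigma> where "y \<in> space N" and \<sigma>: "\<forall>i<Suc (length b). \<sigma> i \<le> (b @ [j]) ! i"
      and "\<forall>n. t \<in> P (map \<sigma> [0..<n]) y"
    by (auto simp: bounded_kernel_def)
  moreover have "\<sigma> i \<le> b ! i" if "i < length b" for i
    using \<sigma>[rule_format, of i] that by (simp add: nth_append)
  ultimately show "(t, y) \<in> bounded_kernel N P b"
    by (auto simp: bounded_kernel_def intro!: exI[of _ \<sigma>])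
qed

text \<open>The entries of \<open>b\<close> are upper bounds rather than exact values so that the
  kernels increase in the last entry: outer measure is continuous along increasing sequences, even
  of nonmeasurable sets.\<close>

lemma bounded_kernel_incseq: "incseq (\<lambda>j. bounded_kernel N P (b @ [j]))"
proof (intro monoI subsetI)
  fix j k :: nat and x assume "j \<le> k" "x \<in> bounded_kernel N P (b @ [j])"
  moreover have "\<sigma> i \<le> (b @ [k]) ! i" if "\<forall>i<Suc (length b). \<sigma> i \<le> (b @ [j]) ! i" "i < Suc (length b)" for \<sigma> i
    using that(1)[rule_format, OF that(2)] that(2) \<open>j \<le> k\<close>
    by (auto simp: nth_append less_Suc_eq)
  ultimately show "x \<in> bounded_kernel N P (b @ [k])"
    by (auto simp: bounded_kernel_def)
qed

text \<open>Dependent choice on finite lists; since each list extends the previous one, all are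
  prefixes of one branch.\<close>

lemma list_chain:
  assumes "P []" "\<And>u. P u \<Longrightarrow> \<exists>j. P (u @ [j])"
  shows "\<exists>\<sigma>::nat \<Rightarrow> 'x. \<forall>n. P (map \<sigma> [0..<n])"
proof -
  have "\<exists>f. \<forall>n. (length (f n) = n \<and> P (f n)) \<and> (\<exists>j. f (Suc n) = f n @ [j])"
  proof (rule dependent_nat_choice)
    show "\<exists>u. length u = 0 \<and> P u" using assms(1) by auto
    fix u n assume "length u = n \<and> P u"
    then show "\<exists>v. (length v = Suc n \<and> P v) \<and> (\<exists>j. v = u @ [j])" using assms(2)[of u]
      by (metis length_append_singleton)
  qed
  then obtain f where f: "\<And>n. length (f n) = n" "\<And>n. P (f n)" "\<And>n. \<exists>j. f (Suc n) = f n @ [j]"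
    by auto
  define \<sigma> where "\<sigma> i = f (Suc i) ! i" for i
  have "f n = map \<sigma> [0..<n]" for n
  proof (induction n)
    case 0
    then show ?case using f(1)[of 0] by simp
  next
    case (Suc n)
    obtain j where "f (Suc n) = f n @ [j]" using f(3) by blast
    moreover have "\<sigma> n = j" using calculation f(1)[of n] by (simp add: \<sigma>_def nth_append)
    ultimately show ?case using Suc by simp
  qed
  then show ?thesis using f(2) by metis
qed

text \<open>Koenig's lemma for the tree of admissible lists below \<open>g\<close>. A list is
  \<open>good\<close> if it extends to admissible lists of every length. If no child of a good list
  were good, each of its finitely many children would die out at some level, and no extension could
  reach the largest such level \<open>K\<close>.\<close>

lemma koenig_boxes:
  fixes g :: "nat \<Rightarrow> nat" and ok :: "nat list \<Rightarrow> bool"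
  assumes ex: "\<And>k. \<exists>l. length l = k \<and> (\<forall>i<k. l ! i \<le> g i) \<and> (\<forall>n\<le>k. ok (take n l))"
  shows "\<exists>\<sigma>. \<forall>n. ok (map \<sigma> [0..<n])"
proof -
  define W where "W k = {l. length l = k \<and> (\<forall>i<k. l ! i \<le> g i) \<and> (\<forall>n\<le>k. ok (take n l))}" for k
  define good where "good u \<longleftrightarrow> (\<forall>k\<ge>length u. \<exists>l\<in>W k. take (length u) l = u)" for u
  have W_take: "take m l \<in> W m" if "l \<in> W k" "m \<le> k" for l m k
    using that by (auto simp: W_def min_def)
  have "good []" using ex by (auto simp: good_def W_def)
  have step: "\<exists>j. good (u @ [j])" if u: "good u" for u
  proof (rule ccontr)
    assume "\<nexists>j. good (u @ [j])"
    then have "\<forall>j. \<exists>k\<ge>Suc (length u). \<forall>l\<in>W k. take (Suc (length u)) l \<noteq> u @ [j]"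
      by (auto simp: good_def)
    then obtain \<kappa> where \<kappa>: "\<And>j. \<kappa> j \<ge> Suc (length u)"
        "\<And>j l. l \<in> W (\<kappa> j) \<Longrightarrow> take (Suc (length u)) l \<noteq> u @ [j]" by metis
    define K where "K = Max (\<kappa> ` {..g (length u)})"
    have K: "\<kappa> j \<le> K" if "j \<le> g (length u)" for j
      unfolding K_def using that by (intro Max_ge) auto
    have "Suc (length u) \<le> K" using \<kappa>(1)[of 0] K[of 0] by linarith
    then have "length u \<le> K" by simp
    then obtain l where l: "l \<in> W K" "take (length u) l = u"
      using u unfolding good_def by blast
    define j where "j = l ! length u"
    have lK: "length l = K" "j \<le> g (length u)"
      using l \<open>Suc (length u) \<le> K\<close> by (auto simp: W_def j_def)
    have "take (Suc (length u)) (take (\<kappa> j) l) = u @ [j]"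
      using \<kappa>(1)[of j] l(2) \<open>Suc (length u) \<le> K\<close> lK
      by (simp add: min_def take_Suc_conv_app_nth j_def)
    then show False using \<kappa>(2)[OF W_take[OF l(1) K[OF lK(2)]]] by simp
  qed
  obtain \<sigma> where \<sigma>: "\<And>n. good (map \<sigma> [0..<n])"
    using list_chain[of good, OF \<open>good []\<close> step] by blast
  have "ok (map \<sigma> [0..<n])" for n
  proof -
    obtain l where "l \<in> W n" "take n l = map \<sigma> [0..<n]"
      using \<sigma>[of n] by (auto simp: good_def)
    then show ?thesis by (auto simp: W_def)
  qed
  then show ?thesis by blast
qed

text \<open>Choquet's capacitability argument: bound the coordinates of \<open>\<sigma>\<close> one after the other
  without losing outer measure; boundedness turns the kernel into a decreasing intersection of
  sets with compact sections, whose projections are measurable.\<close>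

lemma suslin_bounded_inner_approx:
  assumes fin: "finite_measure N" and H: "H \<in> suslin_sets N" and r: "H \<subseteq> {-r..r} \<times> UNIV"
    and c: "c < outer_measure_of N (snd ` H)"
  shows "\<exists>A\<in>sets N. A \<subseteq> snd ` H \<and> c \<le> emeasure N A"
proof -
  interpret finite_measure N by fact
  obtain P where P: "closed_section_scheme N P" "H = suslin_kernel N P"
    using H by (auto simp: suslin_sets_def)
  let ?I = "\<lambda>b. outer_measure_of N (snd ` bounded_kernel N P b)"
  have nil: "bounded_kernel N P [] = H" by (auto simp: bounded_kernel_def P suslin_kernel_def)
  have step: "\<exists>j. c < ?I (b @ [j])" if "c < ?I b" for b
  proof -
    have "?I b = outer_measure_of N (\<Union>j. snd ` bounded_kernel N P (b @ [j]))"
      by (subst bounded_kernel_append) (simp add: image_UN)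
    also have "\<dots> = (SUP j. ?I (b @ [j]))"
      using bounded_kernel_incseq[of N P b]
      by (intro SUP_outer_measure_of_incseq[symmetric])
        (auto simp: mono_def bounded_kernel_def image_def subset_iff intro!: le_funI, blast?)
    finally show ?thesis using that by (auto simp: less_SUP_iff)
  qed
  have "c < ?I []" using c nil by simp
  then obtain g where g: "\<And>n. c < ?I (map g [0..<n])"
    using list_chain[of "\<lambda>b. c < ?I b"] step by blast
  define box where "box k = {l::nat list. length l = k \<and> (\<forall>i<k. l ! i \<le> g i)}" for k
  \<comment> \<open>A finite stage tests only prefixes of length \<open>k\<close> in the box below
    \<open>g\<close>. It contains the sections of the kernel bounded by
    \<open>map g [0..<k]\<close>; finiteness of the box makes it simple in \<open>y\<close>, and the
    cut to \<open>{-r..r}\<close> makes it compact.\<close>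
  define L where "L k y = {-r..r} \<inter> (\<Union>l\<in>box k. \<Inter>n\<in>{..k}. P (take n l) y)" for k y
  have fin_box: "finite (box k)" for k
  proof (rule finite_subset)
    show "box k \<subseteq> {l. set l \<subseteq> {..Max (g ` {..<k})} \<and> length l = k}"
    proof safe
      fix l x assume l: "l \<in> box k" "x \<in> set l"
      then obtain i where "i < k" "x = l ! i" by (auto simp: box_def in_set_conv_nth)
      then have "x \<le> g i" "g i \<le> Max (g ` {..<k})" using l by (auto simp: box_def)
      then show "x \<le> Max (g ` {..<k})" by linarith
    qed (auto simp: box_def)
    show "finite {l. set l \<subseteq> {..Max (g ` {..<k})} \<and> length l = k}"
      by (intro finite_lists_length_eq) auto
  qed
  have simp_L: "simple_function N (L k)" for k
  proof -
    have "simple_function N (\<lambda>y. \<Union>l\<in>box k. \<Inter>n\<in>{..k}. P (take n l) y)"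
      by (intro simple_function_UN simple_function_INT fin_box)
        (use P in \<open>auto simp: closed_section_scheme_def\<close>)
    then have "simple_function N (\<lambda>y. {-r..r} \<inter> (\<Union>l\<in>box k. \<Inter>n\<in>{..k}. P (take n l) y))"
      by (rule simple_function_compose1)
    then show ?thesis by (simp add: L_def[abs_def])
  qed
  have comp_L: "compact (L k y)" for k y
    unfolding L_def
    by (intro compact_Int_closed closed_UN fin_box closed_INT)
      (use P in \<open>auto simp: closed_section_scheme_def\<close>)
  have dec_L: "L (Suc k) y \<subseteq> L k y" for k y
  proof
    fix t assume "t \<in> L (Suc k) y"
    then obtain l where l: "t \<in> {-r..r}" "l \<in> box (Suc k)" "\<forall>n\<le>Suc k. t \<in> P (take n l) y"
      by (auto simp: L_def)
    have "take k l \<in> box k" using l(2) by (auto simp: box_def)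
    moreover have "t \<in> P (take n (take k l)) y" if "n \<le> k" for n
      using l(3) that by (auto simp: min_def)
    ultimately show "t \<in> L k y" using l(1) unfolding L_def by blast
  qed
  have dec_L': "L n y \<subseteq> L m y" if "m \<le> n" for m n y
    using that by (rule lift_Suc_antimono_le[of "\<lambda>k. L k y", rotated]) (rule dec_L)
  define A where "A = (\<Inter>k. {y \<in> space N. L k y \<noteq> {}})"
  have meas: "{y \<in> space N. L k y \<noteq> {}} \<in> sets N" for k
    by (rule simple_function_nonempty_sets[OF simp_L])
  have "c \<le> emeasure N {y \<in> space N. L k y \<noteq> {}}" for k
  proof -
    have "snd ` bounded_kernel N P (map g [0..<k]) \<subseteq> {y \<in> space N. L k y \<noteq> {}}"
    proof
      fix y assume "y \<in> snd ` bounded_kernel N P (map g [0..<k])"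
      then obtain t where *: "(t, y) \<in> bounded_kernel N P (map g [0..<k])" by auto
      then obtain \<sigma> where y: "y \<in> space N" and \<sigma>: "\<forall>i<k. \<sigma> i \<le> g i" "\<forall>n. t \<in> P (map \<sigma> [0..<n]) y"
        by (auto simp: bounded_kernel_def)
      have "(t, y) \<in> H" using y \<sigma> P by (auto simp: suslin_kernel_def)
      then have t: "t \<in> {-r..r}" using r by auto
      have "map \<sigma> [0..<k] \<in> box k" using \<sigma> by (auto simp: box_def)
      moreover have "t \<in> P (take n (map \<sigma> [0..<k])) y" if "n \<le> k" for n
        using \<sigma>(2) that by (simp add: take_map min_def)
      ultimately have "t \<in> L k y" using t by (auto simp: L_def)
      then show "y \<in> {y \<in> space N. L k y \<noteq> {}}" using y by auto
    qed
    then have "?I (map g [0..<k]) \<le> outer_measure_of N {y \<in> space N. L k y \<noteq> {}}"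
      by (rule outer_measure_of_mono)
    then show ?thesis using g[of k] meas by simp
  qed
  moreover have "(\<lambda>k. emeasure N {y \<in> space N. L k y \<noteq> {}}) \<longlonglongrightarrow> emeasure N A"
    unfolding A_def
    by (intro Lim_emeasure_decseq) (use meas dec_L' in \<open>auto simp: decseq_def\<close>, blast)
  ultimately have "c \<le> emeasure N A"
    by (intro LIMSEQ_le_const) auto
  moreover have "A \<in> sets N" using meas by (auto simp: A_def)
  moreover have "A \<subseteq> snd ` H"
  proof
    fix y assume "y \<in> A"
    then have y: "y \<in> space N" "\<And>k. L k y \<noteq> {}" by (auto simp: A_def)
    have "(\<Inter>k. L k y) \<noteq> {}"
      by (rule compact_nest[OF comp_L y(2) dec_L'])
    then obtain t where t: "\<And>k. t \<in> L k y" by auto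
    \<comment> \<open>\<open>t\<close> lies in every \<open>L k y\<close>, but the prefixes that
      witness this for different \<open>k\<close> need not cohere; Koenig's lemma extracts a single
      branch.\<close>
    have "\<exists>\<sigma>. \<forall>n. t \<in> P (map \<sigma> [0..<n]) y"
    proof (rule koenig_boxes)
      fix k
      show "\<exists>l. length l = k \<and> (\<forall>i<k. l ! i \<le> g i) \<and> (\<forall>n\<le>k. t \<in> P (take n l) y)"
        using t[of k] by (auto simp: L_def box_def)
    qed
    then have "(t, y) \<in> H" using y(1) P by (auto simp: suslin_kernel_def)
    then show "y \<in> snd ` H" by force
  qed
  ultimately show ?thesis by blast
qed

text \<open>Time is cut to bounded intervals, on which a measurable cover of the projection is
  exhausted from inside by the approximation lemma. The conclusion speaks of an inner measurable set
  with null remainder, a form that passes to image measures and to sections of a product.\<close>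

theorem measurable_projection:
  fixes H :: "(real \<times> 'b) set"
  assumes fin: "finite_measure N" and H: "H \<in> sets (borel \<Otimes>\<^sub>M N)"
  shows "\<exists>A\<in>sets N. A \<subseteq> snd ` H \<and> (AE y in N. y \<in> snd ` H \<longrightarrow> y \<in> A)"
proof -
  interpret finite_measure N by fact
  define G where "G r = H \<inter> ({- real r..real r} \<times> space N)" for r
  have G_sets: "G r \<in> sets (borel \<Otimes>\<^sub>M N)" for r
    using H by (auto simp: G_def)
  have sp: "snd ` G r \<subseteq> space N" for r by (auto simp: G_def)
  have one: "\<exists>A\<in>sets N. A \<subseteq> snd ` G r \<and> (AE y in N. y \<in> snd ` G r \<longrightarrow> y \<in> A)" for r
  proof (cases "outer_measure_of N (snd ` G r) = 0")
    case True
    obtain E where E: "E \<in> sets N" "snd ` G r \<subseteq> E" "outer_measure_of N (snd ` G r) = emeasure N E"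
      using outer_measure_of_attain[OF sp] by blast
    then have "AE y in N. y \<notin> E" using True by (auto intro!: AE_not_in)
    then show ?thesis using E by (intro bexI[of _ "{}"]) auto
  next
    case False
    obtain E where E: "E \<in> sets N" "snd ` G r \<subseteq> E" "outer_measure_of N (snd ` G r) = emeasure N E"
      using outer_measure_of_attain[OF sp] by blast
    have "0 < emeasure N E" using False E by (simp add: zero_less_iff_neq_zero)
    then obtain c :: "nat \<Rightarrow> ennreal" where c: "\<And>n. c n < emeasure N E" "c \<longlonglongrightarrow> emeasure N E"
      using approx_from_below_dense_linorder[of 0 "emeasure N E"] by blast
    have "\<exists>A\<in>sets N. A \<subseteq> snd ` G r \<and> c n \<le> emeasure N A" for n
      by (rule suslin_bounded_inner_approx[OF fin, of _ r])
        (use sets_pair_subset_suslin_sets[OF G_sets] c(1)[of n] E in \<open>auto simp: G_def\<close>)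
    then obtain A where A: "\<And>n. A n \<in> sets N" "\<And>n. A n \<subseteq> snd ` G r" "\<And>n. c n \<le> emeasure N (A n)"
      by metis
    have "emeasure N E \<le> emeasure N (\<Union>n. A n)"
    proof (rule LIMSEQ_le_const2[OF c(2)], intro exI allI impI)
      fix n
      have "emeasure N (A n) \<le> emeasure N (\<Union>n. A n)" using A by (intro emeasure_mono) auto
      then show "c n \<le> emeasure N (\<Union>n. A n)" using A(3)[of n] by simp
    qed
    moreover have sub: "(\<Union>n. A n) \<subseteq> E" using A E by blast
    moreover have "emeasure N (E - (\<Union>n. A n)) = emeasure N E - emeasure N (\<Union>n. A n)"
      using A E sub by (intro emeasure_Diff) auto
    ultimately have "emeasure N (E - (\<Union>n. A n)) = 0"
      by (simp add: diff_eq_0_iff_ennreal less_top emeasure_eq_measure)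
    then have "AE y in N. y \<notin> E - (\<Union>n. A n)" using A E by (intro AE_not_in) auto
    then have "AE y in N. y \<in> snd ` G r \<longrightarrow> y \<in> (\<Union>n. A n)" by eventually_elim (use E in auto)
    then show ?thesis using A by (intro bexI[of _ "\<Union>n. A n"]) auto
  qed
  then obtain A where A: "\<And>r. A r \<in> sets N" "\<And>r. A r \<subseteq> snd ` G r"
      "\<And>r. AE y in N. y \<in> snd ` G r \<longrightarrow> y \<in> A r" by metis
  have HG: "snd ` H = (\<Union>r. snd ` G r)"
  proof -
    have "H \<subseteq> UNIV \<times> space N" using sets.sets_into_space[OF H] by (simp add: space_pair_measure)
    moreover have "\<exists>r. - real r \<le> t \<and> t \<le> real r" for t
      using real_arch_simple[of "\<bar>t\<bar>"] by (metis abs_le_iff minus_le_iff)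
    ultimately have "H = (\<Union>r. G r)" by (fastforce simp: G_def)
    then show ?thesis by (metis image_UN)
  qed
  have "AE y in N. \<forall>r. y \<in> snd ` G r \<longrightarrow> y \<in> A r" using A(3) by (simp add: AE_all_countable)
  then have "AE y in N. y \<in> snd ` H \<longrightarrow> y \<in> (\<Union>r. A r)" unfolding HG by eventually_elim auto
  moreover have "(\<Union>r. A r) \<subseteq> snd ` H" unfolding HG using A(2) by blast
  ultimately show ?thesis using A(1) by (intro bexI[of _ "\<Union>r. A r"]) auto
qed

text \<open>Although the exceptional event need not be measurable, its being null depends only on the
  distribution of \<open>f\<close>.\<close>

lemma AE_projection_distr_cong:
  fixes H :: "(real \<times> 'b) set"
  assumes H: "H \<in> sets (borel \<Otimes>\<^sub>M N)"
    and M: "prob_space M1" "prob_space M2" and f: "f \<in> measurable M1 N" "g \<in> measurable M2 N"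
    and eq: "distr M1 N f = distr M2 N g"
    and AE: "AE \<omega> in M1. f \<omega> \<notin> snd ` H"
  shows "AE \<omega> in M2. g \<omega> \<notin> snd ` H"
proof -
  interpret M1: prob_space M1 by fact
  interpret D: prob_space "distr M1 N f" by (rule M1.prob_space_distr[OF f(1)])
  have "H \<in> sets (borel \<Otimes>\<^sub>M distr M1 N f)"
    using H by (simp cong: sets_pair_measure_cong)
  from measurable_projection[OF D.finite_measure_axioms this]
  obtain A where A: "A \<in> sets N" "A \<subseteq> snd ` H"
      "AE y in distr M1 N f. y \<in> snd ` H \<longrightarrow> y \<in> A" by auto
  have "AE \<omega> in M1. f \<omega> \<notin> A" using AE by eventually_elim (use A in auto)
  then have "AE y in distr M1 N f. y \<notin> A" using A f by (subst AE_distr_iff) auto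
  with A(3) have "AE y in distr M1 N f. y \<notin> snd ` H" by eventually_elim auto
  then show ?thesis unfolding eq using f(2) by (rule AE_distrD[rotated])
qed

text \<open>Fubini does not apply to the projection itself. Its measurable inner set
  \<open>A\<close> has null sections, so \<open>A\<close> is null, and the remainder is null by the
  choice of \<open>A\<close>.\<close>

lemma AE_projection_pair:
  fixes H :: "(real \<times> 'a \<times> 'b) set"
  assumes H: "H \<in> sets (borel \<Otimes>\<^sub>M (K \<Otimes>\<^sub>M N))" and prob: "prob_space K" "prob_space N"
    and AE: "\<And>x. x \<in> space K \<Longrightarrow> AE y in N. (x, y) \<notin> snd ` H"
  shows "AE z in K \<Otimes>\<^sub>M N. z \<notin> snd ` H"
proof -
  interpret K: prob_space K by fact
  interpret N: prob_space N by fact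
  interpret P: pair_prob_space K N ..
  from measurable_projection[OF P.finite_measure_axioms H]
  obtain A where A: "A \<in> sets (K \<Otimes>\<^sub>M N)" "A \<subseteq> snd ` H"
      "AE z in K \<Otimes>\<^sub>M N. z \<in> snd ` H \<longrightarrow> z \<in> A" by blast
  have "AE x in K. AE y in N. (x, y) \<notin> A"
  proof (rule AE_I2)
    fix x assume "x \<in> space K"
    from AE[OF this] show "AE y in N. (x, y) \<notin> A" by eventually_elim (use A in auto)
  qed
  moreover have "{z \<in> space (K \<Otimes>\<^sub>M N). z \<notin> A} \<in> sets (K \<Otimes>\<^sub>M N)" using A by measurable
  ultimately have "AE z in K \<Otimes>\<^sub>M N. z \<notin> A"
    by (intro P.AE_pair_measure) auto
  with A(3) show ?thesis by eventually_elim auto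
qed

section \<open>The Markov property on rational times\<close>

definition rat_times :: "real set" where
  "rat_times = {q. q \<in> \<rat> \<and> 0 \<le> q}"

text \<open>A right-continuous path is determined by its values at these countably many times, and
  countable conditions on them are measurable in the product.\<close>

definition path_space :: "(real \<Rightarrow> 'a::euclidean_space) measure" where
  "path_space = PiM rat_times (\<lambda>_. borel)"

text \<open>Puts finitely many rational times on one equidistant grid, on which the increments are
  independent and identically distributed.\<close>

lemma rat_times_common_denominator:
  assumes "finite F" "F \<subseteq> rat_times"
  shows "\<exists>N>0::nat. \<forall>q\<in>F. \<exists>k::nat. q = real k / real N"
  using assms
proof (induction F rule: finite_induct)
  case (insert q F)
  then obtain N :: nat where N: "N > 0" "\<forall>q\<in>F. \<exists>k::nat. q = real k / real N" by auto
  from insert have "q \<in> \<rat>" "0 \<le> q" by (auto simp: rat_times_def)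
  then obtain m n :: nat where n: "n \<noteq> 0" "\<bar>q\<bar> = real m / real n"
    using Rats_abs_nat_div_natE by metis
  have "\<exists>k::nat. r = real k / real (N * n)" if "r \<in> insert q F" for r
  proof (cases "r = q")
    case True
    then show ?thesis using n N \<open>0 \<le> q\<close> by (intro exI[of _ "m * N"]) (auto simp: field_simps)
  next
    case False
    with that have "r \<in> F" by simp
    then obtain k :: nat where "r = real k / real N" using N by blast
    then show ?thesis using n by (intro exI[of _ "k * n"]) (auto simp: field_simps)
  qed
  then show ?case using N n by (intro exI[of _ "N * n"]) auto
qed (auto intro: exI[of _ 1])

lemma countable_rat_times: "countable rat_times"
  unfolding rat_times_def by (rule countable_subset[OF _ countable_rat]) auto

lemma rat_times_closed [simp, intro]:
  "0 \<in> rat_times" "p \<in> rat_times \<Longrightarrow> q \<in> rat_times \<Longrightarrow> p + q \<in> rat_times"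
  "real k / 2 ^ n \<in> rat_times"
  by (auto simp: rat_times_def)

lemma rat_times_nonneg: "q \<in> rat_times \<Longrightarrow> 0 \<le> q"
  by (simp add: rat_times_def)

lemma rat_times_diff: "p \<in> rat_times \<Longrightarrow> q \<in> rat_times \<Longrightarrow> p \<le> q \<Longrightarrow> q - p \<in> rat_times"
  by (auto simp: rat_times_def)

lemma rat_times_between:
  assumes "0 \<le> s" "s < t"
  obtains q where "q \<in> rat_times" "s < q" "q < t"
  using Rats_dense_in_real[OF assms(2)] assms(1) by (auto simp: rat_times_def)

context levy_process
begin

definition grid_incr :: "real \<Rightarrow> nat \<Rightarrow> 'w \<Rightarrow> 'a" where
  "grid_incr h i \<omega> = X (real (Suc i) * h) \<omega> - X (real i * h) \<omega>"

definition path_trace :: "'w \<Rightarrow> real \<Rightarrow> 'a" where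
  "path_trace \<omega> = (\<lambda>q\<in>rat_times. X q \<omega>)"

definition shifted_trace :: "real \<Rightarrow> 'w \<Rightarrow> real \<Rightarrow> 'a" where
  "shifted_trace p \<omega> = (\<lambda>q\<in>rat_times. X (p + q) \<omega> - X p \<omega>)"

lemma measurable_X_rat: "p \<in> rat_times \<Longrightarrow> random_variable borel (X p)"
  by (intro measurable_X rat_times_nonneg)

lemma measurable_path_trace [measurable]: "path_trace \<in> measurable M path_space"
  unfolding path_trace_def[abs_def] path_space_def
  by (intro measurable_restrict measurable_X) (rule rat_times_nonneg)

lemma measurable_shifted_trace [measurable]:
  assumes "p \<in> rat_times"
  shows "shifted_trace p \<in> measurable M path_space"
  unfolding shifted_trace_def[abs_def] path_space_def
  using assms by (intro measurable_restrict borel_measurable_diff measurable_X)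
    (auto intro!: rat_times_nonneg)

lemma measurable_grid_incr: "0 \<le> h \<Longrightarrow> random_variable borel (grid_incr h i)"
  unfolding grid_incr_def[abs_def] by (intro borel_measurable_diff measurable_X) auto

lemma grid_incr_indep: "0 \<le> h \<Longrightarrow> indep_vars (\<lambda>_. borel) (grid_incr h) {..<m}"
  using indep_increments[of "\<lambda>i. real i * h" m]
  by (simp add: grid_incr_def[abs_def] mono_def mult_right_mono)

lemma grid_incr_law: "0 \<le> h \<Longrightarrow> distr M borel (grid_incr h i) = distr M borel (X h)"
  using stationary_increments[of "real i * h" h]
  by (simp add: grid_incr_def[abs_def] algebra_simps)

text \<open>The right-hand side does not contain \<open>k\<close>: the increments after
  \<open>k\<close> grid steps have the joint law of those from the start. Positive \<open>L\<close>
  gives the nonempty index set that the product characterization of independence asks for.\<close>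

lemma grid_incr_shift_law:
  assumes h: "0 \<le> h" and L: "0 < L"
  shows "distr M (PiM {..<L} (\<lambda>_. borel)) (\<lambda>\<omega>. \<lambda>i\<in>{..<L}. grid_incr h (k + i) \<omega>)
       = PiM {..<L} (\<lambda>_. distr M borel (X h))"
proof -
  have "indep_vars (\<lambda>_. borel) (\<lambda>i \<omega>. X (real (k + Suc i) * h) \<omega> - X (real (k + i) * h) \<omega>) {..<L}"
    using indep_increments[of "\<lambda>i. real (k + i) * h" L] h
    by (simp add: mono_def mult_right_mono)
  then have "indep_vars (\<lambda>_. borel) (\<lambda>i. grid_incr h (k + i)) {..<L}"
    by (simp add: grid_incr_def[abs_def])
  then show ?thesis
    using L h by (subst (asm) indep_vars_iff_distr_eq_PiM')
      (auto simp: grid_incr_law measurable_grid_incr)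
qed

lemma sum_grid_incr: "(\<Sum>i<k. grid_incr h (j + i) \<omega>) = X (real (j + k) * h) \<omega> - X (real j * h) \<omega>"
  by (induction k) (simp_all add: grid_incr_def algebra_simps)

lemma finite_dimensional_markov:
  assumes p: "p \<in> rat_times" and J: "finite J" "J \<subseteq> rat_times"
    and A: "A \<in> sets borel" and B: "\<And>q. q \<in> J \<Longrightarrow> B q \<in> sets borel"
  shows "prob {\<omega> \<in> space M. X p \<omega> \<in> A \<and> (\<forall>q\<in>J. X (p + q) \<omega> - X p \<omega> \<in> B q)}
       = prob {\<omega> \<in> space M. X p \<omega> \<in> A} * prob {\<omega> \<in> space M. \<forall>q\<in>J. X q \<omega> \<in> B q}"
proof -
  obtain N :: nat where N: "N > 0" "\<forall>q\<in>insert p J. \<exists>k::nat. q = real k / real N"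
    using rat_times_common_denominator[of "insert p J"] p J by auto
  then obtain m where m: "\<And>q. q \<in> insert p J \<Longrightarrow> q = real (m q) / real N" by metis
  \<comment> \<open>On the grid of mesh \<open>h\<close>, \<open>X p\<close> is almost surely a
    function of the first \<open>k\<close> increments, and each \<open>X (p + q) - X p\<close> is a
    function of the next \<open>L\<close>. The successor makes \<open>L\<close> positive and larger
    than every \<open>m q\<close>.\<close>
  define h k L where "h = 1 / real N" and "k = m p" and "L = Suc (Max (insert 0 (m ` J)))"
  have h: "0 \<le> h" by (simp add: h_def)
  have mL: "m q < L" if "q \<in> J" for q
    unfolding L_def less_Suc_eq_le using that J by (intro Max_ge) auto
  have time: "q = real (m q) * h" if "q \<in> insert p J" for q
    using m[OF that] by (simp add: h_def)
  note [measurable] = B A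
  have PX [measurable]: "random_variable borel (X q)" if "q \<in> insert p J" for q
    using that p J by (intro measurable_X) (auto intro!: rat_times_nonneg)
  have PX' [measurable]: "random_variable borel (X (p + q))" if "q \<in> insert p J" for q
    using that p J by (intro measurable_X) (auto intro!: rat_times_nonneg)
  define G where "G f = (\<lambda>q\<in>J. \<Sum>i<m q. f i)" for f :: "nat \<Rightarrow> 'a"
  have G_meas: "G \<in> measurable (PiM {..<L} (\<lambda>_. borel)) (PiM J (\<lambda>_. borel))"
    unfolding G_def[abs_def] by (intro measurable_restrict borel_measurable_sum measurable_component_singleton)
      (use mL in fastforce)
  have X0: "AE \<omega> in M. X p \<omega> = (\<Sum>i<k. grid_incr h i \<omega>)" (is "AE \<omega> in M. ?P \<omega>")
    using start_zero by eventually_elim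
      (use sum_grid_incr[where h=h and j=0 and k=k] time[of p] in \<open>simp add: k_def\<close>)
  have XJ: "X (p + q) \<omega> - X p \<omega> = (\<Sum>i<m q. grid_incr h (k + i) \<omega>)" if "q \<in> J" for q \<omega>
    using sum_grid_incr[where h=h and j=k and k="m q" and \<omega>=\<omega>] time[of p] time[of q] that
    by (simp add: k_def distrib_right)
  have X0J: "AE \<omega> in M. \<forall>q\<in>J. X q \<omega> = (\<Sum>i<m q. grid_incr h i \<omega>)"
    using start_zero
  proof eventually_elim
    case (elim \<omega>)
    then show ?case using sum_grid_incr[where h=h and j=0 and \<omega>=\<omega>] time by simp
  qed
  have ind: "indep_var (PiM {..<k} (\<lambda>_. borel)) (\<lambda>\<omega>. restrict (\<lambda>i. grid_incr h i \<omega>) {..<k})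
      (PiM {k..<k+L} (\<lambda>_. borel)) (\<lambda>\<omega>. restrict (\<lambda>i. grid_incr h i \<omega>) {k..<k+L})"
    by (rule indep_var_restrict[OF grid_incr_indep[OF h, of "k + L"]]) auto
  define S where "S = (\<lambda>\<omega>. \<Sum>i<k. grid_incr h i \<omega>)"
  define T where "T k' = (\<lambda>\<omega>. \<lambda>i\<in>{..<L}. grid_incr h (k' + i) \<omega>)" for k'
  define Z where "Z = {f \<in> space (PiM {..<L} (\<lambda>_. borel)). \<forall>q\<in>J. (\<Sum>i<m q. f i) \<in> B q}"
  have Z: "Z \<in> sets (PiM {..<L} (\<lambda>_. borel :: 'a measure))"
    unfolding Z_def
  proof (rule sets.sets_Collect_finite_All[OF _ J(1)])
    fix q assume q: "q \<in> J"
    have "(\<lambda>f. \<Sum>i<m q. f i) \<in> borel_measurable (PiM {..<L} (\<lambda>_. borel :: 'a measure))"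
      using mL[OF q] by (intro borel_measurable_sum measurable_component_singleton) auto
    from measurable_sets[OF this B[OF q]]
    show "{f \<in> space (PiM {..<L} (\<lambda>_. borel :: 'a measure)). (\<Sum>i<m q. f i) \<in> B q} \<in> sets (PiM {..<L} (\<lambda>_. borel))"
      by (simp add: vimage_def Int_def conj_commute)
  qed
  have T_space: "T k' \<omega> \<in> space (PiM {..<L} (\<lambda>_. borel))" for k' \<omega>
    by (auto simp: T_def space_PiM)
  have T_meas: "random_variable (PiM {..<L} (\<lambda>_. borel)) (T k')" for k'
    unfolding T_def by (intro measurable_restrict measurable_grid_incr h)
  have T_law: "prob (T k -` Z \<inter> space M) = prob (T 0 -` Z \<inter> space M)"
  proof -
    have "0 < L" by (simp add: L_def)
    have "prob (T k' -` Z \<inter> space M) = measure (PiM {..<L} (\<lambda>_. distr M borel (X h))) Z" for k'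
      unfolding grid_incr_shift_law[OF h \<open>0 < L\<close>, of k', symmetric] T_def[symmetric]
      by (rule measure_distr[OF T_meas Z, symmetric])
    then show ?thesis by simp
  qed
  have sum_T: "(\<Sum>i<m q. T k' \<omega> i) = (\<Sum>i<m q. grid_incr h (k' + i) \<omega>)" if "q \<in> J" for q k' \<omega>
    using mL[OF that] by (intro sum.cong) (auto simp: T_def)
  have S_meas: "random_variable borel S"
    unfolding S_def by (intro borel_measurable_sum measurable_grid_incr h)
  have ev: "T k' -` Z \<inter> space M \<in> events" "S -` A \<inter> space M \<in> events" for k'
    using T_meas Z S_meas A by (auto intro: measurable_sets)
  have E1: "{\<omega> \<in> space M. X p \<omega> \<in> A \<and> (\<forall>q\<in>J. X (p + q) \<omega> - X p \<omega> \<in> B q)} \<in> events"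
    using J(1) by measurable
  have E2: "{\<omega> \<in> space M. X p \<omega> \<in> A} \<in> events" by measurable
  have E3: "{\<omega> \<in> space M. \<forall>q\<in>J. X q \<omega> \<in> B q} \<in> events" using J(1) by measurable
  have "prob {\<omega> \<in> space M. X p \<omega> \<in> A \<and> (\<forall>q\<in>J. X (p + q) \<omega> - X p \<omega> \<in> B q)}
      = prob ((\<lambda>x. (S x, T k x)) -` (A \<times> Z) \<inter> space M)"
  proof (rule finite_measure_eq_AE)
    show "AE x in M. (x \<in> {\<omega> \<in> space M. X p \<omega> \<in> A \<and> (\<forall>q\<in>J. X (p + q) \<omega> - X p \<omega> \<in> B q)}) =
      (x \<in> (\<lambda>x. (S x, T k x)) -` (A \<times> Z) \<inter> space M)"
      using X0 by eventually_elim (auto simp: Z_def T_space sum_T XJ S_def)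
    have "(\<lambda>x. (S x, T k x)) -` (A \<times> Z) \<inter> space M = (S -` A \<inter> space M) \<inter> (T k -` Z \<inter> space M)" by auto
    then show "(\<lambda>x. (S x, T k x)) -` (A \<times> Z) \<inter> space M \<in> events" using ev by auto
  qed (rule E1)
  also have "\<dots> = prob (S -` A \<inter> space M) * prob (T k -` Z \<inter> space M)"
  proof -
    define g1 where "g1 = (\<lambda>f::nat \<Rightarrow> 'a. \<Sum>i<k. f i)"
    define g2 where "g2 = (\<lambda>f::nat \<Rightarrow> 'a. \<lambda>i\<in>{..<L}. f (k + i))"
    have g1: "g1 \<in> measurable (PiM {..<k} (\<lambda>_. borel)) borel"
      unfolding g1_def by (intro borel_measurable_sum measurable_component_singleton) auto
    have g2: "g2 \<in> measurable (PiM {k..<k+L} (\<lambda>_. borel)) (PiM {..<L} (\<lambda>_. borel))"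
      unfolding g2_def by (intro measurable_restrict measurable_component_singleton) auto
    let ?r1 = "\<lambda>\<omega>. restrict (\<lambda>i. grid_incr h i \<omega>) {..<k}"
    let ?r2 = "\<lambda>\<omega>. restrict (\<lambda>i. grid_incr h i \<omega>) {k..<k+L}"
    have e: "g1 (?r1 \<omega>) = S \<omega>" "g2 (?r2 \<omega>) = T k \<omega>" for \<omega>
      by (auto simp: g1_def g2_def S_def T_def fun_eq_iff)
    have sp: "?r1 \<omega> \<in> space (PiM {..<k} (\<lambda>_. borel))" "?r2 \<omega> \<in> space (PiM {k..<k+L} (\<lambda>_. borel))" for \<omega>
      by (auto simp: space_PiM)
    note indep_varD[OF ind measurable_sets[OF g1 A] measurable_sets[OF g2 Z]]
    moreover have "?r1 -` (g1 -` A \<inter> space (PiM {..<k} (\<lambda>_. borel))) \<inter> space M = S -` A \<inter> space M"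
      "?r2 -` (g2 -` Z \<inter> space (PiM {k..<k+L} (\<lambda>_. borel))) \<inter> space M = T k -` Z \<inter> space M"
      using e sp by auto
    moreover have "(\<lambda>\<omega>. (?r1 \<omega>, ?r2 \<omega>)) -` ((g1 -` A \<inter> space (PiM {..<k} (\<lambda>_. borel))) \<times>
        (g2 -` Z \<inter> space (PiM {k..<k+L} (\<lambda>_. borel)))) \<inter> space M
      = (\<lambda>x. (S x, T k x)) -` (A \<times> Z) \<inter> space M"
      using e sp by auto
    ultimately show ?thesis by simp
  qed
  also have "prob (S -` A \<inter> space M) = prob {\<omega> \<in> space M. X p \<omega> \<in> A}"
  proof (rule finite_measure_eq_AE)
    show "AE x in M. (x \<in> S -` A \<inter> space M) = (x \<in> {\<omega> \<in> space M. X p \<omega> \<in> A})"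
      using X0 by eventually_elim (auto simp: S_def)
  qed (use ev E2 in auto)
  also have "prob (T k -` Z \<inter> space M) = prob {\<omega> \<in> space M. \<forall>q\<in>J. X q \<omega> \<in> B q}"
    unfolding T_law
  proof (rule finite_measure_eq_AE)
    show "AE x in M. (x \<in> T 0 -` Z \<inter> space M) = (x \<in> {\<omega> \<in> space M. \<forall>q\<in>J. X q \<omega> \<in> B q})"
      using X0J by eventually_elim (auto simp: Z_def T_space sum_T)
  qed (use ev E3 in auto)
  finally show ?thesis .
qed

text \<open>Restricting \<open>M\<close> to the event \<open>X p \<in> A\<close> turns the claim for
  fixed \<open>A\<close> into the equality of two finite measures on path space, and these are
  determined by cylinders over finitely many rational times.\<close>

lemma markov_law:
  assumes p: "p \<in> rat_times"
  shows "distr M (borel \<Otimes>\<^sub>M path_space) (\<lambda>\<omega>. (X p \<omega>, shifted_trace p \<omega>))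
       = distr M borel (X p) \<Otimes>\<^sub>M distr M path_space path_trace"
proof (rule pair_measure_eqI[symmetric])
  note [measurable] = measurable_X_rat[OF p]
  note [measurable] = measurable_shifted_trace[OF p]
  interpret D1: prob_space "distr M borel (X p)" by (rule prob_space_distr) measurable
  interpret D2: prob_space "distr M path_space path_trace" by (rule prob_space_distr) measurable
  show "sigma_finite_measure (distr M borel (X p))" "sigma_finite_measure (distr M path_space path_trace)" by unfold_locales
  show "sets (distr M borel (X p) \<Otimes>\<^sub>M distr M path_space path_trace) =
    sets (distr M (borel \<Otimes>\<^sub>M path_space) (\<lambda>\<omega>. (X p \<omega>, shifted_trace p \<omega>)))"
    by (simp cong: sets_pair_measure_cong)
  fix A B assume A': "A \<in> sets (distr M borel (X p))" and B': "B \<in> sets (distr M path_space path_trace)"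
  then have A [measurable]: "A \<in> sets borel" and B [measurable]: "B \<in> sets path_space" by auto
  define R where "R = X p -` A \<inter> space M"
  have R: "R \<in> events" unfolding R_def by measurable
  let ?P = "distr (density M (indicator R)) path_space (shifted_trace p)"
  let ?Q = "scale_measure (emeasure M R) (distr M path_space path_trace)"
  have sm: "shifted_trace p \<in> measurable (density M (indicator R)) path_space"
    by measurable
  have "?P = ?Q"
  proof (rule measure_eqI_PiM_infinite[where I=rat_times and M="\<lambda>_. borel"])
    show "sets ?P = sets (PiM rat_times (\<lambda>_. borel))" "sets ?Q = sets (PiM rat_times (\<lambda>_. borel))"
      by (simp_all add: path_space_def)
    interpret DR: finite_measure "density M (indicator R)" by (rule finite_measure_restricted[OF R])
    show "finite_measure ?P" by (rule DR.finite_measure_distr[OF sm])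
    fix B :: "real \<Rightarrow> 'a set" and J
    assume J: "finite J" "J \<subseteq> rat_times" and B: "\<And>i. i \<in> J \<Longrightarrow> B i \<in> sets borel"
    let ?C = "prod_emb rat_times (\<lambda>_. borel) J (Pi\<^sub>E J B)"
    have C: "?C \<in> sets path_space"
      unfolding path_space_def using J B by (intro sets_PiM_I) auto
    have c1: "shifted_trace p -` ?C \<inter> space M = {\<omega> \<in> space M. \<forall>q\<in>J. X (p + q) \<omega> - X p \<omega> \<in> B q}"
      using J by (auto simp: prod_emb_def shifted_trace_def PiE_iff subset_eq extensional_def)
    have c2: "path_trace -` ?C \<inter> space M = {\<omega> \<in> space M. \<forall>q\<in>J. X q \<omega> \<in> B q}"
      using J by (auto simp: prod_emb_def path_trace_def PiE_iff subset_eq extensional_def)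
    have "emeasure ?P ?C = emeasure M (R \<inter> (shifted_trace p -` ?C \<inter> space M))"
      using C sm by (simp add: emeasure_distr emeasure_restricted R measurable_sets)
    also have "R \<inter> (shifted_trace p -` ?C \<inter> space M)
       = {\<omega> \<in> space M. X p \<omega> \<in> A \<and> (\<forall>q\<in>J. X (p + q) \<omega> - X p \<omega> \<in> B q)}"
      unfolding c1 R_def by auto
    also have "emeasure M \<dots> = emeasure M R * emeasure M {\<omega> \<in> space M. \<forall>q\<in>J. X q \<omega> \<in> B q}"
      using finite_dimensional_markov[OF p J A B]
      by (simp add: emeasure_eq_measure R_def vimage_def Int_def conj_commute ennreal_mult)
    also have "\<dots> = emeasure ?Q ?C"
      using C by (simp add: emeasure_distr c2)
    finally show "emeasure ?P ?C = emeasure ?Q ?C" .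
  qed
  then have "emeasure ?P B = emeasure ?Q B" by simp
  then have "emeasure M (R \<inter> (shifted_trace p -` B \<inter> space M)) = emeasure M R * emeasure (distr M path_space path_trace) B"
    using sm B by (simp add: emeasure_distr emeasure_restricted R measurable_sets)
  moreover have "R \<inter> (shifted_trace p -` B \<inter> space M) = (\<lambda>\<omega>. (X p \<omega>, shifted_trace p \<omega>)) -` (A \<times> B) \<inter> space M"
    by (auto simp: R_def)
  ultimately show "emeasure (distr M borel (X p)) A * emeasure (distr M path_space path_trace) B
      = emeasure (distr M (borel \<Otimes>\<^sub>M path_space) (\<lambda>\<omega>. (X p \<omega>, shifted_trace p \<omega>))) (A \<times> B)"
    by (simp add: emeasure_distr R_def)
qed

end

section \<open>Step paths\<close>

text \<open>Right constancy at \<open>t\<close> together with constancy just before \<open>t\<close>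
  leaves at most one change near each time, hence finitely many in a bounded interval.\<close>

definition step_path :: "(real \<Rightarrow> 'b) \<Rightarrow> bool" where
  "step_path v \<longleftrightarrow> (\<forall>t\<ge>0. \<forall>\<^sub>F s in at_right t. v s = v t) \<and>
     (\<forall>t>0. \<exists>c. \<forall>\<^sub>F s in at_left t. v s = c)"

text \<open>Averaging \<open>1 - cos (u Y)\<close> over a centred Gaussian \<open>u\<close> of standard deviation \<open>\<sigma>\<close> gives
  \<open>1 - exp (- (\<sigma> Y)\<^sup>2 / 2)\<close>, which tends to the indicator of \<open>Y \<noteq> 0\<close> as \<open>\<sigma>\<close> grows.\<close>

lemma (in prob_space) prob_nonzero_le_char:
  fixes Y :: "'a \<Rightarrow> real"
  assumes Y [measurable]: "random_variable borel Y"
    and C: "\<And>u. 1 - expectation (\<lambda>\<omega>. cos (u * Y \<omega>)) \<le> C"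
  shows "prob {\<omega> \<in> space M. Y \<omega> \<noteq> 0} \<le> C"
proof -
  interpret G: prob_space std_normal_distribution by (rule prob_space_normal_density) simp
  interpret P: pair_prob_space std_normal_distribution M ..
  have gauss: "(\<integral>g. cos (s * g) \<partial>std_normal_distribution) = exp (- s\<^sup>2 / 2)" for s
  proof -
    have "char std_normal_distribution s = complex_of_real (exp (- (s\<^sup>2) / 2))"
      by (simp add: char_std_normal_distribution)
    then have "Re (\<integral>g. iexp (s * g) \<partial>std_normal_distribution) = exp (- s\<^sup>2 / 2)"
      by (simp add: char_def)
    moreover have "integrable std_normal_distribution (\<lambda>g. iexp (s * g))"
      by (rule G.integrable_iexp) auto
    then have "(\<integral>g. Re (iexp (s * g)) \<partial>std_normal_distribution) = Re (\<integral>g. iexp (s * g) \<partial>std_normal_distribution)"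
      by (rule integral_Re)
    ultimately show ?thesis by (simp add: Re_exp)
  qed
  have le: "expectation (\<lambda>\<omega>. 1 - exp (- (\<sigma> * Y \<omega>)\<^sup>2 / 2)) \<le> C" for \<sigma>
  proof -
    have int: "integrable (std_normal_distribution \<Otimes>\<^sub>M M) (\<lambda>(g, \<omega>). cos ((\<sigma> * Y \<omega>) * g))"
      by (rule P.integrable_const_bound[where B=1]) auto
    have i2: "integrable M (\<lambda>\<omega>. exp (- (\<sigma> * Y \<omega>)\<^sup>2 / 2))"
      by (rule integrable_const_bound[where B=1]) auto
    have "expectation (\<lambda>\<omega>. exp (- (\<sigma> * Y \<omega>)\<^sup>2 / 2))
       = expectation (\<lambda>\<omega>. \<integral>g. cos ((\<sigma> * Y \<omega>) * g) \<partial>std_normal_distribution)"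
      by (simp only: gauss)
    also have "\<dots> = (\<integral>g. expectation (\<lambda>\<omega>. cos ((\<sigma> * Y \<omega>) * g)) \<partial>std_normal_distribution)"
      using P.Fubini_integral[of "\<lambda>g \<omega>. cos ((\<sigma> * Y \<omega>) * g)"] int by simp
    \<comment> \<open>The assumption bounds the inner expectation uniformly in the frequency
      \<open>\<sigma> * g\<close>, so the bound survives the Gaussian average.\<close>
    also have "\<dots> \<ge> (\<integral>g. 1 - C \<partial>std_normal_distribution)"
    proof (rule integral_mono)
      show "integrable std_normal_distribution (\<lambda>g. expectation (\<lambda>\<omega>. cos ((\<sigma> * Y \<omega>) * g)))"
        using P.integrable_fst'[OF int] by simp
      show "1 - C \<le> expectation (\<lambda>\<omega>. cos ((\<sigma> * Y \<omega>) * g))" for g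
        using C[of "\<sigma> * g"] by (simp add: mult_ac)
    qed auto
    finally show ?thesis using i2 G.prob_space prob_space by simp
  qed
  have "(\<lambda>n. expectation (\<lambda>\<omega>. 1 - exp (- (real n * Y \<omega>)\<^sup>2 / 2)))
      \<longlonglongrightarrow> expectation (\<lambda>\<omega>. indicator {\<omega> \<in> space M. Y \<omega> \<noteq> 0} \<omega>)"
  proof (rule integral_dominated_convergence[where w="\<lambda>_. 1"])
    show "AE x in M. (\<lambda>n. 1 - exp (- (real n * Y x)\<^sup>2 / 2)) \<longlonglongrightarrow> indicator {\<omega> \<in> space M. Y \<omega> \<noteq> 0} x"
    proof (rule AE_I2)
      fix x assume x: "x \<in> space M"
      show "(\<lambda>n. 1 - exp (- (real n * Y x)\<^sup>2 / 2)) \<longlonglongrightarrow> indicator {\<omega> \<in> space M. Y \<omega> \<noteq> 0} x"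
      proof (cases "Y x = 0")
        case False
        then have "0 < (Y x)\<^sup>2" by simp
        then have "((\<lambda>n. 1 - exp (- (real n * real n * ((Y x)\<^sup>2)) / 2)) \<longlonglongrightarrow> 1 - 0)"
          by (intro tendsto_intros) real_asymp
        then show ?thesis using False x by (simp add: power2_eq_square mult_ac)
      qed simp
    qed
  qed auto
  then have "expectation (\<lambda>\<omega>. indicator {\<omega> \<in> space M. Y \<omega> \<noteq> 0} \<omega>) \<le> C"
    using le by (intro LIMSEQ_le_const2) auto
  then show ?thesis by simp
qed

text \<open>If no two adjacent fine dyadic intervals carry a change of \<open>v\<close>, then \<open>v\<close> is a step
  function: near a point \<open>t\<close> whose dyadic intervals all carry a change, the neighbouring
  intervals carry none, and they overlap in a chain that accumulates at \<open>t\<close>.\<close>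

definition dyadic_const :: "(real \<Rightarrow> 'b) \<Rightarrow> nat \<Rightarrow> nat \<Rightarrow> bool" where
  "dyadic_const v n k \<longleftrightarrow> (\<forall>s\<in>{real k / 2^n..real (Suc k) / 2^n}. v s = v (real k / 2^n))"

lemma dyadic_constD:
  "dyadic_const v n k \<Longrightarrow> s \<in> {real k / 2^n..real (Suc k) / 2^n} \<Longrightarrow>
     s' \<in> {real k / 2^n..real (Suc k) / 2^n} \<Longrightarrow> v s = v s'"
  unfolding dyadic_const_def by (rule trans[OF _ sym]) (erule bspec, assumption)+

lemma dyadic_cover:
  assumes "0 \<le> t"
  shows "real (nat \<lfloor>t * 2^n\<rfloor>) / 2^n \<le> t" "t < real (Suc (nat \<lfloor>t * 2^n\<rfloor>)) / 2^n"
proof -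
  have "real (nat \<lfloor>t * 2^n\<rfloor>) \<le> t * 2^n" "t * 2^n < real (Suc (nat \<lfloor>t * 2^n\<rfloor>))"
    using assms by (auto simp: of_nat_nat) linarith
  then show "real (nat \<lfloor>t * 2^n\<rfloor>) / 2^n \<le> t" "t < real (Suc (nat \<lfloor>t * 2^n\<rfloor>)) / 2^n"
    by (simp_all only: pos_divide_le_eq pos_less_divide_eq zero_less_power zero_less_numeral)
qed

lemma eventually_const_right:
  fixes v :: "real \<Rightarrow> real"
  assumes t: "0 \<le> t" and cont: "(v \<longlongrightarrow> v t) (at_right t)"
    and adj: "\<And>n k. n \<ge> n0 \<Longrightarrow> real k \<le> (t + 1) * 2 ^ n \<Longrightarrow> dyadic_const v n k \<or> dyadic_const v n (Suc k)"
  shows "\<forall>\<^sub>F s in at_right t. v s = v t"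
proof -
  \<comment> \<open>\<open>k n\<close> numbers the dyadic interval of level \<open>n\<close> that
    contains \<open>t\<close>, and \<open>r n\<close> is its right end. If one of these intervals is
    constant the claim is immediate; otherwise \<open>adj\<close> makes their right neighbours
    constant from level \<open>n0\<close> on.\<close>
  define k where "k n = nat \<lfloor>t * 2^n\<rfloor>" for n :: nat
  define r where "r n = real (Suc (k n)) / 2^n" for n
  have k: "real (k n) / 2^n \<le> t" "t < r n" for n
    using dyadic_cover[OF t, of n] by (auto simp: k_def r_def)
  show ?thesis
  proof (cases "\<exists>n. dyadic_const v n (k n)")
    case True
    then obtain n where n: "dyadic_const v n (k n)" ..
    show ?thesis unfolding eventually_at_right_field
    proof (intro exI[of _ "r n"] conjI allI impI)
      fix s assume "t < s" "s < r n"
      then show "v s = v t" using k[of n] by (intro dyadic_constD[OF n]) (auto simp: r_def)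
    qed (rule k)
  next
    case False
    have good: "dyadic_const v n (Suc (k n))" if "n \<ge> n0" for n
    proof -
      have "real (k n) \<le> t * 2 ^ n" using k(1)[of n] by (simp add: field_simps)
      also have "\<dots> \<le> (t + 1) * 2 ^ n" by simp
      finally show ?thesis using adj[OF that] False by blast
    qed
    \<comment> \<open>The interval around \<open>t\<close> at the next level is one half of the old
      one, so \<open>r (Suc n)\<close> is either \<open>r n\<close> or the midpoint, and
      \<open>{r (Suc n)..r n}\<close> lies in the constant right neighbour of level
      \<open>Suc n\<close>.\<close>
    have r_step: "r (Suc n) \<le> r n" "r n \<le> r (Suc n) + 1 / 2 ^ Suc n" for n
    proof -
      have "real (k (Suc n)) < 2 * real (Suc (k n))"
      proof -
        have "real (k (Suc n)) \<le> t * 2 ^ Suc n"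
          using k(1)[of "Suc n"] unfolding r_def by (simp only: pos_divide_le_eq pos_divide_less_eq zero_less_power zero_less_numeral)
        also have "t * 2 ^ Suc n = 2 * (t * 2 ^ n)" by simp
        also have "t * 2 ^ n < real (Suc (k n))"
          using k(2)[of n] unfolding r_def by (simp only: pos_less_divide_eq pos_le_divide_eq zero_less_power zero_less_numeral)
        finally show ?thesis by simp
      qed
      then have 1: "k (Suc n) < 2 * Suc (k n)" by (simp only: of_nat_less_iff[symmetric, where 'a=real] of_nat_mult of_nat_numeral)
      have "2 * real (k n) < real (Suc (k (Suc n)))"
        using k(2)[of "Suc n"] k(1)[of n] unfolding r_def by (simp add: field_simps del: of_nat_Suc)
      then have 2: "2 * k n < Suc (k (Suc n))" by (simp only: of_nat_less_iff[symmetric, where 'a=real] of_nat_mult of_nat_numeral)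
      from 1 2 have "k (Suc n) = 2 * k n \<or> k (Suc n) = 2 * k n + 1" by presburger
      then show "r (Suc n) \<le> r n" "r n \<le> r (Suc n) + 1 / 2 ^ Suc n"
        by (auto simp: r_def field_simps)
    qed
    have const: "\<forall>s\<in>{r n..r n0}. v s = v (r n0)" if "n \<ge> n0" for n
      using that
    proof (induction n rule: dec_induct)
      case (step n)
      have 1: "v s = v (r n)" if "s \<in> {r (Suc n)..r n}" for s
        using that r_step[of n] step
        by (intro dyadic_constD[OF good[of "Suc n"]]) (auto simp: r_def add_divide_distrib)
      have 2: "v (r n) = v (r n0)"
      proof -
        have "r n \<le> r n0" using step(1) by (intro lift_Suc_antimono_le[of r, OF r_step(1)])
        then show ?thesis by (intro step.IH[rule_format]) simp
      qed
      have "v s = v (r n0)" if "s \<in> {r (Suc n)..r n0}" for s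
      proof (cases "s \<le> r n")
        case True
        then show ?thesis using 1[of s] 2 that by simp
      next
        case False
        then show ?thesis using that by (intro step.IH[rule_format]) simp
      qed
      then show ?case by blast
    qed auto
    have near: "v s = v (r n0)" if s: "t < s" "s < r n0" for s
    proof -
      obtain n where n: "1 / 2 ^ n < s - t"
        using real_arch_pow_inv[of "s - t" "1/2"] s by (auto simp: power_one_over)
      define m where "m = max n n0"
      have "r m \<le> t + 1 / 2 ^ m" using k(1)[of m] by (simp add: r_def add_divide_distrib)
      also have "1 / 2 ^ m \<le> (1 / 2 ^ n :: real)" by (simp add: m_def frac_le)
      finally have "r m \<le> s" using n by linarith
      then show ?thesis using s by (intro const[of m, rule_format]) (auto simp: m_def)
    qed
    then have ev: "\<forall>\<^sub>F s in at_right t. v s = v (r n0)"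
      unfolding eventually_at_right_field using k(2)[of n0] by blast
    \<comment> \<open>Right continuity enters here, to identify the constant to the right of
      \<open>t\<close> with \<open>v t\<close>.\<close>
    then have "(v \<longlongrightarrow> v (r n0)) (at_right t)" by (rule tendsto_eventually)
    then have "v (r n0) = v t" using cont by (intro tendsto_unique[of "at_right t" v]) auto
    then show ?thesis using ev by simp
  qed
qed

lemma eventually_const_left:
  fixes v :: "real \<Rightarrow> real"
  assumes t: "0 < t"
    and adj: "\<And>n k. n \<ge> n0 \<Longrightarrow> real k \<le> (t + 1) * 2 ^ n \<Longrightarrow> dyadic_const v n k \<or> dyadic_const v n (Suc k)"
  shows "\<exists>c. \<forall>\<^sub>F s in at_left t. v s = c"
proof -
  \<comment> \<open>The ceiling minus one selects the dyadic interval that contains \<open>t\<close>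
    without starting at it, since the path to the left of \<open>t\<close> matters.\<close>
  define k where "k n = nat (\<lceil>t * 2^n\<rceil> - 1)" for n :: nat
  define l where "l n = real (k n) / 2^n" for n
  have k: "l n < t" "t \<le> real (Suc (k n)) / 2^n" for n
  proof -
    have "0 < \<lceil>t * 2^n\<rceil>" using t by simp
    then have *: "real (k n) = real_of_int \<lceil>t * 2^n\<rceil> - 1" by (simp add: k_def)
    have "real (k n) < t * 2^n" "t * 2^n \<le> real (Suc (k n))" unfolding of_nat_Suc * by linarith+
    then show "l n < t" "t \<le> real (Suc (k n)) / 2^n"
      unfolding l_def by (simp_all only: pos_divide_less_eq pos_le_divide_eq zero_less_power zero_less_numeral)
  qed
  show ?thesis
  proof (cases "\<exists>n. dyadic_const v n (k n)")
    case True
    then obtain n where n: "dyadic_const v n (k n)" ..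
    have "\<forall>\<^sub>F s in at_left t. v s = v t" unfolding eventually_at_left_field
    proof (intro exI[of _ "l n"] conjI allI impI)
      fix s assume "l n < s" "s < t"
      then show "v s = v t" using k[of n] by (intro dyadic_constD[OF n]) (auto simp: l_def)
    qed (rule k)
    then show ?thesis by blast
  next
    case False
    obtain n1' where n1': "1 / 2 ^ n1' < t"
      using real_arch_pow_inv[of t "1/2"] t by (auto simp: power_one_over)
    \<comment> \<open>From level \<open>n1\<close> on the interval that contains \<open>t\<close> is
      not the first one, so it has a left neighbour.\<close>
    define n1 where "n1 = max n0 n1'"
    have k_pos: "0 < k n" if "n \<ge> n1" for n
    proof -
      have "1 / 2 ^ n \<le> (1 / 2 ^ n1' :: real)" using that by (simp add: n1_def frac_le)
      then have "1 / 2 ^ n < real (Suc (k n)) / 2^n" using n1' k(2)[of n] by linarith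
      then show ?thesis by (simp add: divide_less_cancel)
    qed
    have good: "dyadic_const v n (k n - 1)" if "n \<ge> n1" for n
    proof -
      have "real (k n) \<le> t * 2 ^ n" using k(1)[of n] by (simp add: l_def field_simps)
      then have "real (k n) \<le> (t + 1) * 2 ^ n" by (simp add: distrib_right add_increasing2)
      then have "real (k n - 1) \<le> (t + 1) * 2 ^ n" using k_pos[OF that] by (simp add: of_nat_diff)
      then show ?thesis using adj[of n "k n - 1"] that False k_pos[OF that] by (auto simp: n1_def)
    qed
    have l_step: "l n \<le> l (Suc n)" "l (Suc n) - 1 / 2 ^ Suc n \<le> l n" for n
    proof -
      have "real (k (Suc n)) < 2 * real (Suc (k n))"
      proof -
        have "real (k (Suc n)) < t * 2 ^ Suc n"
          using k(1)[of "Suc n"] unfolding l_def by (simp only: pos_divide_le_eq pos_divide_less_eq zero_less_power zero_less_numeral)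
        also have "t * 2 ^ Suc n = 2 * (t * 2 ^ n)" by simp
        also have "t * 2 ^ n \<le> real (Suc (k n))"
          using k(2)[of n] unfolding l_def by (simp only: pos_less_divide_eq pos_le_divide_eq zero_less_power zero_less_numeral)
        finally show ?thesis by simp
      qed
      then have 1: "k (Suc n) < 2 * Suc (k n)" by (simp only: of_nat_less_iff[symmetric, where 'a=real] of_nat_mult of_nat_numeral)
      have "2 * real (k n) < real (Suc (k (Suc n)))"
        using k(2)[of "Suc n"] k(1)[of n] unfolding l_def by (simp add: field_simps del: of_nat_Suc)
      then have 2: "2 * k n < Suc (k (Suc n))" by (simp only: of_nat_less_iff[symmetric, where 'a=real] of_nat_mult of_nat_numeral)
      from 1 2 have "k (Suc n) = 2 * k n \<or> k (Suc n) = 2 * k n + 1" by presburger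
      then show "l n \<le> l (Suc n)" "l (Suc n) - 1 / 2 ^ Suc n \<le> l n"
        by (auto simp: l_def field_simps)
    qed
    have const: "\<forall>s\<in>{l n1..l n}. v s = v (l n1)" if "n \<ge> n1" for n
      using that
    proof (induction n rule: dec_induct)
      case (step n)
      have 1: "v s = v (l n)" if "s \<in> {l n..l (Suc n)}" for s
        using that l_step[of n] step k_pos[of "Suc n"]
        by (intro dyadic_constD[OF good[of "Suc n"]]) (auto simp: l_def of_nat_diff diff_divide_distrib)
      have 2: "v (l n) = v (l n1)"
      proof -
        have "l n1 \<le> l n" using step(1) by (intro lift_Suc_mono_le[of l, OF l_step(1)])
        then show ?thesis by (intro step.IH[rule_format]) simp
      qed
      have "v s = v (l n1)" if "s \<in> {l n1..l (Suc n)}" for s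
      proof (cases "l n \<le> s")
        case True
        then show ?thesis using 1[of s] 2 that by simp
      next
        case False
        then show ?thesis using that by (intro step.IH[rule_format]) simp
      qed
      then show ?case by blast
    qed auto
    have near: "v s = v (l n1)" if s: "l n1 < s" "s < t" for s
    proof -
      obtain n where n: "1 / 2 ^ n < t - s"
        using real_arch_pow_inv[of "t - s" "1/2"] s by (auto simp: power_one_over)
      define m where "m = max n n1"
      have "t \<le> l m + 1 / 2 ^ m" using k(2)[of m] by (simp add: l_def add_divide_distrib)
      moreover have "1 / 2 ^ m \<le> (1 / 2 ^ n :: real)" by (simp add: m_def frac_le)
      ultimately have "s \<le> l m" using n by linarith
      then show ?thesis using s by (intro const[of m, rule_format]) (auto simp: m_def)
    qed
    then show ?thesis
      unfolding eventually_at_left_field using k(1)[of n1] by blast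
  qed
qed

lemma tendsto_dyadic_upper:
  "(\<lambda>m. real_of_int (\<lfloor>s * 2 ^ m\<rfloor> + 1) / 2 ^ m) \<longlonglongrightarrow> s"
  "s < real_of_int (\<lfloor>s * 2 ^ m\<rfloor> + 1) / 2 ^ m"
proof -
  have up: "s < real_of_int (\<lfloor>s * 2 ^ m\<rfloor> + 1) / 2 ^ m" for m
  proof -
    have "s * 2 ^ m < real_of_int (\<lfloor>s * 2 ^ m\<rfloor> + 1)" by linarith
    then show ?thesis by (simp only: pos_less_divide_eq zero_less_power zero_less_numeral)
  qed
  have lo: "real_of_int (\<lfloor>s * 2 ^ m\<rfloor> + 1) / 2 ^ m \<le> s + (1/2) ^ m" for m
  proof -
    have "real_of_int (\<lfloor>s * 2 ^ m\<rfloor> + 1) \<le> s * 2 ^ m + 1" by linarith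
    then have "real_of_int (\<lfloor>s * 2 ^ m\<rfloor> + 1) / 2 ^ m \<le> (s * 2 ^ m + 1) / 2 ^ m"
      by (intro divide_right_mono) auto
    then show ?thesis by (simp add: add_divide_distrib power_one_over)
  qed
  show "s < real_of_int (\<lfloor>s * 2 ^ m\<rfloor> + 1) / 2 ^ m" by (rule up)
  have "(\<lambda>m. s + (1/2) ^ m) \<longlonglongrightarrow> s + 0"
    by (intro tendsto_intros LIMSEQ_realpow_zero) auto
  then have lim: "(\<lambda>m. s + (1/2) ^ m) \<longlonglongrightarrow> s" by simp
  have ev1: "\<forall>\<^sub>F m in sequentially. s \<le> real_of_int (\<lfloor>s * 2 ^ m\<rfloor> + 1) / 2 ^ m"
    by (rule always_eventually) (intro allI less_imp_le[OF up])
  have ev2: "\<forall>\<^sub>F m in sequentially. real_of_int (\<lfloor>s * 2 ^ m\<rfloor> + 1) / 2 ^ m \<le> s + (1/2) ^ m"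
    by (rule always_eventually) (intro allI lo)
  show "(\<lambda>m. real_of_int (\<lfloor>s * 2 ^ m\<rfloor> + 1) / 2 ^ m) \<longlonglongrightarrow> s"
    by (rule tendsto_sandwich[OF ev1 ev2 tendsto_const lim])
qed

lemma filterlim_dyadic_upper:
  "filterlim (\<lambda>m. real_of_int (\<lfloor>s * 2 ^ m\<rfloor> + 1) / 2 ^ m) (at_right s) sequentially"
  by (rule tendsto_imp_filterlim_at_right[OF tendsto_dyadic_upper(1) always_eventually])
    (rule allI, rule tendsto_dyadic_upper(2))

text \<open>Vanishing of all finer increments gives constancy at the dyadic points of the interval.
  Right continuity extends it to every point that such points approach from the right; the right end
  point cannot be approached in this way, but it is dyadic itself.\<close>

lemma dyadic_const_of_increments:
  fixes v :: "real \<Rightarrow> real"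
  assumes cont: "\<And>t. 0 \<le> t \<Longrightarrow> (v \<longlongrightarrow> v t) (at_right t)"
    and zero: "\<And>m i. i < 2 ^ m \<Longrightarrow> v (real (Suc (k * 2 ^ m + i)) / 2 ^ (n + m)) = v (real (k * 2 ^ m + i) / 2 ^ (n + m))"
  shows "dyadic_const v n k"
proof -
  have grid: "v (real (k * 2 ^ m + i) / 2 ^ (n + m)) = v (real k / 2 ^ n)" if "i \<le> 2 ^ m" for m i
    using that
  proof (induction i)
    case 0
    then show ?case by (simp add: power_add)
  next
    case (Suc i)
    then show ?case using zero[of i m] by simp
  qed
  have "v s = v (real k / 2 ^ n)" if s: "real k / 2 ^ n \<le> s" "s \<le> real (Suc k) / 2 ^ n" for s
  proof (cases "s = real (Suc k) / 2 ^ n")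
    case True
    then show ?thesis using grid[of 1 0] by simp
  next
    case False
    with s have s2: "s < real (Suc k) / 2 ^ n" by simp
    have "0 \<le> s" using s(1) by (rule order_trans[rotated]) simp
    let ?d = "\<lambda>m. real_of_int (\<lfloor>s * 2 ^ m\<rfloor> + 1) / 2 ^ m"
    have d: "v (?d (n + m)) = v (real k / 2 ^ n)" for m
    proof -
      define j where "j = \<lfloor>s * 2 ^ (n + m)\<rfloor> + 1"
      have "real k * 2 ^ m \<le> s * 2 ^ (n + m)"
        using s(1) by (simp add: power_add field_simps)
      then have jlo: "int (k * 2 ^ m) \<le> j" unfolding j_def by (simp add: le_floor_iff add_increasing2)
      have "s * 2 ^ (n + m) < real (Suc k) * 2 ^ m"
      proof -
        have "s * 2 ^ n < real (Suc k)" using s2 by (simp only: pos_less_divide_eq zero_less_power zero_less_numeral)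
        then have "s * 2 ^ n * 2 ^ m < real (Suc k) * 2 ^ m" by (rule mult_strict_right_mono) simp
        then show ?thesis by (simp add: power_add mult_ac)
      qed
      moreover have "real_of_int (int (Suc k * 2 ^ m)) = real (Suc k) * 2 ^ m"
        by (simp add: distrib_right)
      ultimately have "\<lfloor>s * 2 ^ (n + m)\<rfloor> < int (Suc k * 2 ^ m)" by (simp only: floor_less_iff)
      then have "j \<le> int (Suc k * 2 ^ m)" unfolding j_def by linarith
      moreover from jlo obtain i where i: "j = int (k * 2 ^ m) + int i"
        using zle_iff_zadd by blast
      ultimately have "int (k * 2 ^ m + i) \<le> int (Suc k * 2 ^ m)" by (simp only: of_nat_add)
      then have "i \<le> 2 ^ m" "j = int (k * 2 ^ m + i)"
        unfolding of_nat_le_iff i by simp_all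
      then have "v (real_of_int j / 2 ^ (n + m)) = v (real k / 2 ^ n)"
        using grid[of i m] by simp
      then show ?thesis by (simp add: j_def)
    qed
    have "(\<lambda>m. v (?d (m + n))) \<longlonglongrightarrow> v s"
      by (rule LIMSEQ_ignore_initial_segment[OF filterlim_compose[OF cont[OF \<open>0 \<le> s\<close>] filterlim_dyadic_upper]])
    moreover have "(\<lambda>m. v (?d (m + n))) = (\<lambda>m. v (real k / 2 ^ n))"
      using d by (simp add: add.commute)
    ultimately show ?thesis using LIMSEQ_unique[of "\<lambda>m. v (real k / 2 ^ n)"] by auto
  qed
  note const = this
  show ?thesis unfolding dyadic_const_def by (intro ballI const) auto
qed

context levy_process
begin

text \<open>A nonzero increment over time \<open>h\<close> has probability at most
  \<open>C * h\<close>. By independence two adjacent intervals of length \<open>1 / 2 ^ n\<close>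
  both carry a change with probability of order \<open>1 / 4 ^ n\<close>, and up to a fixed time
  there are of order \<open>2 ^ n\<close> such pairs. The bounds are summable, so by Borel-Cantelli
  no such pair remains on fine levels.\<close>

lemma AE_step_path_coordinate:
  fixes z :: 'a and c C :: real
  assumes C: "\<And>u h. 0 \<le> h \<Longrightarrow> h \<le> 1 \<Longrightarrow> 1 - expectation (\<lambda>\<omega>. cos (u * (z \<bullet> X h \<omega> - h * c))) \<le> C * h"
  shows "AE \<omega> in M. step_path (\<lambda>t. z \<bullet> X t \<omega> - t * c)"
proof -
  define V where "V \<omega> t = z \<bullet> X t \<omega> - t * c" for \<omega> t
  define nz where "nz n i \<omega> \<longleftrightarrow> V \<omega> (real (Suc i) / 2 ^ n) \<noteq> V \<omega> (real i / 2 ^ n)" for n i \<omega>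
  have C0: "0 \<le> C" using C[of 1 0] by (simp add: prob_space)
  define U where "U n = {x. z \<bullet> x - 1 / 2 ^ n * c \<noteq> 0}" for n :: nat
  have U: "U n \<in> sets borel" for n
    unfolding U_def by measurable
  have nz_eq: "{\<omega> \<in> space M. nz n i \<omega>} = grid_incr (1 / 2 ^ n) i -` U n \<inter> space M" for n i
    by (auto simp: nz_def V_def U_def grid_incr_def inner_diff_right add_divide_distrib algebra_simps)
  have nz_meas: "{\<omega> \<in> space M. nz n i \<omega>} \<in> events" for n i
    unfolding nz_eq by (rule measurable_sets[OF measurable_grid_incr U]) simp
  have nz_prob: "prob {\<omega> \<in> space M. nz n i \<omega>} \<le> C / 2 ^ n" for n i
  proof -
    have "prob {\<omega> \<in> space M. nz n i \<omega>} = measure (distr M borel (grid_incr (1 / 2 ^ n) i)) (U n)"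
      unfolding nz_eq by (rule measure_distr[OF measurable_grid_incr U, symmetric]) simp
    also have "\<dots> = measure (distr M borel (X (1 / 2 ^ n))) (U n)"
      by (subst grid_incr_law) auto
    also have "\<dots> = prob {\<omega> \<in> space M. z \<bullet> X (1 / 2 ^ n) \<omega> - 1 / 2 ^ n * c \<noteq> 0}"
      by (subst measure_distr[OF measurable_X U]) (auto simp: U_def intro!: arg_cong[where f=prob])
    also have "\<dots> \<le> C * (1 / 2 ^ n)"
      by (rule prob_nonzero_le_char) (use measurable_X[of "1 / 2 ^ n"] C[of "1 / 2 ^ n"] in auto)
    finally show ?thesis by simp
  qed
  have nz_pair: "prob {\<omega> \<in> space M. nz n i \<omega> \<and> nz n j \<omega>} \<le> (C / 2 ^ n)\<^sup>2" if "i \<noteq> j" for n i j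
  proof -
    have "prob (\<Inter>l\<in>{i, j}. grid_incr (1 / 2 ^ n) l -` U n \<inter> space M)
        = (\<Prod>l\<in>{i, j}. prob (grid_incr (1 / 2 ^ n) l -` U n \<inter> space M))"
      by (rule indep_varsD[OF grid_incr_indep[of "1 / 2 ^ n" "Suc (max i j)"]]) (auto simp: U)
    also have "(\<Inter>l\<in>{i, j}. grid_incr (1 / 2 ^ n) l -` U n \<inter> space M) = {\<omega> \<in> space M. nz n i \<omega> \<and> nz n j \<omega>}"
      using nz_eq[of n i] nz_eq[of n j] by blast
    also have "(\<Prod>l\<in>{i, j}. prob (grid_incr (1 / 2 ^ n) l -` U n \<inter> space M))
        = prob {\<omega> \<in> space M. nz n i \<omega>} * prob {\<omega> \<in> space M. nz n j \<omega>}"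
      using that by (simp add: nz_eq)
    also have "\<dots> \<le> (C / 2 ^ n)\<^sup>2"
      unfolding power2_eq_square using C0 by (intro mult_mono nz_prob) auto
    finally show ?thesis .
  qed
  \<comment> \<open>\<open>m\<close> is the refinement at which a change inside the dyadic interval
    \<open>k\<close> of level \<open>n\<close> becomes visible; once visible, a change stays visible
    on finer grids.\<close>
  define ch where "ch n k m \<omega> \<longleftrightarrow> (\<exists>i<2 ^ m. nz (n + m) (k * 2 ^ m + i) \<omega>)" for n k m \<omega>
  have ch_mono: "ch n k (Suc m) \<omega>" if ch: "ch n k m \<omega>" for n k m \<omega>
  proof -
    obtain i where i: "i < 2 ^ m" "nz (n + m) (k * 2 ^ m + i) \<omega>" using ch by (auto simp: ch_def)
    define j where "j = k * 2 ^ m + i"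
    have "real j / 2 ^ (n + m) = real (2 * j) / 2 ^ (n + Suc m)"
      "real (Suc j) / 2 ^ (n + m) = real (Suc (Suc (2 * j))) / 2 ^ (n + Suc m)"
      by (simp_all add: field_simps)
    then have "nz (n + Suc m) (2 * j) \<omega> \<or> nz (n + Suc m) (Suc (2 * j)) \<omega>"
      using i(2) unfolding nz_def j_def by metis
    then have "nz (n + Suc m) (k * 2 ^ Suc m + 2 * i) \<omega> \<or> nz (n + Suc m) (k * 2 ^ Suc m + Suc (2 * i)) \<omega>"
      by (simp add: j_def algebra_simps)
    moreover have "2 * i < 2 ^ Suc m" "Suc (2 * i) < 2 ^ Suc m" using i(1) by auto
    ultimately show ?thesis unfolding ch_def by blast
  qed
  have ch_mono': "ch n k m' \<omega>" if "m \<le> m'" "ch n k m \<omega>" for n k m m' \<omega>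
    using that by (induction rule: dec_induct) (auto intro: ch_mono)
  define Adj where "Adj K n m = {\<omega> \<in> space M. \<exists>k\<le>K * 2 ^ n. ch n k m \<omega> \<and> ch n (Suc k) m \<omega>}" for K n m :: nat
  have Adj_UN: "Adj K n m = (\<Union>(k, i, j)\<in>{..K * 2 ^ n} \<times> {..<(2::nat) ^ m} \<times> {..<(2::nat) ^ m}.
      {\<omega> \<in> space M. nz (n + m) (k * 2 ^ m + i) \<omega> \<and> nz (n + m) (Suc k * 2 ^ m + j) \<omega>})" for K n m
    by (fastforce simp: Adj_def ch_def)
  have pair_meas: "{\<omega> \<in> space M. nz n i \<omega> \<and> nz n j \<omega>} \<in> events" for n i j
    using sets.Int[OF nz_meas[of n i] nz_meas[of n j]] by (simp add: Int_def conj_ac cong: conj_cong)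
  have Adj_meas: "Adj K n m \<in> events" for K n m
    unfolding Adj_UN by (intro sets.finite_UN) (auto simp: pair_meas)
  have Adj_prob: "prob (Adj K n m) \<le> 2 * (real K + 1) * C\<^sup>2 * (1 / 2) ^ n" for K n m
  proof -
    have "prob (Adj K n m) \<le> (\<Sum>(k, i, j)\<in>{..K * 2 ^ n} \<times> {..<(2::nat) ^ m} \<times> {..<(2::nat) ^ m}.
        prob {\<omega> \<in> space M. nz (n + m) (k * 2 ^ m + i) \<omega> \<and> nz (n + m) (Suc k * 2 ^ m + j) \<omega>})"
      unfolding Adj_UN case_prod_beta
      by (intro finite_measure_subadditive_finite) (auto simp: pair_meas)
    also have "\<dots> \<le> (\<Sum>(k, i, j)\<in>{..K * 2 ^ n} \<times> {..<(2::nat) ^ m} \<times> {..<(2::nat) ^ m}. (C / 2 ^ (n + m))\<^sup>2)"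
    proof (rule sum_mono)
      fix x assume "x \<in> {..K * 2 ^ n} \<times> {..<(2::nat) ^ m} \<times> {..<(2::nat) ^ m}"
      then obtain k i j where x: "x = (k, i, j)" "i < 2 ^ m" by auto
      then have "k * 2 ^ m + i \<noteq> Suc k * 2 ^ m + j" by simp
      then show "(case x of (k, i, j) \<Rightarrow> prob {\<omega> \<in> space M. nz (n + m) (k * 2 ^ m + i) \<omega> \<and> nz (n + m) (Suc k * 2 ^ m + j) \<omega>})
          \<le> (case x of (k, i, j) \<Rightarrow> (C / 2 ^ (n + m))\<^sup>2)"
        unfolding x(1) prod.case by (rule nz_pair)
    qed
    \<comment> \<open>The number \<open>4 ^ m\<close> of pairs cancels against the squared
      probability, so the bound does not depend on the refinement \<open>m\<close> and survives the
      limit.\<close>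
    also have "\<dots> = (real K * 2 ^ n + 1) * (2 ^ m * 2 ^ m) * (C / 2 ^ (n + m))\<^sup>2"
      by (simp add: card_cartesian_product distrib_right)
    also have "\<dots> = (real K * 2 ^ n + 1) * C\<^sup>2 / (2 ^ n * 2 ^ n)"
      by (simp add: power2_eq_square power_add field_simps)
    also have "\<dots> \<le> (2 * (real K + 1) * 2 ^ n) * C\<^sup>2 / (2 ^ n * 2 ^ n)"
    proof (intro divide_right_mono mult_right_mono)
      define y where "y = (2::real) ^ n"
      have "1 \<le> y" "0 \<le> real K * y" by (simp_all add: y_def)
      then have "real K * y + 1 \<le> 2 * (real K * y) + 2 * y" by linarith
      then show "real K * 2 ^ n + 1 \<le> 2 * (real K + 1) * 2 ^ n" by (simp add: y_def algebra_simps)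
    qed auto
    also have "\<dots> = 2 * (real K + 1) * C\<^sup>2 * (1 / 2) ^ n" by (simp add: power_one_over field_simps)
    finally show ?thesis .
  qed
  have AE_adj: "AE \<omega> in M. \<forall>K. \<exists>n0. \<forall>n\<ge>n0. \<forall>k\<le>K * 2 ^ n. \<forall>m. \<not> (ch n k m \<omega> \<and> ch n (Suc k) m \<omega>)"
    unfolding AE_all_countable
  proof
    fix K :: nat
    have inc: "incseq (Adj K n)" for n
      unfolding incseq_def Adj_def using ch_mono' by blast
    have Un_meas: "(\<Union>m. Adj K n m) \<in> events" for n using Adj_meas by auto
    have bound: "prob (\<Union>m. Adj K n m) \<le> 2 * (real K + 1) * C\<^sup>2 * (1 / 2) ^ n" for n
      by (rule LIMSEQ_le_const2[OF finite_Lim_measure_incseq[OF _ inc[of n]]])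
        (use Adj_meas Adj_prob in auto)
    have "summable (\<lambda>n. 2 * (real K + 1) * C\<^sup>2 * (1 / 2) ^ n)"
      by (intro summable_mult summable_geometric) simp
    then have "summable (\<lambda>n. prob (\<Union>m. Adj K n m))"
      by (rule summable_comparison_test'[where N=0]) (use bound in simp)
    then have "AE \<omega> in M. \<forall>\<^sub>F n in sequentially. \<omega> \<in> space M - (\<Union>m. Adj K n m)"
      by (intro borel_cantelli_AE1 Un_meas) (auto simp: less_top[symmetric])
    then show "AE \<omega> in M. \<exists>n0. \<forall>n\<ge>n0. \<forall>k\<le>K * 2 ^ n. \<forall>m. \<not> (ch n k m \<omega> \<and> ch n (Suc k) m \<omega>)"
      by eventually_elim (auto simp: eventually_sequentially Adj_def)
  qed
  show ?thesis
    using AE_adj cadlag_paths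
  proof eventually_elim
    case (elim \<omega>)
    have cont: "(V \<omega> \<longlongrightarrow> V \<omega> t) (at_right t)" if "0 \<le> t" for t
      unfolding V_def[abs_def] using elim(2) that by (auto intro!: tendsto_intros)
    have adj: "\<exists>n0. \<forall>n\<ge>n0. \<forall>k. real k \<le> (t + 1) * 2 ^ n \<longrightarrow>
        dyadic_const (V \<omega>) n k \<or> dyadic_const (V \<omega>) n (Suc k)" for t
    proof -
      define K where "K = nat \<lceil>t + 1\<rceil>"
      obtain n0 where n0: "\<And>n k m. n0 \<le> n \<Longrightarrow> k \<le> K * 2 ^ n \<Longrightarrow> \<not> (ch n k m \<omega> \<and> ch n (Suc k) m \<omega>)"
        using elim(1) by meson
      show ?thesis
      proof (intro exI[of _ n0] allI impI)
        fix n k assume n: "n0 \<le> n" "real k \<le> (t + 1) * 2 ^ n"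
        have "(t + 1) * 2 ^ n \<le> real K * 2 ^ n"
          unfolding K_def by (intro mult_right_mono real_nat_ceiling_ge) simp
        with n(2) have "real k \<le> real K * 2 ^ n" by (rule order_trans)
        then have "real k \<le> real (K * 2 ^ n)" by simp
        then have k: "k \<le> K * 2 ^ n" by (simp only: of_nat_le_iff)
        show "dyadic_const (V \<omega>) n k \<or> dyadic_const (V \<omega>) n (Suc k)"
        proof (rule ccontr)
          assume *: "\<not> ?thesis"
          have "\<exists>m. ch n l m \<omega>" if "\<not> dyadic_const (V \<omega>) n l" for l
          proof (rule ccontr)
            assume "\<nexists>m. ch n l m \<omega>"
            then have "dyadic_const (V \<omega>) n l"
              by (intro dyadic_const_of_increments cont) (auto simp: ch_def nz_def)
            with that show False by simp
          qed
          then obtain m1 m2 where "ch n k m1 \<omega>" "ch n (Suc k) m2 \<omega>" using * by blast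
          then have "ch n k (max m1 m2) \<omega> \<and> ch n (Suc k) (max m1 m2) \<omega>"
            using ch_mono'[of m1 "max m1 m2"] ch_mono'[of m2 "max m1 m2"] by simp
          then show False using n0[OF n(1) k] by blast
        qed
      qed
    qed
    have "step_path (V \<omega>)"
      unfolding step_path_def
    proof (intro conjI allI impI)
      fix t :: real assume t: "0 \<le> t"
      obtain n0 where "\<And>n k. n0 \<le> n \<Longrightarrow> real k \<le> (t + 1) * 2 ^ n \<Longrightarrow>
        dyadic_const (V \<omega>) n k \<or> dyadic_const (V \<omega>) n (Suc k)" using adj[of t] by blast
      then show "\<forall>\<^sub>F s in at_right t. V \<omega> s = V \<omega> t"
        by (rule eventually_const_right[OF t cont[OF t]])
    next
      fix t :: real assume t: "0 < t"
      obtain n0 where "\<And>n k. n0 \<le> n \<Longrightarrow> real k \<le> (t + 1) * 2 ^ n \<Longrightarrow>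
        dyadic_const (V \<omega>) n k \<or> dyadic_const (V \<omega>) n (Suc k)" using adj[of t] by blast
      then show "\<exists>c. \<forall>\<^sub>F s in at_left t. V \<omega> s = c"
        by (rule eventually_const_left[OF t])
    qed
    then show ?case by (simp add: V_def[abs_def])
  qed
qed

end

section \<open>The component outside the subspace\<close>

text \<open>The maximum of the Rayleigh quotient on the unit sphere of an invariant subspace is
  attained at an eigenvector.\<close>

lemma selfadjoint_eigenvector:
  fixes f :: "'a::euclidean_space \<Rightarrow> 'a"
  assumes f: "linear f" "\<And>x y. f x \<bullet> y = x \<bullet> f y"
    and S: "subspace S" "f ` S \<subseteq> S" "S \<noteq> {0}"
  shows "\<exists>u\<in>S. norm u = 1 \<and> f u = (u \<bullet> f u) *\<^sub>R u"
proof -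
  let ?K = "sphere 0 1 \<inter> S"
  have comp: "compact ?K" by (intro compact_Int_closed closed_subspace S) auto
  obtain x where x: "x \<in> S" "x \<noteq> 0" using S subspace_0 by blast
  then have "x /\<^sub>R norm x \<in> ?K" using S(1) by (simp add: subspace_mul)
  then have ne: "?K \<noteq> {}" by blast
  have cont: "continuous_on ?K (\<lambda>x. x \<bullet> f x)"
    using f(1) by (intro continuous_intros linear_continuous_on linear_conv_bounded_linear[THEN iffD1])
  obtain u where u: "u \<in> ?K" "\<And>y. y \<in> ?K \<Longrightarrow> y \<bullet> f y \<le> u \<bullet> f u"
    using continuous_attains_sup[OF comp ne cont] by blast
  define l where "l = u \<bullet> f u"
  have uu: "u \<bullet> u = 1" using u(1) by (simp add: dot_square_norm)
  have max: "y \<bullet> f y \<le> l * (y \<bullet> y)" if "y \<in> S" for y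
  proof (cases "y = 0")
    case False
    have "(y /\<^sub>R norm y) \<bullet> f (y /\<^sub>R norm y) \<le> l"
      unfolding l_def using that False S(1) by (intro u(2)) (simp add: subspace_mul)
    then have "(y \<bullet> f y) / (norm y)\<^sup>2 \<le> l"
      using f(1) by (simp add: linear_cmul power2_eq_square divide_inverse mult_ac)
    then show ?thesis using False by (simp add: dot_square_norm field_simps)
  qed (simp add: linear_0[OF f(1)])
  define v where "v = f u - l *\<^sub>R u"
  have v: "v \<in> S" unfolding v_def using u(1) S by (intro subspace_diff subspace_mul) auto
  have vu: "v \<bullet> u = 0" using inner_commute[of "f u" u] by (simp add: v_def inner_diff_left l_def uu)
  have vf: "v \<bullet> f u = v \<bullet> v"
  proof -
    have "f u = v + l *\<^sub>R u" by (simp add: v_def)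
    then have "v \<bullet> f u = v \<bullet> (v + l *\<^sub>R u)" by simp
    then show ?thesis by (simp add: inner_add_right vu)
  qed
  \<comment> \<open>Maximality of the Rayleigh quotient at \<open>u\<close>, tested along the line
    \<open>u + t v\<close>: a term linear in \<open>t\<close> must stay below a quadratic one, which
    for small positive \<open>t\<close> forces \<open>v = 0\<close>.\<close>
  have quad: "2 * t * (v \<bullet> v) \<le> t\<^sup>2 * (l * (v \<bullet> v) - v \<bullet> f v)" for t
  proof -
    have "(u + t *\<^sub>R v) \<bullet> f (u + t *\<^sub>R v) \<le> l * ((u + t *\<^sub>R v) \<bullet> (u + t *\<^sub>R v))"
      using u(1) v S(1) by (intro max subspace_add subspace_mul) auto
    moreover have "u \<bullet> f v = v \<bullet> v" using f(2)[of u v] vf by (simp add: inner_commute)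
    moreover have "u \<bullet> v = 0" using vu by (simp add: inner_commute)
    ultimately show ?thesis
      by (simp add: linear_add[OF f(1)] linear_cmul[OF f(1)] inner_add_left inner_add_right vf vu uu
          l_def[symmetric] power2_eq_square algebra_simps)
  qed
  have "v \<bullet> v \<le> 0"
  proof (rule ccontr)
    assume "\<not> v \<bullet> v \<le> 0"
    then have p: "0 < v \<bullet> v" by (simp only: not_le)
    \<comment> \<open>\<open>b\<close> and \<open>t\<close> are chosen so that
      \<open>t\<^sup>2 * b\<close> equals \<open>t * (v \<bullet> v)\<close>, half of the left-hand
      side; the summand 1 keeps \<open>b\<close> positive.\<close>
    define b where "b = \<bar>l * (v \<bullet> v) - v \<bullet> f v\<bar> + 1"
    define t where "t = (v \<bullet> v) / b"
    have b: "0 < b" by (simp add: b_def)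
    have "2 * t * (v \<bullet> v) \<le> t\<^sup>2 * b"
      using quad[of t] by (rule order_trans) (auto simp: b_def intro!: mult_left_mono)
    also have "\<dots> = t * (v \<bullet> v)" using b by (simp add: t_def power2_eq_square)
    finally have "t * (v \<bullet> v) \<le> 0" by simp
    moreover have "0 < t * (v \<bullet> v)" using p b by (simp add: t_def)
    ultimately show False by simp
  qed
  then have "v \<bullet> v = 0" using inner_ge_zero[of v] by linarith
  then have "v = 0" by simp
  then show ?thesis using u(1) by (intro bexI[of _ u]) (auto simp: v_def l_def)
qed

text \<open>By self-adjointness the vectors of \<open>S\<close> orthogonal to an eigenvector form an
  invariant subspace of smaller dimension.\<close>

lemma selfadjoint_eigenbasis:
  fixes f :: "'a::euclidean_space \<Rightarrow> 'a"
  assumes f: "linear f" "\<And>x y. f x \<bullet> y = x \<bullet> f y"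
    and S: "subspace S" "f ` S \<subseteq> S"
  shows "\<exists>B\<subseteq>S. pairwise orthogonal B \<and> (\<forall>b\<in>B. norm b = 1 \<and> f b = (b \<bullet> f b) *\<^sub>R b) \<and> span B = S"
  using S
proof (induction "dim S" arbitrary: S rule: less_induct)
  case less
  show ?case
  proof (cases "S = {0}")
    case True
    then show ?thesis by (intro exI[of _ "{}"]) auto
  next
    case False
    then obtain u where u: "u \<in> S" "norm u = 1" "f u = (u \<bullet> f u) *\<^sub>R u"
      using selfadjoint_eigenvector[OF f less.prems] by blast
    define T where "T = {x \<in> S. u \<bullet> x = 0}"
    have T: "subspace T" unfolding T_def
      using less.prems(1) by (auto simp: subspace_def inner_add_right)
    have "f x \<in> T" if "x \<in> T" for x
    proof -
      have "u \<bullet> f x = f u \<bullet> x" using f(2)[of u x] by simp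
      also have "\<dots> = (u \<bullet> f u) * (u \<bullet> x)" by (subst u(3)) simp
      finally show ?thesis using that less.prems(2) by (auto simp: T_def)
    qed
    then have fT: "f ` T \<subseteq> T" by blast
    have "u \<notin> T" using u by (auto simp: T_def dot_square_norm)
    moreover have "T \<subseteq> S" by (auto simp: T_def)
    ultimately have "T \<subset> S" using u(1) by blast
    then have "dim T < dim S"
      by (intro dim_psubset) (simp add: span_eq_iff[THEN iffD2] T less.prems)
    from less.hyps[OF this T fT] obtain B where
      B: "B \<subseteq> T" "pairwise orthogonal B" "\<And>b. b \<in> B \<Longrightarrow> norm b = 1 \<and> f b = (b \<bullet> f b) *\<^sub>R b" "span B = T"
      by blast
    have "span (insert u B) = S"
    proof
      show "span (insert u B) \<subseteq> S"
        using u B(1) less.prems(1) by (intro span_minimal) (auto simp: T_def)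
      show "S \<subseteq> span (insert u B)"
      proof
        fix x assume x: "x \<in> S"
        have "x - (u \<bullet> x) *\<^sub>R u \<in> T"
          using x u less.prems(1) by (auto simp: T_def inner_diff_right dot_square_norm intro!: subspace_diff subspace_mul)
        then have "x - (u \<bullet> x) *\<^sub>R u \<in> span B" by (simp add: B)
        then show "x \<in> span (insert u B)" by (auto simp: span_insert)
      qed
    qed
    moreover have "pairwise orthogonal (insert u B)"
      using B(1,2) by (auto simp: pairwise_insert T_def orthogonal_def inner_commute subset_iff)
    ultimately show ?thesis
      using u B by (intro exI[of _ "insert u B"]) (auto simp: T_def)
  qed
qed

lemma symmetric_matrix_selfadjoint:
  fixes Q :: "real^'n^'n"
  assumes "transpose Q = Q"
  shows "(Q *v x) \<bullet> y = x \<bullet> (Q *v y)"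
proof -
  have "(Q *v x) \<bullet> y = (x v* transpose Q) \<bullet> y" by (simp only: vector_transpose_matrix)
  also have "\<dots> = x \<bullet> (transpose Q *v y)" by (rule dot_lmul_matrix)
  finally show ?thesis using assms by simp
qed

lemma symmetric_matrixI:
  fixes Q :: "real^'n^'n"
  assumes "\<And>x y. (Q *v x) \<bullet> y = x \<bullet> (Q *v y)"
  shows "transpose Q = Q"
proof -
  have "x \<bullet> (transpose Q *v y) = x \<bullet> (Q *v y)" for x y
  proof -
    have "x \<bullet> (transpose Q *v y) = (x v* transpose Q) \<bullet> y" by (rule dot_lmul_matrix[symmetric])
    also have "\<dots> = (Q *v x) \<bullet> y" by (simp only: vector_transpose_matrix)
    finally show ?thesis using assms[of x y] by simp
  qed
  then have "transpose Q *v y = Q *v y" for y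
    using vector_eq_ldot[of "transpose Q *v y" "Q *v y"] by blast
  then show ?thesis by (simp add: matrix_eq)
qed

text \<open>\<open>matrix_sqrt\<close> is a definite description and carries information only once
  existence and uniqueness are known. In an orthonormal eigenbasis of \<open>Q\<close> the root
  scales by the square roots of the eigenvalues, and any other root must act in the same way on that
  basis.\<close>

lemma pos_semidef_sqrt_ex1:
  fixes Q :: "real^'n^'n"
  assumes Q: "pos_semidef Q"
  shows "\<exists>!R. pos_semidef R \<and> R ** R = Q"
proof -
  have sym: "(Q *v x) \<bullet> y = x \<bullet> (Q *v y)" for x y
    using Q by (intro symmetric_matrix_selfadjoint) (simp add: pos_semidef_def)
  obtain B where B: "pairwise orthogonal B" "span B = UNIV"
     "\<And>b. b \<in> B \<Longrightarrow> norm b = 1" "\<And>b. b \<in> B \<Longrightarrow> Q *v b = (b \<bullet> (Q *v b)) *\<^sub>R b"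
    using selfadjoint_eigenbasis[of "(*v) Q" UNIV] sym by (auto simp: matrix_vector_mul_linear)
  have fin: "finite B"
  proof (intro independent_imp_finite pairwise_orthogonal_independent B(1))
    show "0 \<notin> B" using B(3) by force
  qed
  define s where "s b = sqrt (b \<bullet> (Q *v b))" for b
  have s: "0 \<le> s b" "s b * s b = b \<bullet> (Q *v b)" for b
    using Q by (auto simp: s_def pos_semidef_def)
  have Qb: "Q *v b = (s b * s b) *\<^sub>R b" if "b \<in> B" for b using B(4)[OF that] s by metis
  define r where "r x = (\<Sum>b\<in>B. (s b * (b \<bullet> x)) *\<^sub>R b)" for x
  have lin_r: "linear r"
    by (rule linearI) (simp_all add: r_def inner_add_right distrib_left scaleR_add_left sum.distrib
        scaleR_sum_right mult_ac)
  have rb: "r b = s b *\<^sub>R b" if "b \<in> B" for b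
  proof -
    have "r b = (\<Sum>c\<in>B. if c = b then s b *\<^sub>R b else 0)"
      unfolding r_def using B(1,3) that
      by (intro sum.cong) (auto simp: pairwise_def orthogonal_def dot_square_norm)
    then show ?thesis using fin that by simp
  qed
  have uniq: "R *v b = s b *\<^sub>R b" if R: "pos_semidef R" "R ** R = Q" and b: "b \<in> B" for R b
  proof -
    have R2: "R *v (R *v b) = (s b * s b) *\<^sub>R b"
      using Qb[OF b] R(2) by (simp add: matrix_vector_mul_assoc)
    have Rsym: "(R *v x) \<bullet> y = x \<bullet> (R *v y)" for x y
      using R(1) by (intro symmetric_matrix_selfadjoint) (simp add: pos_semidef_def)
    \<comment> \<open>\<open>R\<close> maps \<open>w\<close> to \<open>- s b\<close> times
      \<open>w\<close>. For positive \<open>s b\<close> nonnegativity of \<open>R\<close> forces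
      \<open>w = 0\<close>; for \<open>s b = 0\<close> the squared norm of \<open>R *v b\<close> is
      the inner product of \<open>b\<close> with \<open>Q *v b\<close>, which vanishes.\<close>
    define w where "w = R *v b - s b *\<^sub>R b"
    have Rw: "R *v w = - s b *\<^sub>R w"
      unfolding w_def matrix_vector_mult_diff_distrib R2 matrix_vector_mult_scaleR
      by (simp add: scaleR_diff_right)
    have "w = 0"
    proof (cases "s b = 0")
      case True
      have "w \<bullet> w = (R *v b) \<bullet> (R *v b)" using True by (simp add: w_def)
      also have "\<dots> = b \<bullet> (R *v (R *v b))" by (rule Rsym)
      also have "\<dots> = 0" using R2 True by simp
      finally show ?thesis by simp
    next
      case False
      have "0 \<le> w \<bullet> (R *v w)" using R(1) by (simp add: pos_semidef_def)
      then have "s b * (w \<bullet> w) \<le> 0" by (simp add: Rw)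
      then have "w \<bullet> w \<le> 0" using False s(1)[of b] by (simp add: mult_le_0_iff)
      then have "w \<bullet> w = 0" using inner_ge_zero[of w] by linarith
      then show ?thesis by simp
    qed
    then show ?thesis by (simp add: w_def)
  qed
  have eq: "R1 = R2" if "\<And>b. b \<in> B \<Longrightarrow> R1 *v b = R2 *v b" for R1 R2 :: "real^'n^'n"
  proof -
    have "R1 *v x = R2 *v x" for x
      by (rule linear_eq_on_span[of "(*v) R1" "(*v) R2" B])
        (auto simp: that B(2) matrix_vector_mul_linear)
    then show ?thesis by (simp add: matrix_eq)
  qed
  show ?thesis
  proof (rule ex_ex1I)
    show "\<exists>R. pos_semidef R \<and> R ** R = Q"
    proof (intro exI conjI)
      have m: "matrix r *v x = r x" for x using lin_r by (simp add: matrix_works)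
      have inner_r: "r x \<bullet> y = (\<Sum>b\<in>B. s b * (b \<bullet> x) * (b \<bullet> y))" for x y
        by (simp add: r_def inner_sum_left)
      show "pos_semidef (matrix r)"
        unfolding pos_semidef_def
      proof (intro conjI allI)
        show "transpose (matrix r) = matrix r"
        proof (rule symmetric_matrixI)
          show "(matrix r *v x) \<bullet> y = x \<bullet> (matrix r *v y)" for x y
            unfolding m inner_commute[of x] inner_r by (simp add: mult_ac)
        qed
        show "0 \<le> z \<bullet> (matrix r *v z)" for z
          unfolding m inner_commute[of z] inner_r
          using s(1) by (intro sum_nonneg) (simp add: mult.assoc)
      qed
      show "matrix r ** matrix r = Q"
      proof (rule eq)
        fix b assume "b \<in> B"
        then show "(matrix r ** matrix r) *v b = Q *v b"
          by (simp add: matrix_vector_mul_assoc[symmetric] m rb Qb linear_cmul[OF lin_r])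
      qed
    qed
    show "R1 = R2" if "pos_semidef R1 \<and> R1 ** R1 = Q" "pos_semidef R2 \<and> R2 ** R2 = Q" for R1 R2
      using that uniq by (intro eq) auto
  qed
qed

text \<open>Here the range condition enters: \<open>Q\<close> is the square of its root and so maps
  into \<open>S\<close> as well, whence \<open>X\<close> has no Gaussian part in directions
  orthogonal to \<open>S\<close>.\<close>

lemma quadratic_form_zero_orthogonal:
  fixes Q :: "real^'n^'n"
  assumes Q: "pos_semidef Q" and S: "range (\<lambda>y. matrix_sqrt Q *v y) \<subseteq> S" and z: "z \<in> S\<^sup>\<bottom>"
  shows "z \<bullet> (Q *v z) = 0"
proof -
  have "matrix_sqrt Q ** matrix_sqrt Q = Q"
    using theI'[OF pos_semidef_sqrt_ex1[OF Q]] by (simp add: matrix_sqrt_def)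
  then have "Q *v z = matrix_sqrt Q *v (matrix_sqrt Q *v z)"
    by (simp add: matrix_vector_mul_assoc)
  then have "Q *v z \<in> S" using S by auto
  then show ?thesis using z by (auto simp: orthogonal_comp_def orthogonal_def inner_commute)
qed

text \<open>The truncation term is integrable off \<open>S\<close>, where \<open>\<mu>\<close> is
  finite, and is merged into the linear part. The minus sign comes from the convention
  \<open>E exp (i <z, X_t>) = exp (- t psi (z))\<close>, under which a drift \<open>d\<close> has
  exponent \<open>- i <d, z>\<close>.\<close>

definition outer_drift :: "real^'n \<Rightarrow> (real^'n) measure \<Rightarrow> (real^'n) set \<Rightarrow> real^'n" where
  "outer_drift a \<mu> S = - (a + (\<integral>x. indicator {x. norm x < 1 \<and> x \<notin> S} x *\<^sub>R x \<partial>\<mu>))"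

text \<open>On \<open>S\<close> the integrand vanishes, and off \<open>S\<close> the measure is
  finite, so the truncation term can be split off. What remains is the exponent
  \<open>\<eta>\<close> of a compound Poisson variable; its bound comes from
  \<open>norm (1 - iexp r) \<le> 2\<close> and is uniform in \<open>w\<close>, on which the estimate
  for nonzero increments rests.\<close>

lemma levy_exponent_orthogonal:
  fixes \<mu> :: "(real^'n) measure"
  assumes \<mu>: "levy_measure \<mu>" and fin: "emeasure \<mu> (UNIV - S) < \<infinity>" and S: "subspace S"
    and Q: "w \<bullet> (Q *v w) = 0" and w: "w \<in> S\<^sup>\<bottom>"
  shows "\<exists>\<eta>. levy_exponent a Q \<mu> w = - \<i> * complex_of_real (w \<bullet> outer_drift a \<mu> S) + \<eta> \<and>
    0 \<le> Re \<eta> \<and> norm \<eta> \<le> 2 * measure \<mu> (UNIV - S)"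
proof -
  have sets: "sets \<mu> = sets (restrict_space borel (UNIV - {0}))" using \<mu> by (simp add: levy_measure_def)
  have space: "space \<mu> = UNIV - {0}" using sets_eq_imp_space_eq[OF sets] by (simp add: space_restrict_space)
  have meas: "f \<in> measurable \<mu> N" if "f \<in> measurable borel N" for f :: "real^'n \<Rightarrow> 'b" and N
    using that by (simp add: measurable_cong_sets[OF sets refl] measurable_restrict_space1)
  have S0: "0 \<in> S" using S by (rule subspace_0)
  have S_borel [measurable]: "S \<in> sets borel" using closed_subspace[OF S] by auto
  have A: "UNIV - S \<in> sets \<mu>"
    unfolding sets using S0 by (subst sets_restrict_space_iff) auto
  have wS: "w \<bullet> x = 0" if "x \<in> S" for x using w that by (auto simp: orthogonal_comp_def orthogonal_def inner_commute)
  have int: "integrable \<mu> f" if "f \<in> borel_measurable borel" "\<And>x. norm (f x) \<le> b" "\<And>x. x \<in> S \<Longrightarrow> f x = 0"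
    for f :: "real^'n \<Rightarrow> 'b::{banach, second_countable_topology}" and b
    by (rule integrableI_bounded_set[OF A _ fin, of f b]) (use that in \<open>auto intro: meas\<close>)
  define G where "G x = 1 - iexp (w \<bullet> x)" for x
  define K where "K x = indicator {x. norm x < 1 \<and> x \<notin> S} x *\<^sub>R x" for x :: "real^'n"
  have G_norm: "norm (G x) \<le> 2" for x
    using norm_triangle_ineq4[of 1 "iexp (w \<bullet> x)"] by (simp add: G_def)
  have G_meas: "G \<in> borel_measurable borel" unfolding G_def by measurable
  have G_zero: "G x = 0" if "x \<in> S" for x by (simp add: G_def wS that)
  have int_G: "integrable \<mu> G" by (rule int[of _ 2]) (fact G_meas G_norm G_zero)+
  have K_norm: "norm (K x) \<le> 1" for x by (simp add: K_def indicator_def)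
  have K_meas: "K \<in> borel_measurable borel" unfolding K_def by measurable
  have int_K: "integrable \<mu> K" by (rule int[of _ 1]) (fact K_meas K_norm | simp add: K_def)+
  have split: "1 - iexp (w \<bullet> x) + \<i> * complex_of_real (w \<bullet> x) * indicator {x. norm x < 1} x
      = G x + \<i> * complex_of_real (w \<bullet> K x)" for x
    by (cases "x \<in> S") (auto simp: G_def K_def wS indicator_def)
  have int_wK: "integrable \<mu> (\<lambda>x. w \<bullet> K x)" using int_K by simp
  define \<eta> where "\<eta> = (\<integral>x. G x \<partial>\<mu>)"
  have "(\<integral>x. 1 - iexp (w \<bullet> x) + \<i> * complex_of_real (w \<bullet> x) * indicator {x. norm x < 1} x \<partial>\<mu>)
      = \<eta> + \<i> * complex_of_real (w \<bullet> (\<integral>x. K x \<partial>\<mu>))"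
    unfolding split \<eta>_def using int_G int_wK int_K
    by (subst Bochner_Integration.integral_add) auto
  then have "levy_exponent a Q \<mu> w = - \<i> * complex_of_real (w \<bullet> outer_drift a \<mu> S) + \<eta>"
    unfolding levy_exponent_def Q outer_drift_def K_def
    by (simp add: inner_add_right inner_commute[of a] algebra_simps)
  moreover have "0 \<le> Re \<eta>"
  proof -
    have "Re \<eta> = (\<integral>x. Re (G x) \<partial>\<mu>)" unfolding \<eta>_def using integral_Re[OF int_G] by simp
    also have "\<dots> \<ge> 0" by (intro Bochner_Integration.integral_nonneg) (simp add: G_def Re_exp)
    finally show ?thesis .
  qed
  moreover have "norm \<eta> \<le> 2 * measure \<mu> (UNIV - S)"
  proof -
    have "norm \<eta> \<le> (\<integral>x. norm (G x) \<partial>\<mu>)" unfolding \<eta>_def by (rule integral_norm_bound)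
    also have "\<dots> \<le> (\<integral>x. 2 * indicator (UNIV - S) x \<partial>\<mu>)"
      using int_G A fin G_norm G_zero
      by (intro integral_mono integrable_norm integrable_mult_right integrable_real_indicator)
        (auto simp: indicator_def)
    also have "\<dots> = 2 * measure \<mu> (UNIV - S)" using A by simp
    finally show ?thesis .
  qed
  ultimately show ?thesis by blast
qed

context levy_process
begin

text \<open>With the drift removed the characteristic function is \<open>exp (- h \<eta>)\<close>
  with \<open>norm \<eta> \<le> C\<close>. Its modulus costs at most \<open>C * h\<close>; its
  rotation costs at most \<open>(C * h)\<^sup>2 / 2\<close>, which is below
  \<open>C\<^sup>2 * h\<close> because \<open>h \<le> 1\<close>. Neither bound depends on
  \<open>u\<close>.\<close>

lemma one_minus_char_le:
  fixes z d :: 'a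
  assumes char: "\<And>u h. 0 \<le> h \<Longrightarrow> \<exists>\<eta>. expectation (\<lambda>\<omega>. iexp ((u *\<^sub>R z) \<bullet> X h \<omega>))
      = exp (- (complex_of_real h * (- \<i> * complex_of_real ((u *\<^sub>R z) \<bullet> d) + \<eta>))) \<and> 0 \<le> Re \<eta> \<and> norm \<eta> \<le> C"
    and h: "0 \<le> h" "h \<le> 1"
  shows "1 - expectation (\<lambda>\<omega>. cos (u * (z \<bullet> X h \<omega> - h * (z \<bullet> d)))) \<le> (C + C\<^sup>2) * h"
proof -
  note Xh [measurable] = measurable_X[OF h(1)]
  obtain \<eta> where \<eta>: "expectation (\<lambda>\<omega>. iexp ((u *\<^sub>R z) \<bullet> X h \<omega>))
      = exp (- (complex_of_real h * (- \<i> * complex_of_real ((u *\<^sub>R z) \<bullet> d) + \<eta>)))" "0 \<le> Re \<eta>" "norm \<eta> \<le> C"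
    using char[OF h(1)] by blast
  define c where "c = u * h * (z \<bullet> d)"
  have int: "integrable M (\<lambda>\<omega>. iexp ((u *\<^sub>R z) \<bullet> X h \<omega>))"
    by (rule integrable_const_bound[where B=1]) auto
  have "expectation (\<lambda>\<omega>. iexp (u * (z \<bullet> X h \<omega> - h * (z \<bullet> d))))
      = expectation (\<lambda>\<omega>. iexp (- c) * iexp ((u *\<^sub>R z) \<bullet> X h \<omega>))"
    by (intro Bochner_Integration.integral_cong refl)
      (simp add: c_def exp_add[symmetric] algebra_simps)
  also have "\<dots> = iexp (- c) * expectation (\<lambda>\<omega>. iexp ((u *\<^sub>R z) \<bullet> X h \<omega>))"
    using int by simp
  also have "\<dots> = exp (- (complex_of_real h * \<eta>))"
    unfolding \<eta>(1) exp_add[symmetric] by (simp add: c_def algebra_simps)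
  finally have eq: "expectation (\<lambda>\<omega>. iexp (u * (z \<bullet> X h \<omega> - h * (z \<bullet> d)))) = exp (- (complex_of_real h * \<eta>))" .
  have int2: "integrable M (\<lambda>\<omega>. iexp (u * (z \<bullet> X h \<omega> - h * (z \<bullet> d))))"
    by (rule integrable_const_bound[where B=1]) auto
  have "expectation (\<lambda>\<omega>. cos (u * (z \<bullet> X h \<omega> - h * (z \<bullet> d))))
      = expectation (\<lambda>\<omega>. Re (iexp (u * (z \<bullet> X h \<omega> - h * (z \<bullet> d)))))"
    by (intro Bochner_Integration.integral_cong refl) (simp add: Re_exp)
  also have "\<dots> = Re (exp (- (complex_of_real h * \<eta>)))"
    using integral_Re[OF int2] eq by simp
  also have "\<dots> = exp (- (h * Re \<eta>)) * cos (h * Im \<eta>)" by (simp add: Re_exp)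
  finally have E: "expectation (\<lambda>\<omega>. cos (u * (z \<bullet> X h \<omega> - h * (z \<bullet> d)))) = exp (- (h * Re \<eta>)) * cos (h * Im \<eta>)" .
  have C0: "0 \<le> C" using \<eta>(3) norm_ge_zero order_trans by blast
  have re: "h * Re \<eta> \<le> C * h"
  proof -
    have "Re \<eta> \<le> C" using complex_Re_le_cmod[of \<eta>] \<eta>(3) by (rule order_trans)
    then show ?thesis using h(1) by (simp add: mult.commute[of C] mult_left_mono)
  qed
  have im: "(h * Im \<eta>)\<^sup>2 / 2 \<le> C\<^sup>2 * h"
  proof -
    have "(Im \<eta>)\<^sup>2 \<le> C\<^sup>2"
      using abs_Im_le_cmod[of \<eta>] \<eta>(3) C0 by (intro power2_le_iff_abs_le[THEN iffD2]) auto
    moreover have "h\<^sup>2 \<le> h" using h by (simp add: power2_eq_square mult_left_le_one_le)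
    ultimately have "h\<^sup>2 * (Im \<eta>)\<^sup>2 \<le> h * C\<^sup>2" using h by (intro mult_mono) auto
    moreover have "0 \<le> h * C\<^sup>2" using h by simp
    ultimately show ?thesis by (simp add: power_mult_distrib mult.commute)
  qed
  have "1 - exp (- (h * Re \<eta>)) * cos (h * Im \<eta>)
      = (1 - exp (- (h * Re \<eta>))) + exp (- (h * Re \<eta>)) * (1 - cos (h * Im \<eta>))"
    by (simp add: algebra_simps)
  also have "\<dots> \<le> h * Re \<eta> + 1 * ((h * Im \<eta>)\<^sup>2 / 2)"
  proof (intro add_mono mult_mono)
    show "1 - exp (- (h * Re \<eta>)) \<le> h * Re \<eta>" using exp_ge_add_one_self[of "- (h * Re \<eta>)"] by simp
    show "1 - cos (h * Im \<eta>) \<le> (h * Im \<eta>)\<^sup>2 / 2"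
    proof -
      have "cos (h * Im \<eta>) = 1 - 2 * (sin (h * Im \<eta> / 2))\<^sup>2" using cos_double_sin[of "h * Im \<eta> / 2"] by simp
      moreover have "(sin (h * Im \<eta> / 2))\<^sup>2 \<le> (h * Im \<eta> / 2)\<^sup>2"
        using abs_sin_x_le_abs_x[of "h * Im \<eta> / 2"] unfolding abs_le_square_iff .
      ultimately show ?thesis by (simp add: power2_eq_square)
    qed
  qed (use h \<eta>(2) in auto)
  also have "\<dots> \<le> (C + C\<^sup>2) * h" using re im by (simp add: distrib_right)
  finally show ?thesis unfolding E .
qed

end

section \<open>Path functionals\<close>

text \<open>Paths are sampled at the nonnegative rationals.  A rational witness strictly beyond \<open>t\<close>
  makes \<open>frozen_until\<close> exclude a change at \<open>t\<close> itself.  The limit in \<open>jump_pos\<close> is the position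
  at the first change of \<open>w\<close>, and a junk value unless \<open>jumped\<close> holds.\<close>

definition frozen_until :: "('a \<Rightarrow> 'b) \<Rightarrow> (real \<Rightarrow> 'a) \<Rightarrow> real \<Rightarrow> bool" where
  "frozen_until w \<phi> t \<longleftrightarrow>
     (\<exists>q\<in>rat_times. t < q \<and> (\<forall>q'\<in>rat_times. q' \<le> q \<longrightarrow> w (\<phi> q') = w (\<phi> 0)))"

definition jumped :: "('a \<Rightarrow> 'b) \<Rightarrow> (real \<Rightarrow> 'a) \<Rightarrow> bool" where
  "jumped w \<phi> \<longleftrightarrow> (\<exists>q\<in>rat_times. w (\<phi> q) \<noteq> w (\<phi> 0))"

text \<open>Right limits along dyadic times recover the path at real times, jointly measurably in
  path and time. For nonnegative \<open>t\<close> the successor of the floor keeps the sampling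
  times strictly above \<open>t\<close>, where right continuity controls them.\<close>

definition path_ext :: "(real \<Rightarrow> 'a::t2_space) \<Rightarrow> real \<Rightarrow> 'a" where
  "path_ext \<phi> t = lim (\<lambda>m. \<phi> (real (Suc (nat \<lfloor>t * 2 ^ m\<rfloor>)) / 2 ^ m))"

definition jump_pos :: "('a \<Rightarrow> 'b) \<Rightarrow> (real \<Rightarrow> 'a::t2_space) \<Rightarrow> 'a" where
  "jump_pos w \<phi> = lim (\<lambda>m. \<phi> (real (LEAST k. w (\<phi> (real k / 2 ^ m)) \<noteq> w (\<phi> 0)) / 2 ^ m))"

lemma measurable_path_component [measurable (raw)]:
  assumes "f \<in> measurable N path_space" "q \<in> rat_times"
  shows "(\<lambda>x. f x q) \<in> borel_measurable N"
  using measurable_compose[OF assms(1)[unfolded path_space_def] measurable_component_singleton[OF assms(2)]] .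

lemma pred_rat_times_bounded:
  assumes "\<And>q. q \<in> rat_times \<Longrightarrow> Measurable.pred N (P q)"
  shows "Measurable.pred N (\<lambda>x. \<forall>q\<in>rat_times. P q x)" "Measurable.pred N (\<lambda>x. \<exists>q\<in>rat_times. P q x)"
proof -
  have ex: "Measurable.pred N (\<lambda>x. \<exists>q\<in>rat_times. R q x)"
    if "\<And>q. q \<in> rat_times \<Longrightarrow> Measurable.pred N (R q)" for R
  proof -
    have "(\<Union>q\<in>rat_times. {x \<in> space N. R q x}) \<in> sets N"
      using that by (intro sets.countable_UN' countable_rat_times) (auto simp: pred_def)
    also have "(\<Union>q\<in>rat_times. {x \<in> space N. R q x}) = {x \<in> space N. \<exists>q\<in>rat_times. R q x}" by blast
    finally show ?thesis by (simp add: pred_def)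
  qed
  show "Measurable.pred N (\<lambda>x. \<exists>q\<in>rat_times. P q x)" by (rule ex[OF assms])
  have "Measurable.pred N (\<lambda>x. \<not> (\<exists>q\<in>rat_times. \<not> P q x))"
    by (intro pred_intros_logic ex assms)
  then show "Measurable.pred N (\<lambda>x. \<forall>q\<in>rat_times. P q x)" by simp
qed

context
  fixes w :: "'a::euclidean_space \<Rightarrow> 'a"
  assumes w [measurable]: "w \<in> borel_measurable borel"
begin

lemma pred_w_eq [measurable (raw)]:
  assumes "f \<in> measurable N path_space" "q \<in> rat_times"
  shows "Measurable.pred N (\<lambda>x. w (f x q) = w (f x 0))"
proof -
  have "(\<lambda>x. w (f x q) - w (f x 0)) \<in> borel_measurable N"
    using assms by (intro borel_measurable_diff measurable_compose[OF measurable_path_component w]) auto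
  then have "Measurable.pred N (\<lambda>x. w (f x q) - w (f x 0) \<in> {0})"
    by (intro pred_sets2[of _ borel]) auto
  then show ?thesis by simp
qed

lemma measurable_frozen_until [measurable (raw)]:
  assumes [measurable]: "f \<in> measurable N path_space" "g \<in> borel_measurable N"
  shows "Measurable.pred N (\<lambda>x. frozen_until w (f x) (g x))"
proof -
  have "Measurable.pred N (\<lambda>x. q' \<le> q \<longrightarrow> w (f x q') = w (f x 0))" if "q' \<in> rat_times" for q' q
    by (intro pred_intros_logic pred_w_eq that) measurable
  note all = pred_rat_times_bounded(1)[OF this]
  show ?thesis
    unfolding frozen_until_def
    by (intro pred_rat_times_bounded(2) pred_intros_logic all) measurable
qed

lemma measurable_jumped [measurable (raw)]:
  assumes [measurable]: "f \<in> measurable N path_space"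
  shows "Measurable.pred N (\<lambda>x. jumped w (f x))"
  unfolding jumped_def
  by (intro pred_rat_times_bounded(2) pred_intros_logic pred_w_eq assms)

lemma measurable_jump_pos [measurable (raw)]:
  assumes [measurable]: "f \<in> measurable N path_space"
  shows "(\<lambda>x. jump_pos w (f x)) \<in> borel_measurable N"
proof -
  have "(\<lambda>x. f x (real (LEAST k. w (f x (real k / 2 ^ m)) \<noteq> w (f x 0)) / 2 ^ m)) \<in> borel_measurable N" for m :: nat
  proof (rule measurable_compose_countable[where f="\<lambda>k x. f x (real k / 2 ^ m)"])
    show "(\<lambda>x. f x (real k / 2 ^ m)) \<in> borel_measurable N" for k
      by (intro measurable_path_component) auto
    show "(\<lambda>x. LEAST k. w (f x (real k / 2 ^ m)) \<noteq> w (f x 0)) \<in> measurable N (count_space UNIV)"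
      by (intro measurable_Least pred_intros_logic pred_w_eq) auto
  qed
  then show ?thesis unfolding jump_pos_def by (rule borel_measurable_lim_metric)
qed

end

lemma measurable_path_ext [measurable (raw)]:
  fixes f :: "'b \<Rightarrow> real \<Rightarrow> 'a::euclidean_space"
  assumes [measurable]: "f \<in> measurable N path_space" "g \<in> borel_measurable N"
  shows "(\<lambda>x. path_ext (f x) (g x)) \<in> borel_measurable N"
proof -
  have "(\<lambda>x. f x (real (Suc (nat \<lfloor>g x * 2 ^ m\<rfloor>)) / 2 ^ m)) \<in> borel_measurable N" for m :: nat
  proof (rule measurable_compose_countable[where f="\<lambda>k x. f x (real (Suc (nat k)) / 2 ^ m)"])
    show "(\<lambda>x. f x (real (Suc (nat k)) / 2 ^ m)) \<in> borel_measurable N" for k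
      by (intro measurable_path_component) (auto simp del: of_nat_Suc)
  qed measurable
  then show ?thesis unfolding path_ext_def by (rule borel_measurable_lim_metric)
qed

section \<open>Right-continuous paths and their first jump after a rational time\<close>

lemma tendsto_from_right:
  fixes x :: "real \<Rightarrow> 'a::metric_space"
  assumes x: "(x \<longlongrightarrow> x t) (at_right t)" and s: "s \<longlonglongrightarrow> t" "\<forall>\<^sub>F m in sequentially. t \<le> s m"
  shows "(\<lambda>m. x (s m)) \<longlonglongrightarrow> x t"
proof (rule tendstoI)
  fix e :: real assume e: "0 < e"
  obtain b where b: "t < b" "\<And>y. t < y \<Longrightarrow> y < b \<Longrightarrow> dist (x y) (x t) < e"
    using tendstoD[OF x e] unfolding eventually_at_right_field by blast
  have "\<forall>\<^sub>F m in sequentially. s m < b" using order_tendstoD(2)[OF s(1) b(1)] .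
  then show "\<forall>\<^sub>F m in sequentially. dist (x (s m)) (x t) < e"
    using s(2)
  proof eventually_elim
    case (elim m)
    then show ?case using b(2)[of "s m"] e by (cases "s m = t") auto
  qed
qed

definition right_cont_path :: "(real \<Rightarrow> 'a::topological_space) \<Rightarrow> bool" where
  "right_cont_path x \<longleftrightarrow> (\<forall>t\<ge>0. (x \<longlongrightarrow> x t) (at_right t))"

definition shift_path :: "real \<Rightarrow> (real \<Rightarrow> 'a::euclidean_space) \<Rightarrow> real \<Rightarrow> 'a" where
  "shift_path p x = (\<lambda>q\<in>rat_times. x (p + q) - x p)"

lemma shift_path_rat: "q \<in> rat_times \<Longrightarrow> shift_path p x q = x (p + q) - x p"
  by (simp add: shift_path_def)

lemma path_ext_shift_path:
  assumes x: "right_cont_path x" and p: "p \<in> rat_times" and t: "0 \<le> t"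
  shows "path_ext (shift_path p x) t = x (p + t) - x p"
  unfolding path_ext_def
proof (rule limI)
  let ?d = "\<lambda>m. real (Suc (nat \<lfloor>t * 2 ^ m\<rfloor>)) / 2 ^ m"
  have d: "?d m = real_of_int (\<lfloor>t * 2 ^ m\<rfloor> + 1) / 2 ^ m" for m using t by simp
  have "(\<lambda>m. p + ?d m) \<longlonglongrightarrow> p + t"
    unfolding d by (intro tendsto_intros tendsto_dyadic_upper(1))
  moreover have "\<forall>\<^sub>F m in sequentially. p + t \<le> p + ?d m"
    unfolding d using tendsto_dyadic_upper(2)[of t] by (intro always_eventually allI) (simp add: less_imp_le)
  moreover have "(x \<longlongrightarrow> x (p + t)) (at_right (p + t))"
    using x t rat_times_nonneg[OF p] by (simp add: right_cont_path_def)
  ultimately have "(\<lambda>m. x (p + ?d m)) \<longlonglongrightarrow> x (p + t)"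
    by (intro tendsto_from_right[where x=x and s="\<lambda>m. p + ?d m"])
  moreover have "shift_path p x (?d m) = x (p + ?d m) - x p" for m
    by (rule shift_path_rat) (rule rat_times_closed)
  ultimately show "(\<lambda>m. shift_path p x (?d m)) \<longlonglongrightarrow> x (p + t) - x p"
    by (simp only: tendsto_intros)
qed

context
  fixes w :: "'a::euclidean_space \<Rightarrow> 'a" and x :: "real \<Rightarrow> 'a"
  assumes lin: "linear w" and x: "right_cont_path x" and step: "step_path (\<lambda>t. w (x t))"
begin

lemma w_shift_eq_iff: "q \<in> rat_times \<Longrightarrow> w (shift_path p x q) = w (shift_path p x 0) \<longleftrightarrow> w (x (p + q)) = w (x p)"
  by (simp add: shift_path_rat linear_diff[OF lin] linear_0[OF lin])

lemma frozen_until_shiftD: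
  assumes p: "p \<in> rat_times" and t: "0 \<le> t" "frozen_until w (shift_path p x) t"
  shows "w (x (p + t)) = w (x p)"
proof -
  obtain q where q: "q \<in> rat_times" "t < q"
      "\<And>q'. q' \<in> rat_times \<Longrightarrow> q' \<le> q \<Longrightarrow> w (x (p + q')) = w (x p)"
    using t(2) by (auto simp: frozen_until_def w_shift_eq_iff)
  have pt: "0 \<le> p + t" using t(1) rat_times_nonneg[OF p] by simp
  obtain b where b: "p + t < b" "\<And>s. p + t < s \<Longrightarrow> s < b \<Longrightarrow> w (x s) = w (x (p + t))"
    using step pt unfolding step_path_def eventually_at_right_field by blast
  obtain r where r: "r \<in> rat_times" "t < r" "r < min q (b - p)"
    using rat_times_between[OF t(1), of "min q (b - p)"] q(2) b(1) by auto
  then show ?thesis using q(3)[of r] b(2)[of "p + r"] by auto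
qed

lemma frozen_until_shiftI:
  assumes "p \<in> rat_times" "0 \<le> t" "p + t < b" "\<And>s. p \<le> s \<Longrightarrow> s < b \<Longrightarrow> w (x s) = w (x p)"
  shows "frozen_until w (shift_path p x) t"
proof -
  obtain q where q: "q \<in> rat_times" "t < q" "q < b - p"
    using rat_times_between[of t "b - p"] assms by auto
  have "w (shift_path p x q') = w (shift_path p x 0)" if "q' \<in> rat_times" "q' \<le> q" for q'
    unfolding w_shift_eq_iff[OF that(1)] using that q rat_times_nonneg[OF that(1)]
    by (intro assms(4)) auto
  then show ?thesis unfolding frozen_until_def using q by blast
qed

lemma jump_pos_shift:
  assumes p: "p \<in> rat_times" and t: "p < t"
    and before: "\<And>s. p \<le> s \<Longrightarrow> s < t \<Longrightarrow> w (x s) = w (x p)" and at: "w (x t) \<noteq> w (x p)"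
  shows "jump_pos w (shift_path p x) = x t - x p"
  unfolding jump_pos_def
proof (rule limI)
  have p0: "0 \<le> p" using p by (rule rat_times_nonneg)
  then have t0: "0 \<le> t" using t by simp
  obtain b where b: "t < b" "\<And>s. t < s \<Longrightarrow> s < b \<Longrightarrow> w (x s) = w (x t)"
    using step t0 unfolding step_path_def eventually_at_right_field by blast
  define k where "k m = (LEAST k. w (shift_path p x (real k / 2 ^ m)) \<noteq> w (shift_path p x 0))" for m :: nat
  have k_eq: "k m = (LEAST k. w (x (p + real k / 2 ^ m)) \<noteq> w (x p))" for m
    unfolding k_def by (simp add: w_shift_eq_iff)
  have bounds: "t \<le> p + real (k m) / 2 ^ m \<and> p + real (k m) / 2 ^ m \<le> t + (1/2) ^ m" if m: "(1/2) ^ m < b - t" for m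
  proof -
    \<comment> \<open>The first grid point at or after \<open>t\<close>. Once the mesh is below
      \<open>b - t\<close> it still sees the value at \<open>t\<close>, so the first grid point with
      a changed value lies between \<open>t\<close> and this one.\<close>
    define k0 where "k0 = nat \<lceil>(t - p) * 2 ^ m\<rceil>"
    have "(t - p) * 2 ^ m \<le> real k0" "real k0 \<le> (t - p) * 2 ^ m + 1"
      using t by (auto simp: k0_def of_nat_nat)
    then have "(t - p) \<le> real k0 / 2 ^ m" "real k0 / 2 ^ m \<le> ((t - p) * 2 ^ m + 1) / 2 ^ m"
      by (auto simp: pos_le_divide_eq intro!: divide_right_mono)
    then have k0: "t \<le> p + real k0 / 2 ^ m" "p + real k0 / 2 ^ m \<le> t + (1/2) ^ m"
      by (auto simp: add_divide_distrib power_one_over)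
    have "w (x (p + real k0 / 2 ^ m)) = w (x t)"
      using b(2)[of "p + real k0 / 2 ^ m"] k0 m by (cases "t = p + real k0 / 2 ^ m") auto
    then have k0_change: "w (x (p + real k0 / 2 ^ m)) \<noteq> w (x p)" using at by simp
    have "k m \<le> k0" unfolding k_eq by (rule Least_le) (rule k0_change)
    then have "real (k m) / 2 ^ m \<le> real k0 / 2 ^ m" by (intro divide_right_mono) auto
    moreover have "w (x (p + real (k m) / 2 ^ m)) \<noteq> w (x p)"
      unfolding k_eq by (rule LeastI) (rule k0_change)
    then have "t \<le> p + real (k m) / 2 ^ m"
      using before[of "p + real (k m) / 2 ^ m"] by force
    ultimately show ?thesis using k0 by linarith
  qed
  have small: "\<forall>\<^sub>F m in sequentially. (1/2) ^ m < b - t"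
    using order_tendstoD(2)[OF LIMSEQ_realpow_zero[of "1/2"], of "b - t"] b(1) by simp
  have lim: "(\<lambda>m. t + (1/2::real) ^ m) \<longlonglongrightarrow> t"
    using tendsto_add[OF tendsto_const LIMSEQ_realpow_zero[of "1/2"], of t] by simp
  have ev1: "\<forall>\<^sub>F m in sequentially. t \<le> p + real (k m) / 2 ^ m"
    using small by eventually_elim (use bounds in blast)
  have ev2: "\<forall>\<^sub>F m in sequentially. p + real (k m) / 2 ^ m \<le> t + (1/2) ^ m"
    using small by eventually_elim (use bounds in blast)
  have "(\<lambda>m. p + real (k m) / 2 ^ m) \<longlonglongrightarrow> t"
    by (rule tendsto_sandwich[OF ev1 ev2 tendsto_const lim])
  moreover have "(x \<longlongrightarrow> x t) (at_right t)" using x t0 by (simp add: right_cont_path_def)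
  ultimately have "(\<lambda>m. x (p + real (k m) / 2 ^ m)) \<longlonglongrightarrow> x t"
    using ev1 by (intro tendsto_from_right[where x=x and s="\<lambda>m. p + real (k m) / 2 ^ m"])
  then have "(\<lambda>m. x (p + real (k m) / 2 ^ m) - x p) \<longlonglongrightarrow> x t - x p"
    by (intro tendsto_diff tendsto_const)
  then show "(\<lambda>m. shift_path p x (real (LEAST k. w (shift_path p x (real k / 2 ^ m)) \<noteq> w (shift_path p x 0)) / 2 ^ m))
      \<longlonglongrightarrow> x t - x p"
    unfolding k_def[symmetric] by (simp add: shift_path_rat)
qed

lemma jumped_shiftI:
  assumes p: "p \<in> rat_times" and t: "p \<le> t" "w (x t) \<noteq> w (x p)"
  shows "jumped w (shift_path p x)"
proof -
  have t0: "0 \<le> t" using t(1) rat_times_nonneg[OF p] by simp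
  obtain b where b: "t < b" "\<And>s. t < s \<Longrightarrow> s < b \<Longrightarrow> w (x s) = w (x t)"
    using step t0 unfolding step_path_def eventually_at_right_field by blast
  obtain r where r: "r \<in> rat_times" "t - p < r" "r < b - p"
    using rat_times_between[of "t - p" "b - p"] b(1) t(1) by auto
  then have "w (x (p + r)) \<noteq> w (x p)" using b(2)[of "p + r"] t(2) by auto
  then show ?thesis unfolding jumped_def using r(1) by (intro bexI[of _ r]) (auto simp: w_shift_eq_iff)
qed

text \<open>For a rational \<open>p\<close> shortly before \<open>t\<close> the value of
  \<open>w\<close> is constant in between. Either it does not change at \<open>t\<close> and is
  frozen past \<open>t\<close>, or \<open>t\<close> is the first change after \<open>p\<close>. For
  positive \<open>t\<close> the strict \<open>p < t\<close> matters, because \<open>avoids\<close>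
  below speaks of positive elapsed times only.\<close>

lemma time_cases:
  assumes t: "0 \<le> t"
  shows "(\<exists>p\<in>rat_times. p \<le> t \<and> (0 < t \<longrightarrow> p < t) \<and> frozen_until w (shift_path p x) (t - p)) \<or>
    (\<exists>p\<in>rat_times. jumped w (shift_path p x) \<and> x t = x p + jump_pos w (shift_path p x))"
proof -
  obtain b where b: "t < b" "\<And>s. t < s \<Longrightarrow> s < b \<Longrightarrow> w (x s) = w (x t)"
    using step t unfolding step_path_def eventually_at_right_field by blast
  show ?thesis
  proof (cases "t = 0")
    case True
    have "frozen_until w (shift_path 0 x) (t - 0)"
    proof (rule frozen_until_shiftI[where b=b])
      fix s :: real assume "0 \<le> s" "s < b"
      then show "w (x s) = w (x 0)" using b(2)[of s] True by (cases "s = 0") auto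
    qed (use b True in auto)
    then show ?thesis using True by auto
  next
    case False
    with t have "0 < t" by simp
    then obtain c d where d: "d < t" "\<And>s. d < s \<Longrightarrow> s < t \<Longrightarrow> w (x s) = c"
      using step unfolding step_path_def eventually_at_left_field by blast
    obtain p where p: "p \<in> rat_times" "max 0 d < p" "p < t"
      using rat_times_between[of "max 0 d" t] d(1) \<open>0 < t\<close> by auto
    have before: "w (x s) = w (x p)" if "p \<le> s" "s < t" for s
      using d(2)[of s] d(2)[of p] that p by auto
    show ?thesis
    proof (cases "w (x t) = w (x p)")
      case True
      have "frozen_until w (shift_path p x) (t - p)"
      proof (rule frozen_until_shiftI[where b=b])
        fix s assume s: "p \<le> s" "s < b"
        consider "s < t" | "s = t" | "t < s" by linarith
        then show "w (x s) = w (x p)"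
          by cases (use before[of s] b(2)[of s] s True in auto)
      qed (use p b in auto)
      then show ?thesis using p by (intro disjI1 bexI[of _ p]) auto
    next
      case False
      then have "jumped w (shift_path p x)" "jump_pos w (shift_path p x) = x t - x p"
        using jumped_shiftI[OF p(1), of t] jump_pos_shift[OF p(1,3) before False] p by auto
      then show ?thesis using p by (intro disjI2 bexI[of _ p]) auto
    qed
  qed
qed

lemma frozen_until_start: "\<exists>m::nat. frozen_until w (shift_path 0 x) (1 / 2 ^ m)"
proof -
  obtain b where b: "0 < b" "\<And>s. 0 < s \<Longrightarrow> s < b \<Longrightarrow> w (x s) = w (x 0)"
    using step unfolding step_path_def eventually_at_right_field by blast
  obtain m where m: "(1/2) ^ m < b" using real_arch_pow_inv[OF b(1), of "1/2"] by auto
  have "w (x s) = w (x 0)" if "0 \<le> s" "s < b" for s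
    using b(2)[of s] that by (cases "s = 0") auto
  then have "frozen_until w (shift_path 0 x) (1 / 2 ^ m)"
    by (rule frozen_until_shiftI[where b=b, rotated 3]) (use m in \<open>simp_all add: power_one_over\<close>)
  then show ?thesis ..
qed

text \<open>The first change comes after \<open>h\<close>, so it is also the first change of the
  path restarted at \<open>h\<close>. It happens at the infimum \<open>t\<close> of the times with a
  changed value, and this infimum is attained by right constancy.\<close>

lemma jump_pos_shift_cong:
  assumes h: "h \<in> rat_times" "frozen_until w (shift_path 0 x) h" and j: "jumped w (shift_path 0 x)"
  shows "x 0 + jump_pos w (shift_path 0 x) = x h + jump_pos w (shift_path h x)"
proof -
  define T where "T = {t. 0 \<le> t \<and> w (x t) \<noteq> w (x 0)}"
  obtain q where q: "q \<in> rat_times" "w (x q) \<noteq> w (x 0)" using j by (auto simp: jumped_def w_shift_eq_iff)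
  then have "q \<in> T" using rat_times_nonneg by (simp add: T_def)
  then have ne: "T \<noteq> {}" by blast
  have bdd: "bdd_below T" by (auto simp: T_def bdd_below_def)
  define t where "t = Inf T"
  have before: "w (x s) = w (x 0)" if "0 \<le> s" "s < t" for s
    using that cInf_lower[OF _ bdd, of s] by (force simp: T_def t_def)
  have t0: "0 \<le> t" unfolding t_def by (rule cInf_greatest[OF ne]) (auto simp: T_def)
  obtain b where b: "t < b" "\<And>s. t < s \<Longrightarrow> s < b \<Longrightarrow> w (x s) = w (x t)"
    using step t0 unfolding step_path_def eventually_at_right_field by blast
  have at: "w (x t) \<noteq> w (x 0)"
  proof
    assume *: "w (x t) = w (x 0)"
    obtain s where s: "s \<in> T" "s < b" using cInf_lessD[OF ne] b(1) unfolding t_def by blast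
    have "w (x s) = w (x 0)"
      using b(2)[of s] before[of s] * s by (cases s t rule: linorder_cases) (auto simp: T_def)
    then show False using s(1) by (simp add: T_def)
  qed
  have "h < t"
  proof (rule ccontr)
    assume "\<not> h < t"
    then have "t \<le> h" by simp
    then have "frozen_until w (shift_path 0 x) t"
      using h(2) unfolding frozen_until_def by (meson order_le_less_trans)
    then show False using frozen_until_shiftD[of 0 t] t0 at by simp
  qed
  have h0: "0 \<le> h" using h(1) by (rule rat_times_nonneg)
  have "0 < t" using \<open>h < t\<close> h0 by simp
  then have "jump_pos w (shift_path 0 x) = x t - x 0"
    using before at by (rule jump_pos_shift[OF rat_times_closed(1)])
  moreover have "jump_pos w (shift_path h x) = x t - x h"
  proof (rule jump_pos_shift[OF h(1) \<open>h < t\<close>])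
    have wh: "w (x h) = w (x 0)" using h0 \<open>h < t\<close> by (rule before)
    show "w (x s) = w (x h)" if "h \<le> s" "s < t" for s
      unfolding wh using that h0 by (intro before) auto
    show "w (x t) \<noteq> w (x h)" unfolding wh by (rule at)
  qed
  ultimately show ?thesis by simp
qed

end

section \<open>Regeneration at rational times\<close>

lemma orthogonal_projection_unique:
  assumes A: "subspace A" and y: "y \<in> A" "x - y \<in> A\<^sup>\<bottom>"
  shows "orthogonal_projection A x = y"
proof -
  let ?p = "orthogonal_projection A x"
  have p: "?p \<in> A" "x - ?p \<in> A\<^sup>\<bottom>" using orthogonal_projection[OF A, of x] by auto
  have "?p - y \<in> A" using p(1) y(1) A by (intro subspace_diff)
  then have "(?p - y) \<bullet> (x - y) = 0" "(?p - y) \<bullet> (x - ?p) = 0"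
    using p(2) y(2) by (auto simp: orthogonal_comp_def orthogonal_def)
  then have "(?p - y) \<bullet> (?p - y) = 0" by (simp add: inner_diff_right)
  then show ?thesis by simp
qed

lemma orthogonal_projection_in: "subspace A \<Longrightarrow> orthogonal_projection A x \<in> A"
  using orthogonal_projection by blast

lemma orthogonal_projection_id: "subspace A \<Longrightarrow> x \<in> A \<Longrightarrow> orthogonal_projection A x = x"
  by (intro orthogonal_projection_unique) (auto simp: subspace_0[OF subspace_orthogonal_comp])

lemma linear_orthogonal_projection:
  assumes A: "subspace A"
  shows "linear (orthogonal_projection A)"
proof (rule linearI)
  note C = subspace_orthogonal_comp[of A]
  show "orthogonal_projection A (x + y) = orthogonal_projection A x + orthogonal_projection A y" for x y
  proof (rule orthogonal_projection_unique[OF A])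
    have "(x - orthogonal_projection A x) + (y - orthogonal_projection A y) \<in> A\<^sup>\<bottom>"
      using orthogonal_projection[OF A] by (intro subspace_add[OF C]) auto
    then show "x + y - (orthogonal_projection A x + orthogonal_projection A y) \<in> A\<^sup>\<bottom>"
      by (simp add: algebra_simps)
  qed (intro subspace_add A orthogonal_projection_in)
  show "orthogonal_projection A (r *\<^sub>R x) = r *\<^sub>R orthogonal_projection A x" for r x
  proof (rule orthogonal_projection_unique[OF A])
    have "r *\<^sub>R (x - orthogonal_projection A x) \<in> A\<^sup>\<bottom>"
      using orthogonal_projection[OF A] by (intro subspace_scale[OF C]) auto
    then show "r *\<^sub>R x - r *\<^sub>R orthogonal_projection A x \<in> A\<^sup>\<bottom>" by (simp add: algebra_simps)
  qed (intro subspace_scale A orthogonal_projection_in)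
qed

lemma orthogonal_projection_complement:
  assumes A: "subspace A"
  shows "orthogonal_projection (A\<^sup>\<bottom>) x = x - orthogonal_projection A x"
proof (rule orthogonal_projection_unique)
  show "x - (x - orthogonal_projection A x) \<in> A\<^sup>\<bottom>\<^sup>\<bottom>"
    using orthogonal_projection_in[OF A, of x] by (auto simp: orthogonal_comp_def orthogonal_commute)
qed (use orthogonal_projection[OF A] in \<open>auto simp: subspace_orthogonal_comp\<close>)

lemma measurable_orthogonal_projection:
  "subspace A \<Longrightarrow> orthogonal_projection A \<in> borel_measurable borel"
  by (intro borel_measurable_continuous_onI linear_continuous_on
      linear_conv_bounded_linear[THEN iffD1] linear_orthogonal_projection)

text \<open>\<open>P\<close> need not be measurable; a measurable null set that covers its
  exceptions takes its place.\<close>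

lemma AE_pair_snd:
  assumes "prob_space K" "prob_space M" "AE \<omega> in M. P \<omega>"
  shows "AE (s, \<omega>) in K \<Otimes>\<^sub>M M. P \<omega>"
proof -
  interpret K: prob_space K by fact
  interpret M: prob_space M by fact
  interpret P: pair_prob_space K M ..
  obtain N where N: "{\<omega> \<in> space M. \<not> P \<omega>} \<subseteq> N" "emeasure M N = 0" "N \<in> sets M"
    using assms(3) by (rule AE_E)
  have "AE z in K \<Otimes>\<^sub>M M. snd z \<notin> N"
  proof (rule P.AE_pair_measure)
    show "{z \<in> space (K \<Otimes>\<^sub>M M). snd z \<notin> N} \<in> sets (K \<Otimes>\<^sub>M M)" using N(3) by measurable
    have "AE y in M. y \<notin> N" using N by (intro AE_not_in) auto
    then show "AE x in K. AE y in M. snd (x, y) \<notin> N" by simp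
  qed
  then show ?thesis
    by (rule AE_mp) (rule AE_I2, use N(1) in \<open>auto simp: space_pair_measure\<close>)
qed

lemma AE_pair_fstD:
  assumes "prob_space K" "prob_space M" "AE (s, \<omega>) in K \<Otimes>\<^sub>M M. P s"
  shows "AE s in K. P s"
proof -
  interpret K: prob_space K by fact
  interpret M: prob_space M by fact
  interpret P: pair_prob_space K M ..
  from P.AE_pair[OF assms(3)] have "AE s in K. AE \<omega> in M. P s" by simp
  then show ?thesis by eventually_elim (simp add: M.AE_const)
qed

section \<open>Restarts from random positions\<close>

locale levy_step_process = levy_process M X for M :: "'w measure" and X :: "real \<Rightarrow> 'w \<Rightarrow> 'a::euclidean_space" +
  fixes S :: "'a set"
  assumes subspace_S: "subspace S"
    and step: "AE \<omega> in M. step_path (\<lambda>t. X t \<omega> - orthogonal_projection S (X t \<omega>))"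
begin

definition w :: "'a \<Rightarrow> 'a" where
  "w x = x - orthogonal_projection S x"

definition good :: "'w \<Rightarrow> bool" where
  "good \<omega> \<longleftrightarrow> X 0 \<omega> = 0 \<and> right_cont_path (\<lambda>t. X t \<omega>) \<and> step_path (\<lambda>t. w (X t \<omega>))"

lemma AE_good: "AE \<omega> in M. good \<omega>"
  using start_zero cadlag_paths step
  by eventually_elim (auto simp: good_def right_cont_path_def w_def)

lemma linear_w: "linear w"
  unfolding w_def by (intro linear_compose_sub linear_orthogonal_projection subspace_S) (simp add: linear_iff)

lemma measurable_w [measurable]: "w \<in> borel_measurable borel"
  by (intro borel_measurable_continuous_onI linear_continuous_on linear_conv_bounded_linear[THEN iffD1] linear_w)

lemma shifted_trace_eq: "shifted_trace p \<omega> = shift_path p (\<lambda>t. X t \<omega>)"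
  by (simp add: shifted_trace_def shift_path_def)

lemma path_trace_eq: "good \<omega> \<Longrightarrow> path_trace \<omega> = shift_path 0 (\<lambda>t. X t \<omega>)"
  by (simp add: path_trace_def shift_path_def good_def)

lemmas frozen_measurable [measurable (raw)] = measurable_frozen_until[OF measurable_w]
lemmas jumped_measurable [measurable (raw)] = measurable_jumped[OF measurable_w]
lemmas jump_pos_measurable [measurable (raw)] = measurable_jump_pos[OF measurable_w]

abbreviation path_law :: "(real \<Rightarrow> 'a) measure" where
  "path_law \<equiv> distr M path_space path_trace"

lemma prob_space_path_law: "prob_space path_law"
  by (rule prob_space_distr) measurable

text \<open>The function \<open>F\<close> allows two kinds of restart: at the actual position
  \<open>x + X p\<close>, and at \<open>y + s\<close> plus the projected position, which discards
  the motion of \<open>w (X)\<close> up to \<open>p\<close>. For fixed \<open>s\<close> this is the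
  Markov property; the rest is integration over \<open>s\<close>.\<close>

lemma regen_law:
  assumes \<kappa>: "prob_space \<kappa>" and F [measurable]: "F \<in> borel_measurable (\<kappa> \<Otimes>\<^sub>M borel)" and p: "p \<in> rat_times"
  shows "distr (\<kappa> \<Otimes>\<^sub>M M) (borel \<Otimes>\<^sub>M path_space) (\<lambda>(s, \<omega>). (F (s, X p \<omega>), shifted_trace p \<omega>))
    = distr (\<kappa> \<Otimes>\<^sub>M M) borel (\<lambda>(s, \<omega>). F (s, X p \<omega>)) \<Otimes>\<^sub>M path_law"
proof (rule pair_measure_eqI[symmetric])
  interpret K: prob_space \<kappa> by fact
  interpret P: pair_prob_space \<kappa> M ..
  interpret L: prob_space path_law by (rule prob_space_path_law)
  note [measurable] = measurable_X_rat[OF p]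
  note [measurable] = measurable_shifted_trace[OF p]
  let ?\<nu> = "distr (\<kappa> \<Otimes>\<^sub>M M) borel (\<lambda>(s, \<omega>). F (s, X p \<omega>))"
  have Fm [measurable]: "(\<lambda>(s, \<omega>). F (s, X p \<omega>)) \<in> borel_measurable (\<kappa> \<Otimes>\<^sub>M M)" by measurable
  interpret N: prob_space ?\<nu> by (rule P.prob_space_distr) measurable
  show "sigma_finite_measure ?\<nu>" "sigma_finite_measure path_law" by unfold_locales
  show "sets (?\<nu> \<Otimes>\<^sub>M path_law) = sets (distr (\<kappa> \<Otimes>\<^sub>M M) (borel \<Otimes>\<^sub>M path_space) (\<lambda>(s, \<omega>). (F (s, X p \<omega>), shifted_trace p \<omega>)))"
    by (simp cong: sets_pair_measure_cong)
  fix A B assume "A \<in> sets ?\<nu>" "B \<in> sets path_law"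
  then have A [measurable]: "A \<in> sets borel" and B [measurable]: "B \<in> sets path_space" by auto
  have sect: "emeasure M {\<omega> \<in> space M. F (s, X p \<omega>) \<in> A \<and> shifted_trace p \<omega> \<in> B}
      = emeasure M {\<omega> \<in> space M. F (s, X p \<omega>) \<in> A} * emeasure path_law B" if s: "s \<in> space \<kappa>" for s
  proof -
    define A' where "A' = {u. F (s, u) \<in> A}"
    have "(\<lambda>u. F (s, u)) \<in> borel_measurable borel" using s by measurable
    from measurable_sets[OF this A] have A' [measurable]: "A' \<in> sets borel" by (simp add: A'_def vimage_def)
    have "emeasure (distr M (borel \<Otimes>\<^sub>M path_space) (\<lambda>\<omega>. (X p \<omega>, shifted_trace p \<omega>))) (A' \<times> B)
        = emeasure (distr M borel (X p)) A' * emeasure path_law B"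
      unfolding markov_law[OF p] by (rule L.emeasure_pair_measure_Times) auto
    moreover have "emeasure (distr M (borel \<Otimes>\<^sub>M path_space) (\<lambda>\<omega>. (X p \<omega>, shifted_trace p \<omega>))) (A' \<times> B)
        = emeasure M {\<omega> \<in> space M. F (s, X p \<omega>) \<in> A \<and> shifted_trace p \<omega> \<in> B}"
    proof -
      have AB: "A' \<times> B \<in> sets (borel \<Otimes>\<^sub>M path_space)" by measurable
      show ?thesis
        by (subst emeasure_distr[OF _ AB]) (measurable, auto simp: A'_def intro!: arg_cong[where f="emeasure M"])
    qed
    moreover have "emeasure (distr M borel (X p)) A' = emeasure M {\<omega> \<in> space M. F (s, X p \<omega>) \<in> A}"
      by (subst emeasure_distr[OF _ A']) (measurable, auto simp: A'_def intro!: arg_cong[where f="emeasure M"])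
    ultimately show ?thesis by simp
  qed
  define Z1 where "Z1 = {x \<in> space (\<kappa> \<Otimes>\<^sub>M M). F (fst x, X p (snd x)) \<in> A \<and> shifted_trace p (snd x) \<in> B}"
  define Z2 where "Z2 = {x \<in> space (\<kappa> \<Otimes>\<^sub>M M). F (fst x, X p (snd x)) \<in> A}"
  have Z1: "Z1 \<in> sets (\<kappa> \<Otimes>\<^sub>M M)" unfolding Z1_def by measurable
  have Z2: "Z2 \<in> sets (\<kappa> \<Otimes>\<^sub>M M)" unfolding Z2_def by measurable
  have AB: "A \<times> B \<in> sets (borel \<Otimes>\<^sub>M path_space)" by measurable
  have Gm: "(\<lambda>(s, \<omega>). (F (s, X p \<omega>), shifted_trace p \<omega>)) \<in> measurable (\<kappa> \<Otimes>\<^sub>M M) (borel \<Otimes>\<^sub>M path_space)"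
    by measurable
  have "emeasure (distr (\<kappa> \<Otimes>\<^sub>M M) (borel \<Otimes>\<^sub>M path_space) (\<lambda>(s, \<omega>). (F (s, X p \<omega>), shifted_trace p \<omega>))) (A \<times> B)
      = emeasure (\<kappa> \<Otimes>\<^sub>M M) Z1"
    unfolding emeasure_distr[OF Gm AB] Z1_def by (rule arg_cong[where f="emeasure (\<kappa> \<Otimes>\<^sub>M M)"]) auto
  also have "\<dots> = (\<integral>\<^sup>+ s. emeasure M (Pair s -` Z1) \<partial>\<kappa>)" by (rule emeasure_pair_measure_alt[OF Z1])
  also have "\<dots> = (\<integral>\<^sup>+ s. emeasure M (Pair s -` Z2) * emeasure path_law B \<partial>\<kappa>)"
  proof (rule nn_integral_cong)
    fix s assume s: "s \<in> space \<kappa>"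
    have "Pair s -` Z1 = {\<omega> \<in> space M. F (s, X p \<omega>) \<in> A \<and> shifted_trace p \<omega> \<in> B}"
      "Pair s -` Z2 = {\<omega> \<in> space M. F (s, X p \<omega>) \<in> A}"
      using s by (auto simp: Z1_def Z2_def space_pair_measure)
    then show "emeasure M (Pair s -` Z1) = emeasure M (Pair s -` Z2) * emeasure path_law B"
      using sect[OF s] by (simp only:)
  qed
  also have "\<dots> = (\<integral>\<^sup>+ s. emeasure M (Pair s -` Z2) \<partial>\<kappa>) * emeasure path_law B"
    by (rule nn_integral_multc[OF measurable_emeasure_Pair[OF Z2]])
  also have "(\<integral>\<^sup>+ s. emeasure M (Pair s -` Z2) \<partial>\<kappa>) = emeasure (\<kappa> \<Otimes>\<^sub>M M) Z2"
    by (rule emeasure_pair_measure_alt[OF Z2, symmetric])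
  also have "\<dots> = emeasure ?\<nu> A"
    unfolding emeasure_distr[OF Fm A] Z2_def by (rule arg_cong[where f="emeasure (\<kappa> \<Otimes>\<^sub>M M)"]) auto
  finally show "emeasure ?\<nu> A * emeasure path_law B =
    emeasure (distr (\<kappa> \<Otimes>\<^sub>M M) (borel \<Otimes>\<^sub>M path_space) (\<lambda>(s, \<omega>). (F (s, X p \<omega>), shifted_trace p \<omega>))) (A \<times> B)" by simp
qed

text \<open>Time is kept as a coordinate so that the set is measurable; the hitting event proper is
  its projection along time.\<close>

definition hits :: "real set \<Rightarrow> 'a set \<Rightarrow> (real \<times> 'a \<times> (real \<Rightarrow> 'a)) set" where
  "hits T N = {(t, z, \<phi>) \<in> space (borel \<Otimes>\<^sub>M (borel \<Otimes>\<^sub>M path_space)).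
     t \<in> T \<and> frozen_until w \<phi> t \<and> z + path_ext \<phi> t \<in> N}"

lemma hits_sets:
  assumes [measurable]: "T \<in> sets borel" "N \<in> sets borel"
  shows "hits T N \<in> sets (borel \<Otimes>\<^sub>M (borel \<Otimes>\<^sub>M path_space))"
proof -
  have "hits T N = {x \<in> space (borel \<Otimes>\<^sub>M (borel \<Otimes>\<^sub>M path_space)). fst x \<in> T \<and>
      frozen_until w (snd (snd x)) (fst x) \<and> fst (snd x) + path_ext (snd (snd x)) (fst x) \<in> N}"
    by (auto simp: hits_def)
  also have "\<dots> \<in> sets (borel \<Otimes>\<^sub>M (borel \<Otimes>\<^sub>M path_space))" by measurable
  finally show ?thesis .
qed

lemma path_trace_space [simp]: "path_trace \<omega> \<in> space path_space" "shifted_trace p \<omega> \<in> space path_space"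
  by (auto simp: path_space_def space_PiM path_trace_def shifted_trace_def)

lemma hits_path_trace:
  assumes "good \<omega>" "T \<subseteq> {0..}"
  shows "(z, path_trace \<omega>) \<in> snd ` hits T N \<longleftrightarrow> (\<exists>t\<in>T. frozen_until w (path_trace \<omega>) t \<and> z + X t \<omega> \<in> N)"
proof -
  have "path_ext (path_trace \<omega>) t = X t \<omega>" if "t \<in> T" for t
    using path_ext_shift_path[of "\<lambda>t. X t \<omega>" 0 t] assms that
    by (auto simp: path_trace_eq good_def)
  then show ?thesis by (force simp: hits_def space_pair_measure image_iff)
qed

lemma hits_shifted_trace:
  assumes "good \<omega>" "T \<subseteq> {0..}" "p \<in> rat_times"
  shows "(z, shifted_trace p \<omega>) \<in> snd ` hits T N \<longleftrightarrow>
    (\<exists>t\<in>T. frozen_until w (shifted_trace p \<omega>) t \<and> z + (X (p + t) \<omega> - X p \<omega>) \<in> N)"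
proof -
  have "path_ext (shifted_trace p \<omega>) t = X (p + t) \<omega> - X p \<omega>" if "t \<in> T" for t
    using path_ext_shift_path[of "\<lambda>t. X t \<omega>" p t] assms that
    by (auto simp: shifted_trace_eq good_def)
  then show ?thesis by (force simp: hits_def space_pair_measure image_iff)
qed

text \<open>Position and path after the restart have the law of a random start with an independent
  fresh path. Since the event is a projection of \<open>hits T N\<close>,
  \<open>AE_projection_distr_cong\<close> transfers nullity between the two probability
  spaces.\<close>

lemma AE_regeneration:
  assumes \<kappa>: "prob_space \<kappa>" and F [measurable]: "F \<in> borel_measurable (\<kappa> \<Otimes>\<^sub>M borel)" and p: "p \<in> rat_times"
    and T: "T \<in> sets borel" "T \<subseteq> {0..}" and N: "N \<in> sets borel"
    and AE: "AE (z, \<omega>) in distr (\<kappa> \<Otimes>\<^sub>M M) borel (\<lambda>(s, \<omega>). F (s, X p \<omega>)) \<Otimes>\<^sub>M M.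
      \<forall>t\<in>T. frozen_until w (path_trace \<omega>) t \<longrightarrow> z + X t \<omega> \<notin> N"
  shows "AE (s, \<omega>) in \<kappa> \<Otimes>\<^sub>M M. \<forall>t\<in>T. frozen_until w (shifted_trace p \<omega>) t \<longrightarrow>
      F (s, X p \<omega>) + (X (p + t) \<omega> - X p \<omega>) \<notin> N"
proof -
  interpret K: prob_space \<kappa> by fact
  interpret P: pair_prob_space \<kappa> M ..
  interpret L: prob_space path_law by (rule prob_space_path_law)
  note [measurable] = measurable_X_rat[OF p]
  note [measurable] = measurable_shifted_trace[OF p]
  let ?\<nu> = "distr (\<kappa> \<Otimes>\<^sub>M M) borel (\<lambda>(s, \<omega>). F (s, X p \<omega>))"
  have "(\<lambda>(s, \<omega>). F (s, X p \<omega>)) \<in> borel_measurable (\<kappa> \<Otimes>\<^sub>M M)" by measurable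
  then interpret N: prob_space ?\<nu> by (rule P.prob_space_distr)
  interpret PN: pair_prob_space ?\<nu> M ..
  have ae: "AE x in ?\<nu> \<Otimes>\<^sub>M M. (case x of (z, \<omega>) \<Rightarrow> (z, path_trace \<omega>)) \<notin> snd ` hits T N"
    using AE AE_pair_snd[OF N.prob_space_axioms prob_space_axioms AE_good]
  proof eventually_elim
    case (elim x)
    then show ?case using hits_path_trace[of "snd x" T "fst x" N] T(2) by (simp add: case_prod_beta)
  qed
  have eq: "distr (?\<nu> \<Otimes>\<^sub>M M) (borel \<Otimes>\<^sub>M path_space) (\<lambda>(z, \<omega>). (z, path_trace \<omega>))
      = distr (\<kappa> \<Otimes>\<^sub>M M) (borel \<Otimes>\<^sub>M path_space) (\<lambda>(s, \<omega>). (F (s, X p \<omega>), shifted_trace p \<omega>))"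
    unfolding regen_law[OF \<kappa> F p]
    by (subst pair_measure_distr[of "\<lambda>z. z" ?\<nu> borel path_trace M path_space, symmetric])
      (auto simp: distr_id2 L.sigma_finite_measure_axioms)
  have m1: "(\<lambda>(z, \<omega>). (z, path_trace \<omega>)) \<in> measurable (?\<nu> \<Otimes>\<^sub>M M) (borel \<Otimes>\<^sub>M path_space)"
    by measurable
  have m2: "(\<lambda>(s, \<omega>). (F (s, X p \<omega>), shifted_trace p \<omega>)) \<in> measurable (\<kappa> \<Otimes>\<^sub>M M) (borel \<Otimes>\<^sub>M path_space)"
    by measurable
  note AE_projection_distr_cong[OF hits_sets[OF T(1) N] PN.prob_space_axioms P.prob_space_axioms m1 m2 eq ae]
  then show ?thesis
    using AE_pair_snd[OF \<kappa> prob_space_axioms AE_good]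
  proof eventually_elim
    case (elim x)
    then show ?case using hits_shifted_trace[of "snd x" T p "F (fst x, X p (snd x))" N] T(2) p
      by (simp add: case_prod_beta)
  qed
qed

text \<open>Hitting is tested only while \<open>w (X)\<close> has not moved, from every fixed start.
  Time 0 is left out, as in \<open>hitting_time\<close>.\<close>

definition avoids :: "'a set \<Rightarrow> bool" where
  "avoids E \<longleftrightarrow> (\<forall>z. AE \<omega> in M. \<forall>t>0. frozen_until w (path_trace \<omega>) t \<longrightarrow> z + X t \<omega> \<notin> E)"

lemma avoids_mono: "avoids E \<Longrightarrow> B \<subseteq> E \<Longrightarrow> avoids B"
  unfolding avoids_def by (rule allI, erule allE, erule AE_mp) auto

text \<open>Passes from fixed starts to a random one; \<open>AE_projection_pair\<close> stands in
  for Fubini.\<close>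

lemma AE_avoids_pair:
  assumes B: "B \<in> sets borel" "avoids B" and \<nu>: "prob_space \<nu>" "sets \<nu> = sets borel"
  shows "AE (z, \<omega>) in \<nu> \<Otimes>\<^sub>M M. \<forall>t>0. frozen_until w (path_trace \<omega>) t \<longrightarrow> z + X t \<omega> \<notin> B"
proof -
  interpret N: prob_space \<nu> by fact
  interpret L: prob_space path_law by (rule prob_space_path_law)
  let ?H = "hits {0<..} B"
  have H: "?H \<in> sets (borel \<Otimes>\<^sub>M (borel \<Otimes>\<^sub>M path_space))" by (rule hits_sets) (use B in auto)
  then have H': "?H \<in> sets (borel \<Otimes>\<^sub>M (\<nu> \<Otimes>\<^sub>M path_law))"
    by (simp add: \<nu>(2) cong: sets_pair_measure_cong)
  have sect: "AE \<phi> in path_law. (z, \<phi>) \<notin> snd ` ?H" for z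
  proof -
    have "AE \<omega> in M. path_trace \<omega> \<notin> snd ` {(t, \<phi>). (t, z, \<phi>) \<in> ?H}"
      using B(2)[unfolded avoids_def, rule_format, of z] AE_good
    proof eventually_elim
      case (elim \<omega>)
      then have "(z, path_trace \<omega>) \<notin> snd ` ?H" by (subst hits_path_trace) auto
      then show ?case by force
    qed
    moreover have "{(t, \<phi>). (t, z, \<phi>) \<in> ?H} \<in> sets (borel \<Otimes>\<^sub>M path_space)"
    proof -
      have "(\<lambda>(t, \<phi>). (t, z, \<phi>)) \<in> measurable (borel \<Otimes>\<^sub>M path_space) (borel \<Otimes>\<^sub>M (borel \<Otimes>\<^sub>M path_space))" by measurable
      from measurable_sets[OF this H] show ?thesis
        by (rule back_subst[of "\<lambda>A. A \<in> _"]) (auto simp: hits_def space_pair_measure)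
    qed
    ultimately have "AE \<phi> in path_law. \<phi> \<notin> snd ` {(t, \<phi>). (t, z, \<phi>) \<in> ?H}"
      by (intro AE_projection_distr_cong[where f=path_trace and ?M1.0=M and g="\<lambda>x. x" and N=path_space])
        (auto simp: distr_id2 prob_space_axioms L.prob_space_axioms)
    then show ?thesis by eventually_elim force
  qed
  have ae: "AE x in \<nu> \<Otimes>\<^sub>M path_law. x \<notin> snd ` ?H"
    by (rule AE_projection_pair[OF H' \<nu>(1) L.prob_space_axioms sect])
  have eq: "\<nu> \<Otimes>\<^sub>M path_law = distr (\<nu> \<Otimes>\<^sub>M M) (\<nu> \<Otimes>\<^sub>M path_space) (\<lambda>(z, \<omega>). (z, path_trace \<omega>))"
    using pair_measure_distr[of "\<lambda>z. z" \<nu> \<nu> path_trace M path_space] L.sigma_finite_measure_axioms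
    by (simp add: distr_id2)
  note ae[unfolded eq]
  then have "AE x in \<nu> \<Otimes>\<^sub>M M. (case x of (z, \<omega>) \<Rightarrow> (z, path_trace \<omega>)) \<notin> snd ` ?H"
    by (rule AE_distrD[rotated]) measurable
  then show ?thesis
    using AE_pair_snd[OF \<nu>(1) prob_space_axioms AE_good]
  proof eventually_elim
    case (elim x)
    have sub: "{0<..} \<subseteq> {0::real..}" by auto
    show ?case using elim hits_path_trace[OF _ sub, of "snd x" "fst x" B]
      by (auto simp add: case_prod_beta)
  qed
qed

end

lemma nearly_borel_UNIV_D:
  assumes "nearly_borel M UNIV X C" "prob_space \<kappa>" "sets \<kappa> = sets borel"
  obtains B B' where "B \<in> sets borel" "B' \<in> sets borel" "B \<subseteq> C" "C \<subseteq> B'"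
    "AE (x, \<omega>) in \<kappa> \<Otimes>\<^sub>M M. \<forall>t\<ge>0. x + X t \<omega> \<notin> B' - B"
proof -
  have "sets \<kappa> = sets (restrict_space borel UNIV)" using assms(3) by simp
  then obtain B B' where B: "B \<in> sets borel" "B' \<in> sets borel" "B \<subseteq> C" "C \<subseteq> B'"
    and AE: "AE (x, \<omega>) in \<kappa> \<Otimes>\<^sub>M M. \<not> (\<exists>t\<ge>0. x + X t \<omega> \<in> B' - B)"
    using assms(1,2) unfolding nearly_borel_def by auto
  from AE have "AE (x, \<omega>) in \<kappa> \<Otimes>\<^sub>M M. \<forall>t\<ge>0. x + X t \<omega> \<notin> B' - B"
    by eventually_elim (auto simp: case_prod_beta)
  with B show ?thesis by (rule that)
qed

text \<open>The law of \<open>f\<close> serves as initial distribution, and only time 0 is read off,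
  where the process almost surely sits at its starting point.\<close>

lemma (in levy_process) nearly_borel_random_point:
  assumes C: "nearly_borel M UNIV X C" and K: "prob_space K" and f: "f \<in> borel_measurable K"
  shows "\<exists>B B'. B \<in> sets borel \<and> B' \<in> sets borel \<and> B \<subseteq> C \<and> C \<subseteq> B' \<and> (AE x in K. f x \<notin> B' - B)"
proof -
  interpret N: prob_space "distr K borel f" by (rule prob_space.prob_space_distr[OF K f])
  obtain B B' where B: "B \<in> sets borel" "B' \<in> sets borel" "B \<subseteq> C" "C \<subseteq> B'"
    "AE (z, \<omega>) in distr K borel f \<Otimes>\<^sub>M M. \<forall>t\<ge>0. z + X t \<omega> \<notin> B' - B"
    using nearly_borel_UNIV_D[OF C N.prob_space_axioms] by auto
  have "AE (z, \<omega>) in distr K borel f \<Otimes>\<^sub>M M. z \<notin> B' - B"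
    using B(5) AE_pair_snd[OF N.prob_space_axioms prob_space_axioms start_zero]
  proof eventually_elim
    case (elim x)
    then show ?case by (cases x) force
  qed
  then have "AE z in distr K borel f. z \<notin> B' - B"
    by (rule AE_pair_fstD[OF N.prob_space_axioms prob_space_axioms])
  then have "AE x in K. f x \<notin> B' - B" by (rule AE_distrD[OF f])
  with B(1-4) show ?thesis by blast
qed

section \<open>Avoidance at all times, and slices of nearly Borel sets\<close>

context levy_step_process
begin

lemma shifted_law:
  assumes p: "p \<in> rat_times"
  shows "distr M path_space (shifted_trace p) = path_law"
proof (rule measure_eqI)
  interpret L: prob_space path_law by (rule prob_space_path_law)
  note [measurable] = measurable_X_rat[OF p]
  note [measurable] = measurable_shifted_trace[OF p]
  interpret D: prob_space "distr M borel (X p)" by (rule prob_space_distr) measurable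
  fix B assume "B \<in> sets (distr M path_space (shifted_trace p))"
  then have B [measurable]: "B \<in> sets path_space" by simp
  have UB: "UNIV \<times> B \<in> sets (borel \<Otimes>\<^sub>M path_space)" by measurable
  have "emeasure (distr M (borel \<Otimes>\<^sub>M path_space) (\<lambda>\<omega>. (X p \<omega>, shifted_trace p \<omega>))) (UNIV \<times> B)
      = emeasure (distr M borel (X p)) UNIV * emeasure path_law B"
    unfolding markov_law[OF p] by (rule L.emeasure_pair_measure_Times) auto
  moreover have "emeasure (distr M borel (X p)) UNIV = 1" using D.emeasure_space_1 by simp
  moreover have "emeasure (distr M (borel \<Otimes>\<^sub>M path_space) (\<lambda>\<omega>. (X p \<omega>, shifted_trace p \<omega>))) (UNIV \<times> B)
      = emeasure (distr M path_space (shifted_trace p)) B"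
  proof -
    have "emeasure (distr M (borel \<Otimes>\<^sub>M path_space) (\<lambda>\<omega>. (X p \<omega>, shifted_trace p \<omega>))) (UNIV \<times> B)
        = emeasure M ((\<lambda>\<omega>. (X p \<omega>, shifted_trace p \<omega>)) -` (UNIV \<times> B) \<inter> space M)"
      by (rule emeasure_distr[OF _ UB]) measurable
    also have "\<dots> = emeasure M (shifted_trace p -` B \<inter> space M)"
      by (rule arg_cong[where f="emeasure M"]) auto
    also have "\<dots> = emeasure (distr M path_space (shifted_trace p)) B"
      by (rule emeasure_distr[symmetric]) measurable
    finally show ?thesis .
  qed
  ultimately show "emeasure (distr M path_space (shifted_trace p)) B = emeasure path_law B" by simp
qed simp

text \<open>The alternatives are the two orders of integration: fixed position with random future,
  or fixed future with random position.\<close>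

lemma AE_markov:
  assumes p: "p \<in> rat_times" and D: "D \<in> sets (borel \<Otimes>\<^sub>M path_space)"
    and null: "(AE u in distr M borel (X p). AE \<phi> in path_law. (u, \<phi>) \<notin> D) \<or>
      (AE \<phi> in path_law. AE u in distr M borel (X p). (u, \<phi>) \<notin> D)"
  shows "AE \<omega> in M. (X p \<omega>, shifted_trace p \<omega>) \<notin> D"
proof -
  interpret L: prob_space path_law by (rule prob_space_path_law)
  note [measurable] = measurable_X_rat[OF p]
  note [measurable] = measurable_shifted_trace[OF p]
  interpret D: prob_space "distr M borel (X p)" by (rule prob_space_distr) measurable
  interpret P: pair_prob_space "distr M borel (X p)" path_law ..
  have D': "D \<in> sets (distr M borel (X p) \<Otimes>\<^sub>M path_law)" using D by (simp cong: sets_pair_measure_cong)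
  then have pred: "{x \<in> space (distr M borel (X p) \<Otimes>\<^sub>M path_law). x \<notin> D} \<in> sets (distr M borel (X p) \<Otimes>\<^sub>M path_law)"
    by measurable
  have "AE u in distr M borel (X p). AE \<phi> in path_law. (u, \<phi>) \<notin> D"
    using null P.AE_commute[of "\<lambda>u \<phi>. (u, \<phi>) \<notin> D"] pred by auto
  then have "AE x in distr M borel (X p) \<Otimes>\<^sub>M path_law. x \<notin> D"
    using pred by (intro P.AE_pair_measure)
  then have "AE x in distr M (borel \<Otimes>\<^sub>M path_space) (\<lambda>\<omega>. (X p \<omega>, shifted_trace p \<omega>)). x \<notin> D"
    by (simp only: markov_law[OF p])
  then show ?thesis by (rule AE_distrD[rotated]) measurable
qed

lemma not_frozen_tendsto_0:
  "(\<lambda>n. prob {\<omega> \<in> space M. \<not> frozen_until w (path_trace \<omega>) (1 / 2 ^ n)}) \<longlonglongrightarrow> 0"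
proof -
  let ?Z = "\<lambda>n::nat. {\<omega> \<in> space M. \<not> frozen_until w (path_trace \<omega>) (1 / 2 ^ n)}"
  have Z: "?Z n \<in> events" for n by measurable
  have mono: "frozen_until w \<phi> s" if "frozen_until w \<phi> t" "s \<le> t" for \<phi> and s t :: real
    using that unfolding frozen_until_def by (meson order_le_less_trans)
  have "decseq ?Z"
    unfolding decseq_def using mono by (auto simp: frac_le)
  then have "(\<lambda>n. prob (?Z n)) \<longlonglongrightarrow> prob (\<Inter>n. ?Z n)"
    using Z by (intro finite_Lim_measure_decseq) auto
  moreover have "AE \<omega> in M. \<omega> \<notin> (\<Inter>n. ?Z n)"
    using AE_good
  proof eventually_elim
    case (elim \<omega>)
    then show ?case
      using frozen_until_start[OF linear_w, of "\<lambda>t. X t \<omega>"] by (auto simp: path_trace_eq) (auto simp: good_def)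
  qed
  then have "prob (\<Inter>n. ?Z n) = 0"
    using Z by (subst prob_eq_0) auto
  ultimately show ?thesis by simp
qed

lemma prob_not_frozen_shift:
  assumes p: "p \<in> rat_times"
  shows "prob {\<omega> \<in> space M. \<not> frozen_until w (shifted_trace p \<omega>) h}
    = prob {\<omega> \<in> space M. \<not> frozen_until w (path_trace \<omega>) h}"
proof -
  define Z where "Z = {\<phi> \<in> space path_space. \<not> frozen_until w \<phi> h}"
  have Z: "Z \<in> sets path_space" unfolding Z_def by measurable
  have "measure (distr M path_space (shifted_trace p)) Z = measure path_law Z"
    using shifted_law[OF p] by simp
  then show ?thesis
    using Z measurable_shifted_trace[OF p] by (simp add: measure_distr Z_def vimage_def Int_def conj_commute)
qed

text \<open>With high probability \<open>w (X)\<close> does not move during a short interval before \<open>t\<close>, and then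
  \<open>z + X t\<close> misses \<open>B\<close>, whatever the position at the start of that interval.\<close>

lemma avoids_fixed_time:
  assumes B: "B \<in> sets borel" "avoids B" and t: "t \<in> rat_times" "0 < t"
  shows "AE \<omega> in M. z + X t \<omega> \<notin> B"
proof -
  have Xt [measurable]: "random_variable borel (X t)"
    using t by (intro measurable_X) auto
  note [measurable] = B(1)
  obtain n0 where n0: "1 / 2 ^ n0 < t" using real_arch_pow_inv[OF t(2), of "1/2"] by (auto simp: power_one_over)
  let ?E = "{\<omega> \<in> space M. z + X t \<omega> \<in> B}"
  have Em: "?E \<in> events" by measurable
  have le: "prob ?E \<le> prob {\<omega> \<in> space M. \<not> frozen_until w (path_trace \<omega>) (1 / 2 ^ n)}" if n: "n \<ge> n0" for n
  proof -
    define h where "h = (1::real) / 2 ^ n"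
    have h: "0 < h" "h \<in> rat_times" unfolding h_def using rat_times_closed(3)[of 1 n] by auto
    have "h \<le> 1 / 2 ^ n0" unfolding h_def using n by (intro frac_le) auto
    then have "h \<le> t" using n0 by simp
    define p where "p = t - h"
    have p: "p \<in> rat_times" unfolding p_def using h t \<open>h \<le> t\<close> by (intro rat_times_diff)
    note [measurable] = measurable_shifted_trace[OF p]
    define D where "D = {x \<in> space (borel \<Otimes>\<^sub>M path_space). frozen_until w (snd x) h \<and> z + fst x + snd x h \<in> B}"
    have D: "D \<in> sets (borel \<Otimes>\<^sub>M path_space)"
      unfolding D_def using h by measurable
    have "AE \<phi> in path_law. (u, \<phi>) \<notin> D" for u
    proof -
      have "AE \<omega> in M. (u, path_trace \<omega>) \<notin> D"
        using B(2)[unfolded avoids_def, rule_format, of "z + u"]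
        by eventually_elim (use h in \<open>auto simp: D_def path_trace_def\<close>)
      moreover have "{\<phi> \<in> space path_space. (u, \<phi>) \<notin> D} \<in> sets path_space"
        using D by measurable
      ultimately show ?thesis by (subst AE_distr_iff) auto
    qed
    then have null: "AE \<omega> in M. (X p \<omega>, shifted_trace p \<omega>) \<notin> D"
      by (intro AE_markov[OF p D]) auto
    have "prob ?E \<le> prob {\<omega> \<in> space M. \<not> frozen_until w (shifted_trace p \<omega>) h}"
    proof (rule finite_measure_mono_AE)
      show "AE \<omega> in M. \<omega> \<in> ?E \<longrightarrow> \<omega> \<in> {\<omega> \<in> space M. \<not> frozen_until w (shifted_trace p \<omega>) h}"
        using null
      proof eventually_elim
        case (elim \<omega>)
        have eq: "z + X p \<omega> + shifted_trace p \<omega> h = z + X t \<omega>"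
          using h by (simp add: shifted_trace_def p_def)
        have "\<not> (frozen_until w (shifted_trace p \<omega>) h \<and> z + X p \<omega> + shifted_trace p \<omega> h \<in> B)"
          using elim by (auto simp: D_def space_pair_measure)
        then show ?case unfolding eq by auto
      qed
    qed measurable
    then show ?thesis unfolding prob_not_frozen_shift[OF p] by (simp add: h_def)
  qed
  have "prob ?E \<le> 0"
    by (rule LIMSEQ_le_const[OF not_frozen_tendsto_0]) (use le in blast)
  then have "prob ?E = 0" using measure_nonneg[of M ?E] by linarith
  then have "AE \<omega> in M. \<omega> \<notin> ?E" using prob_eq_0[OF Em] by simp
  then show ?thesis by (rule AE_mp) (rule AE_I2, auto)
qed

lemma avoids_jump_pos:
  assumes B: "B \<in> sets borel" "avoids B"
  shows "AE \<omega> in M. jumped w (path_trace \<omega>) \<longrightarrow> z + jump_pos w (path_trace \<omega>) \<notin> B"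
proof -
  note [measurable] = B(1)
  let ?E = "{\<omega> \<in> space M. jumped w (path_trace \<omega>) \<and> z + jump_pos w (path_trace \<omega>) \<in> B}"
  have Em: "?E \<in> events" by measurable
  have le: "prob ?E \<le> prob {\<omega> \<in> space M. \<not> frozen_until w (path_trace \<omega>) (1 / 2 ^ n)}" for n
  proof -
    define h where "h = (1::real) / 2 ^ n"
    have h: "0 < h" "h \<in> rat_times" unfolding h_def using rat_times_closed(3)[of 1 n] by auto
    have Xh [measurable]: "random_variable borel (X h)"
      using h by (intro measurable_X) auto
    define D where "D = {x \<in> space (borel \<Otimes>\<^sub>M path_space). z + fst x + jump_pos w (snd x) \<in> B}"
    have D: "D \<in> sets (borel \<Otimes>\<^sub>M path_space)"
      unfolding D_def by measurable
    have "AE u in distr M borel (X h). (u, \<phi>) \<notin> D" if "\<phi> \<in> space path_law" for \<phi>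
    proof -
      have "AE \<omega> in M. (X h \<omega>, \<phi>) \<notin> D"
        using avoids_fixed_time[OF B h(2,1), of "z + jump_pos w \<phi>"]
        by eventually_elim (auto simp: D_def add_ac)
      moreover have "{u \<in> space borel. (u, \<phi>) \<notin> D} \<in> sets borel"
        using D that by simp measurable
      ultimately show ?thesis by (subst AE_distr_iff) auto
    qed
    \<comment> \<open>The path after \<open>h\<close> is held fixed and only \<open>X h\<close>,
      which is independent of it, varies. For a fixed displacement from \<open>X h\<close> to the
      jump position the claim is \<open>avoids_fixed_time\<close> with a shifted
      \<open>z\<close>.\<close>
    then have null: "AE \<omega> in M. (X h \<omega>, shifted_trace h \<omega>) \<notin> D"
      by (intro AE_markov[OF h(2) D disjI2[OF AE_I2]])
    have "prob ?E \<le> prob {\<omega> \<in> space M. \<not> frozen_until w (path_trace \<omega>) h}"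
    proof (rule finite_measure_mono_AE)
      show "AE \<omega> in M. \<omega> \<in> ?E \<longrightarrow> \<omega> \<in> {\<omega> \<in> space M. \<not> frozen_until w (path_trace \<omega>) h}"
        using null AE_good
      proof eventually_elim
        case (elim \<omega>)
        have "jump_pos w (path_trace \<omega>) = X h \<omega> + jump_pos w (shifted_trace h \<omega>)"
          if "frozen_until w (path_trace \<omega>) h" "jumped w (path_trace \<omega>)"
          using jump_pos_shift_cong[OF linear_w, of "\<lambda>t. X t \<omega>" h] that elim(2) h(2)
          by (simp add: path_trace_eq shifted_trace_eq) (simp add: good_def)
        then show ?case using elim by (auto simp: D_def space_pair_measure add_ac)
      qed
    qed measurable
    then show ?thesis by (simp add: h_def)
  qed
  have "prob ?E \<le> 0"
    by (rule LIMSEQ_le_const[OF not_frozen_tendsto_0]) (use le in blast)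
  then have "prob ?E = 0" using measure_nonneg[of M ?E] by linarith
  then have "AE \<omega> in M. \<omega> \<notin> ?E" using prob_eq_0[OF Em] by simp
  then show ?thesis by (rule AE_mp) (rule AE_I2, auto)
qed

lemma avoids_jump_pos_shift:
  assumes B: "B \<in> sets borel" "avoids B" and p: "p \<in> rat_times"
  shows "AE \<omega> in M. jumped w (shifted_trace p \<omega>) \<longrightarrow> x + X p \<omega> + jump_pos w (shifted_trace p \<omega>) \<notin> B"
proof -
  note [measurable] = B(1)
  define D where "D = {x' \<in> space (borel \<Otimes>\<^sub>M path_space). jumped w (snd x') \<and> x + fst x' + jump_pos w (snd x') \<in> B}"
  have D: "D \<in> sets (borel \<Otimes>\<^sub>M path_space)"
    unfolding D_def by measurable
  have "AE \<phi> in path_law. (u, \<phi>) \<notin> D" for u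
  proof -
    have "AE \<omega> in M. (u, path_trace \<omega>) \<notin> D"
      using avoids_jump_pos[OF B, of "x + u"]
      by eventually_elim (auto simp: D_def)
    moreover have "{\<phi> \<in> space path_space. (u, \<phi>) \<notin> D} \<in> sets path_space"
      using D by measurable
    ultimately show ?thesis by (subst AE_distr_iff) auto
  qed
  then have "AE \<omega> in M. (X p \<omega>, shifted_trace p \<omega>) \<notin> D"
    by (intro AE_markov[OF p D]) auto
  then show ?thesis by eventually_elim (auto simp: D_def space_pair_measure)
qed

lemma nearly_borel_avoids_AE:
  assumes E: "nearly_borel M UNIV X E" "avoids E"
  shows "AE \<omega> in M. \<forall>t>0. x + X t \<omega> \<notin> E"
proof -
  have mid: "AE \<omega> in M. \<forall>t>0. frozen_until w (shifted_trace p \<omega>) t \<longrightarrow> x + X (p + t) \<omega> \<notin> E"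
    if p: "p \<in> rat_times" for p
  proof -
    note [measurable] = measurable_X_rat[OF p]
    \<comment> \<open>A one-point law turns the regeneration lemma into a statement about the fixed
      start \<open>x\<close>.\<close>
    define \<kappa> where "\<kappa> = return (count_space UNIV) ()"
    interpret K: prob_space \<kappa> unfolding \<kappa>_def by (rule prob_space_return) simp
    interpret P: pair_prob_space \<kappa> M ..
    let ?F = "\<lambda>(s, u). x + u"
    let ?\<nu> = "distr (\<kappa> \<Otimes>\<^sub>M M) borel (\<lambda>(s, \<omega>). ?F (s, X p \<omega>))"
    have F: "?F \<in> borel_measurable (\<kappa> \<Otimes>\<^sub>M borel)" by measurable
    have "(\<lambda>(s, \<omega>). ?F (s, X p \<omega>)) \<in> borel_measurable (\<kappa> \<Otimes>\<^sub>M M)" by measurable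
    then interpret N: prob_space ?\<nu> by (rule P.prob_space_distr)
    \<comment> \<open>The sandwich is taken for the law of the restart position. \<open>B\<close>
      lies in \<open>E\<close> and is avoided while \<open>w (X)\<close> stays put, and
      \<open>B' - B\<close> is avoided because \<open>E\<close> is nearly Borel; so all of
      \<open>B'\<close> is avoided there, and \<open>E\<close> with it.\<close>
    obtain B B' where B: "B \<in> sets borel" "B' \<in> sets borel" "B \<subseteq> E" "E \<subseteq> B'"
      "AE (z, \<omega>) in ?\<nu> \<Otimes>\<^sub>M M. \<forall>t\<ge>0. z + X t \<omega> \<notin> B' - B"
      using nearly_borel_UNIV_D[OF E(1) N.prob_space_axioms] by auto
    have "AE (z, \<omega>) in ?\<nu> \<Otimes>\<^sub>M M. \<forall>t\<in>{0<..}. frozen_until w (path_trace \<omega>) t \<longrightarrow> z + X t \<omega> \<notin> B'"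
      using B(5) AE_avoids_pair[OF B(1) avoids_mono[OF E(2) B(3)] N.prob_space_axioms sets_distr]
      by eventually_elim (auto simp: case_prod_beta)
    then have "AE (s, \<omega>) in \<kappa> \<Otimes>\<^sub>M M. \<forall>t\<in>{0<..}. frozen_until w (shifted_trace p \<omega>) t \<longrightarrow>
        ?F (s, X p \<omega>) + (X (p + t) \<omega> - X p \<omega>) \<notin> B'"
      by (intro AE_regeneration[OF K.prob_space_axioms F p _ _ B(2)]) auto
    from P.AE_pair[OF this]
    have "AE s in \<kappa>. AE \<omega> in M. \<forall>t\<in>{0<..}. frozen_until w (shifted_trace p \<omega>) t \<longrightarrow> x + X (p + t) \<omega> \<notin> B'"
      by (simp add: add_ac)
    then have "AE \<omega> in M. \<forall>t\<in>{0<..}. frozen_until w (shifted_trace p \<omega>) t \<longrightarrow> x + X (p + t) \<omega> \<notin> B'"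
      by (simp add: K.AE_const)
    then show ?thesis by eventually_elim (use B(4) in auto)
  qed
  have jump: "AE \<omega> in M. jumped w (shifted_trace p \<omega>) \<longrightarrow> x + X p \<omega> + jump_pos w (shifted_trace p \<omega>) \<notin> E"
    if p: "p \<in> rat_times" for p
  proof -
    note [measurable] = measurable_X_rat[OF p]
    note [measurable] = measurable_shifted_trace[OF p]
    let ?f = "\<lambda>\<omega>. x + X p \<omega> + jump_pos w (shifted_trace p \<omega>)"
    have f: "?f \<in> borel_measurable M" by measurable
    obtain B B' where B: "B \<in> sets borel" "B' \<in> sets borel" "B \<subseteq> E" "E \<subseteq> B'" "AE \<omega> in M. ?f \<omega> \<notin> B' - B"
      using nearly_borel_random_point[OF E(1) prob_space_axioms f] by blast
    note B(5)
    moreover note avoids_jump_pos_shift[OF B(1) avoids_mono[OF E(2) B(3)] p, of x]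
    ultimately show ?thesis by eventually_elim (use B(4) in auto)
  qed
  have "AE \<omega> in M. \<forall>p\<in>rat_times. \<forall>t>0. frozen_until w (shifted_trace p \<omega>) t \<longrightarrow> x + X (p + t) \<omega> \<notin> E"
    using mid by (subst AE_ball_countable[OF countable_rat_times]) blast
  moreover have "AE \<omega> in M. \<forall>p\<in>rat_times. jumped w (shifted_trace p \<omega>) \<longrightarrow>
      x + X p \<omega> + jump_pos w (shifted_trace p \<omega>) \<notin> E"
    using jump by (subst AE_ball_countable[OF countable_rat_times]) blast
  ultimately show ?thesis
    using AE_good
  proof eventually_elim
    case (elim \<omega>)
    show ?case
    proof (intro allI impI)
      fix t :: real assume t: "0 < t"
      then consider p where "p \<in> rat_times" "p < t" "frozen_until w (shifted_trace p \<omega>) (t - p)"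
        | p where "p \<in> rat_times" "jumped w (shifted_trace p \<omega>)" "X t \<omega> = X p \<omega> + jump_pos w (shifted_trace p \<omega>)"
        using time_cases[OF linear_w, of "\<lambda>t. X t \<omega>" t] elim(3) by (auto simp: good_def shifted_trace_eq)
      then show "x + X t \<omega> \<notin> E"
      proof cases
        case (1 p)
        then show ?thesis using elim(1)[rule_format, of p "t - p"] by simp
      next
        case (2 p)
        then show ?thesis using elim(2) by (simp add: add.assoc)
      qed
    qed
  qed
qed

text \<open>A sandwich for the slice is made from sandwiches of \<open>C\<close> for countably many
  laws. After a rational \<open>p\<close> and while \<open>w (X)\<close> is frozen, the point
  \<open>y + s + pi (X t)\<close> moves like \<open>X\<close> restarted at
  \<open>y + s + pi (X p)\<close>, with \<open>pi\<close> the projection on \<open>S\<close>; at a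
  jump time it is a single random point. By \<open>time_cases\<close> these situations exhaust all
  times.\<close>

lemma nearly_borel_section:
  assumes C: "nearly_borel M UNIV X C"
  shows "nearly_borel M S (projection_process S X) {s \<in> S. y + s \<in> C}"
  unfolding nearly_borel_def
proof (intro allI impI, elim conjE)
  fix \<kappa> :: "'a measure" assume \<kappa>: "prob_space \<kappa>" and sets_\<kappa>: "sets \<kappa> = sets (restrict_space borel S)"
  interpret K: prob_space \<kappa> by fact
  interpret P: pair_prob_space \<kappa> M ..
  let ?pi = "orthogonal_projection S"
  note [measurable] = measurable_orthogonal_projection[OF subspace_S]
  have id [measurable]: "(\<lambda>s. s) \<in> borel_measurable \<kappa>"
    by (simp add: measurable_cong_sets[OF sets_\<kappa> refl] measurable_restrict_space1)
  have space_\<kappa>: "space \<kappa> = S"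
    using sets_eq_imp_space_eq[OF sets_\<kappa>] by (simp add: space_restrict_space)
  have S_borel: "S \<in> sets borel" using closed_subspace[OF subspace_S] by auto
  define Q1 where "Q1 p B B' \<longleftrightarrow> B \<in> sets borel \<and> B' \<in> sets borel \<and> B \<subseteq> C \<and> C \<subseteq> B' \<and>
     (AE (s, \<omega>) in \<kappa> \<Otimes>\<^sub>M M. \<forall>t\<ge>0. frozen_until w (shifted_trace p \<omega>) t \<longrightarrow> y + s + ?pi (X (p + t) \<omega>) \<notin> B' - B)" for p B B'
  have ex1: "\<exists>B B'. Q1 p B B'"
    if p: "p \<in> rat_times" for p
  proof -
    note [measurable] = measurable_X_rat[OF p]
    let ?F = "\<lambda>(s, u). y + s + ?pi u"
    let ?\<nu> = "distr (\<kappa> \<Otimes>\<^sub>M M) borel (\<lambda>(s, \<omega>). ?F (s, X p \<omega>))"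
    have F: "?F \<in> borel_measurable (\<kappa> \<Otimes>\<^sub>M borel)" by measurable
    have "(\<lambda>(s, \<omega>). ?F (s, X p \<omega>)) \<in> borel_measurable (\<kappa> \<Otimes>\<^sub>M M)" by measurable
    then interpret N: prob_space ?\<nu> by (rule P.prob_space_distr)
    obtain B B' where B: "B \<in> sets borel" "B' \<in> sets borel" "B \<subseteq> C" "C \<subseteq> B'"
      "AE (z, \<omega>) in ?\<nu> \<Otimes>\<^sub>M M. \<forall>t\<ge>0. z + X t \<omega> \<notin> B' - B"
      using nearly_borel_UNIV_D[OF C N.prob_space_axioms] by auto
    have "AE (z, \<omega>) in ?\<nu> \<Otimes>\<^sub>M M. \<forall>t\<in>{0..}. frozen_until w (path_trace \<omega>) t \<longrightarrow> z + X t \<omega> \<notin> B' - B"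
      using B(5) by eventually_elim (auto simp: case_prod_beta)
    then have "AE (s, \<omega>) in \<kappa> \<Otimes>\<^sub>M M. \<forall>t\<in>{0..}. frozen_until w (shifted_trace p \<omega>) t \<longrightarrow>
        ?F (s, X p \<omega>) + (X (p + t) \<omega> - X p \<omega>) \<notin> B' - B"
      using B(1,2) by (intro AE_regeneration[OF \<kappa> F p]) auto
    then have "AE (s, \<omega>) in \<kappa> \<Otimes>\<^sub>M M. \<forall>t\<ge>0. frozen_until w (shifted_trace p \<omega>) t \<longrightarrow> y + s + ?pi (X (p + t) \<omega>) \<notin> B' - B"
      using AE_pair_snd[OF \<kappa> prob_space_axioms AE_good]
    proof eventually_elim
      case (elim x)
      obtain s \<omega> where x: "x = (s, \<omega>)" by (cases x)
      \<comment> \<open>While \<open>w (X)\<close> does not move, an increment of \<open>X\<close>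
        is an increment of its projection.\<close>
      have eq: "y + s + ?pi (X p \<omega>) + (X (p + t) \<omega> - X p \<omega>) = y + s + ?pi (X (p + t) \<omega>)"
        if "0 \<le> t" "frozen_until w (shifted_trace p \<omega>) t" for t
        using frozen_until_shiftD[OF linear_w, of "\<lambda>t. X t \<omega>" p t] that p elim(2)
        by (simp add: x shifted_trace_eq good_def w_def algebra_simps)
      show ?case unfolding x prod.case
      proof (intro allI impI)
        fix t :: real assume t: "0 \<le> t" "frozen_until w (shifted_trace p \<omega>) t"
        then have "y + s + ?pi (X p \<omega>) + (X (p + t) \<omega> - X p \<omega>) \<notin> B' - B"
          using elim(1) unfolding x prod.case by blast
        then show "y + s + ?pi (X (p + t) \<omega>) \<notin> B' - B" unfolding eq[OF t] .
      qed
    qed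
    then show ?thesis using B(1-4) unfolding Q1_def by blast
  qed
  then have "\<forall>p\<in>rat_times. \<exists>B B'. Q1 p B B'" by blast
  then obtain B1 B1' where Q1: "\<And>p. p \<in> rat_times \<Longrightarrow> Q1 p (B1 p) (B1' p)" by metis
  have B1: "\<And>p. p \<in> rat_times \<Longrightarrow> B1 p \<in> sets borel" "\<And>p. p \<in> rat_times \<Longrightarrow> B1' p \<in> sets borel"
      "\<And>p. p \<in> rat_times \<Longrightarrow> B1 p \<subseteq> C" "\<And>p. p \<in> rat_times \<Longrightarrow> C \<subseteq> B1' p"
      "\<And>p. p \<in> rat_times \<Longrightarrow> AE (s, \<omega>) in \<kappa> \<Otimes>\<^sub>M M. \<forall>t\<ge>0. frozen_until w (shifted_trace p \<omega>) t \<longrightarrow> y + s + ?pi (X (p + t) \<omega>) \<notin> B1' p - B1 p"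
    using Q1 unfolding Q1_def by blast+
  define Q2 where "Q2 p B B' \<longleftrightarrow> B \<in> sets borel \<and> B' \<in> sets borel \<and> B \<subseteq> C \<and> C \<subseteq> B' \<and>
     (AE (s, \<omega>) in \<kappa> \<Otimes>\<^sub>M M. y + s + ?pi (X p \<omega> + jump_pos w (shifted_trace p \<omega>)) \<notin> B' - B)" for p B B'
  have ex2: "\<exists>B B'. Q2 p B B'"
    if p: "p \<in> rat_times" for p
  proof -
    note [measurable] = measurable_X_rat[OF p]
    note [measurable] = measurable_shifted_trace[OF p]
    let ?f = "\<lambda>(s, \<omega>). y + s + ?pi (X p \<omega> + jump_pos w (shifted_trace p \<omega>))"
    have f: "?f \<in> borel_measurable (\<kappa> \<Otimes>\<^sub>M M)" by measurable
    obtain B B' where B: "B \<in> sets borel" "B' \<in> sets borel" "B \<subseteq> C" "C \<subseteq> B'"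
      "AE x in \<kappa> \<Otimes>\<^sub>M M. ?f x \<notin> B' - B"
      using nearly_borel_random_point[OF C P.prob_space_axioms f] by blast
    from B(5) have "AE (s, \<omega>) in \<kappa> \<Otimes>\<^sub>M M. y + s + ?pi (X p \<omega> + jump_pos w (shifted_trace p \<omega>)) \<notin> B' - B"
      by (simp add: case_prod_beta)
    then show ?thesis using B(1-4) unfolding Q2_def by blast
  qed
  then have "\<forall>p\<in>rat_times. \<exists>B B'. Q2 p B B'" by blast
  then obtain B2 B2' where Q2: "\<And>p. p \<in> rat_times \<Longrightarrow> Q2 p (B2 p) (B2' p)" by metis
  have B2: "\<And>p. p \<in> rat_times \<Longrightarrow> B2 p \<in> sets borel" "\<And>p. p \<in> rat_times \<Longrightarrow> B2' p \<in> sets borel"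
      "\<And>p. p \<in> rat_times \<Longrightarrow> B2 p \<subseteq> C" "\<And>p. p \<in> rat_times \<Longrightarrow> C \<subseteq> B2' p"
      "\<And>p. p \<in> rat_times \<Longrightarrow> AE (s, \<omega>) in \<kappa> \<Otimes>\<^sub>M M. y + s + ?pi (X p \<omega> + jump_pos w (shifted_trace p \<omega>)) \<notin> B2' p - B2 p"
    using Q2 unfolding Q2_def by blast+
  \<comment> \<open>The union of the inner sets and the intersection of the outer sets sandwich
    \<open>C\<close> again, and their gap lies in each single gap.\<close>
  define B where "B = (\<Union>p\<in>rat_times. B1 p \<union> B2 p)"
  define B' where "B' = (\<Inter>p\<in>rat_times. B1' p \<inter> B2' p)"
  have B: "B \<in> sets borel" unfolding B_def
    using B1(1) B2(1) by (intro sets.countable_UN' countable_rat_times) auto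
  have B': "B' \<in> sets borel" unfolding B'_def
    using B1(2) B2(2) countable_rat_times by (intro sets.countable_INT'') auto
  have sub: "B \<subseteq> C" "C \<subseteq> B'" unfolding B_def B'_def
    by (intro UN_least Un_least B1(3) B2(3), assumption+) (intro INT_greatest Int_greatest B1(4) B2(4), assumption+)
  have sect: "{s \<in> S. y + s \<in> A} \<in> sets (restrict_space borel S)" if "A \<in> sets borel" for A
  proof -
    have "(\<lambda>s. y + s) \<in> borel_measurable borel" by measurable
    from measurable_sets[OF this that] have "{s. y + s \<in> A} \<in> sets borel" by (simp add: vimage_def)
    then have "S \<inter> {s. y + s \<in> A} \<in> sets (restrict_space borel S)" by (auto simp: sets_restrict_space)
    then show ?thesis by (simp add: Int_def)
  qed
  have "AE x in \<kappa> \<Otimes>\<^sub>M M. \<forall>p\<in>rat_times. case x of (s, \<omega>) \<Rightarrow>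
      \<forall>t\<ge>0. frozen_until w (shifted_trace p \<omega>) t \<longrightarrow> y + s + ?pi (X (p + t) \<omega>) \<notin> B1' p - B1 p"
    using B1(5) by (subst AE_ball_countable[OF countable_rat_times]) blast
  moreover have "AE x in \<kappa> \<Otimes>\<^sub>M M. \<forall>p\<in>rat_times. case x of (s, \<omega>) \<Rightarrow>
      y + s + ?pi (X p \<omega> + jump_pos w (shifted_trace p \<omega>)) \<notin> B2' p - B2 p"
    using B2(5) by (subst AE_ball_countable[OF countable_rat_times]) blast
  ultimately have "AE (s, \<omega>) in \<kappa> \<Otimes>\<^sub>M M. \<forall>t\<ge>0. y + s + ?pi (X t \<omega>) \<notin> B' - B"
    using AE_pair_snd[OF \<kappa> prob_space_axioms AE_good]
  proof eventually_elim
    case (elim x)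
    obtain s \<omega> where x: "x = (s, \<omega>)" by (cases x)
    have "y + s + ?pi (X t \<omega>) \<notin> B' - B" if t: "0 \<le> t" for t
    proof -
      consider p where "p \<in> rat_times" "p \<le> t" "frozen_until w (shifted_trace p \<omega>) (t - p)"
        | p where "p \<in> rat_times" "X t \<omega> = X p \<omega> + jump_pos w (shifted_trace p \<omega>)"
        using time_cases[OF linear_w, of "\<lambda>t. X t \<omega>" t] elim(3) t by (auto simp: x good_def shifted_trace_eq)
      then show ?thesis
      proof cases
        case (1 p)
        have "0 \<le> t - p" using 1(2) by simp
        then have "y + s + ?pi (X (p + (t - p)) \<omega>) \<notin> B1' p - B1 p"
          using elim(1) 1(1,3) unfolding x prod.case by blast
        then show ?thesis using 1(1) by (auto simp: B_def B'_def)
      next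
        case (2 p)
        then have "y + s + ?pi (X t \<omega>) \<notin> B2' p - B2 p" using elim(2) by (simp add: x)
        then show ?thesis using 2(1) by (auto simp: B_def B'_def)
      qed
    qed
    then show ?case by (simp add: x)
  qed
  then have "AE (s, \<omega>) in \<kappa> \<Otimes>\<^sub>M M. \<not> (\<exists>t\<ge>0. s + projection_process S X t \<omega> \<in> {s \<in> S. y + s \<in> B'} - {s \<in> S. y + s \<in> B})"
    by eventually_elim (auto simp: projection_process_def add_ac)
  then show "\<exists>B\<in>sets (restrict_space borel S). \<exists>B'\<in>sets (restrict_space borel S).
      B \<subseteq> {s \<in> S. y + s \<in> C} \<and> {s \<in> S. y + s \<in> C} \<subseteq> B' \<and>
      (AE (x, \<omega>) in \<kappa> \<Otimes>\<^sub>M M. \<not> (\<exists>t\<ge>0. x + projection_process S X t \<omega> \<in> B' - B))"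
    using sect[OF B] sect[OF B'] sub by (intro bexI[of _ "{s \<in> S. y + s \<in> B}"] bexI[of _ "{s \<in> S. y + s \<in> B'}"]) auto
qed

end

section \<open>Hypothesis (H)\<close>

lemma hitting_time_neq_0_iff: "hitting_time D p \<noteq> 0 \<longleftrightarrow> (\<exists>\<epsilon>>0. \<forall>t. 0 < t \<and> t < \<epsilon> \<longrightarrow> p t \<notin> D)"
proof
  assume *: "hitting_time D p \<noteq> 0"
  have "0 \<le> hitting_time D p" unfolding hitting_time_def by (intro INF_greatest) auto
  with * have "0 < hitting_time D p" by simp
  then obtain e where e: "0 < ereal e" "ereal e < hitting_time D p" using ereal_dense2 by blast
  have "p t \<notin> D" if "0 < t" "t < e" for t
  proof
    assume "p t \<in> D"
    then have "hitting_time D p \<le> ereal t" unfolding hitting_time_def using that by (intro INF_lower) auto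
    then have "ereal e < ereal t" using e(2) by (rule less_le_trans[rotated])
    then show False using that by simp
  qed
  then show "\<exists>\<epsilon>>0. \<forall>t. 0 < t \<and> t < \<epsilon> \<longrightarrow> p t \<notin> D" using e by (intro exI[of _ e]) auto
next
  assume "\<exists>\<epsilon>>0. \<forall>t. 0 < t \<and> t < \<epsilon> \<longrightarrow> p t \<notin> D"
  then obtain e where e: "0 < e" "\<And>t. 0 < t \<Longrightarrow> t < e \<Longrightarrow> p t \<notin> D" by blast
  have "ereal e \<le> hitting_time D p"
    unfolding hitting_time_def using e(2) by (intro INF_greatest) (force simp: not_less[symmetric])
  moreover have "0 < ereal e" using e(1) by simp
  ultimately show "hitting_time D p \<noteq> 0" by auto
qed

lemma hitting_time_infinite_iff: "\<not> hitting_time D p < \<infinity> \<longleftrightarrow> (\<forall>t>0. p t \<notin> D)"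
proof -
  have "hitting_time D p < \<infinity> \<longleftrightarrow> (\<exists>t\<in>{t. 0 < t \<and> p t \<in> D}. ereal t < \<infinity>)"
    unfolding hitting_time_def by (rule INF_less_iff)
  then show ?thesis by auto
qed

lemma nearly_borel_Union:
  assumes \<C>: "countable \<C>" "\<And>C. C \<in> \<C> \<Longrightarrow> nearly_borel M V X C"
  shows "nearly_borel M V X (\<Union>\<C>)"
  unfolding nearly_borel_def
proof (intro allI impI)
  fix \<kappa> assume \<kappa>: "prob_space \<kappa> \<and> sets \<kappa> = sets (restrict_space borel V)"
  let ?R = "sets (restrict_space borel V)"
  define Q where "Q C B B' \<longleftrightarrow> B \<in> ?R \<and> B' \<in> ?R \<and> B \<subseteq> C \<and> C \<subseteq> B' \<and>
    (AE (x, \<omega>) in \<kappa> \<Otimes>\<^sub>M M. \<not> (\<exists>t\<ge>0. x + X t \<omega> \<in> B' - B))" for C B B'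
  have "\<exists>B B'. Q C B B'" if "C \<in> \<C>" for C
    using \<C>(2)[OF that, unfolded nearly_borel_def, rule_format, OF \<kappa>] by (auto simp: Q_def)
  then obtain B B' where Q: "\<And>C. C \<in> \<C> \<Longrightarrow> Q C (B C) (B' C)" by metis
  have "AE x in \<kappa> \<Otimes>\<^sub>M M. \<forall>C\<in>\<C>. case x of (x, \<omega>) \<Rightarrow> \<not> (\<exists>t\<ge>0. x + X t \<omega> \<in> B' C - B C)"
    using Q by (subst AE_ball_countable[OF \<C>(1)]) (auto simp: Q_def)
  then have "AE (x, \<omega>) in \<kappa> \<Otimes>\<^sub>M M. \<not> (\<exists>t\<ge>0. x + X t \<omega> \<in> (\<Union>C\<in>\<C>. B' C) - (\<Union>C\<in>\<C>. B C))"
    by eventually_elim (auto simp: case_prod_beta)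
  moreover have "(\<Union>C\<in>\<C>. B C) \<in> ?R" "(\<Union>C\<in>\<C>. B' C) \<in> ?R"
    using Q \<C>(1) by (auto simp: Q_def intro!: sets.countable_UN')
  moreover have "(\<Union>C\<in>\<C>. B C) \<subseteq> \<Union>\<C>" "\<Union>\<C> \<subseteq> (\<Union>C\<in>\<C>. B' C)"
    using Q unfolding Q_def by blast+
  ultimately show "\<exists>B\<in>?R. \<exists>B'\<in>?R. B \<subseteq> \<Union>\<C> \<and> \<Union>\<C> \<subseteq> B' \<and> (AE (x, \<omega>) in \<kappa> \<Otimes>\<^sub>M M. \<not> (\<exists>t\<ge>0. x + X t \<omega> \<in> B' - B))"
    by (intro bexI[of _ "\<Union>C\<in>\<C>. B C"] bexI[of _ "\<Union>C\<in>\<C>. B' C"] conjI)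
qed

lemma semipolar_set_cover:
  assumes "semipolar_set M V X D"
  obtains \<C> where "countable \<C>" "D \<subseteq> \<Union>\<C>" "\<And>C. C \<in> \<C> \<Longrightarrow> nearly_borel M V X C"
    "\<And>C x. C \<in> \<C> \<Longrightarrow> x \<in> V \<Longrightarrow> AE \<omega> in M. hitting_time C (\<lambda>t. x + X t \<omega>) \<noteq> 0"
proof -
  define thin where "thin C \<longleftrightarrow> nearly_borel M V X C \<and> (\<forall>x\<in>V. AE \<omega> in M. hitting_time C (\<lambda>t. x + X t \<omega>) \<noteq> 0)" for C
  obtain \<T> where T: "countable \<T>" "D \<subseteq> \<Union>\<T>" "\<And>T. T \<in> \<T> \<Longrightarrow> thin_set M V X T"
    using assms unfolding semipolar_set_def by auto
  have "\<exists>C. thin C \<and> T \<subseteq> C" if "T \<in> \<T>" for T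
    using T(3)[OF that] by (auto simp: thin_set_def thin_def)
  then obtain c where c: "\<And>T. T \<in> \<T> \<Longrightarrow> thin (c T)" "\<And>T. T \<in> \<T> \<Longrightarrow> T \<subseteq> c T" by metis
  show ?thesis
  proof (rule that[of "c ` \<T>"])
    show "D \<subseteq> \<Union>(c ` \<T>)" using T(2) c(2) by blast
  qed (use T(1) c(1) in \<open>auto simp: thin_def\<close>)
qed

lemma thin_setI:
  "nearly_borel M V X C \<Longrightarrow> (\<And>x. x \<in> V \<Longrightarrow> AE \<omega> in M. hitting_time C (\<lambda>t. x + X t \<omega>) \<noteq> 0) \<Longrightarrow> thin_set M V X C"
  by (auto simp: thin_set_def)

section \<open>From the process to its projections\<close>

lemma nearly_borel_vimage_projection:
  fixes A :: "'a::euclidean_space set"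
  assumes M: "prob_space M" and A: "subspace A" and C: "nearly_borel M A (projection_process A X) C"
  shows "nearly_borel M UNIV X (orthogonal_projection A -` C)"
  unfolding nearly_borel_def
proof (intro allI impI, elim conjE)
  let ?p = "orthogonal_projection A"
  fix \<kappa> :: "'a measure" assume \<kappa>: "prob_space \<kappa>" and "sets \<kappa> = sets (restrict_space borel UNIV)"
  then have sets_\<kappa>: "sets \<kappa> = sets borel" by simp
  interpret M: prob_space M by fact
  interpret K: prob_space \<kappa> by fact
  let ?R = "restrict_space borel A"
  have p0: "?p \<in> measurable borel ?R"
    using measurable_orthogonal_projection[OF A] orthogonal_projection_in[OF A]
    by (intro measurable_restrict_space2) auto
  then have p: "?p \<in> measurable \<kappa> ?R" by (simp add: measurable_cong_sets[OF sets_\<kappa> refl])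
  interpret K': prob_space "distr \<kappa> ?R ?p" by (rule K.prob_space_distr[OF p])
  obtain B B' where B: "B \<in> sets ?R" "B' \<in> sets ?R" "B \<subseteq> C" "C \<subseteq> B'"
    and AE: "AE (x, \<omega>) in distr \<kappa> ?R ?p \<Otimes>\<^sub>M M. \<not> (\<exists>t\<ge>0. x + projection_process A X t \<omega> \<in> B' - B)"
    using C[unfolded nearly_borel_def, rule_format, of "distr \<kappa> ?R ?p"] K'.prob_space_axioms by auto
  have "distr \<kappa> ?R ?p \<Otimes>\<^sub>M M = distr (\<kappa> \<Otimes>\<^sub>M M) (?R \<Otimes>\<^sub>M M) (\<lambda>(x, \<omega>). (?p x, \<omega>))"
    using pair_measure_distr[OF p, of "\<lambda>\<omega>. \<omega>" M M] M.sigma_finite_measure_axioms by (simp add: distr_id2)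
  with AE have "AE (x, \<omega>) in distr (\<kappa> \<Otimes>\<^sub>M M) (?R \<Otimes>\<^sub>M M) (\<lambda>(x, \<omega>). (?p x, \<omega>)). \<not> (\<exists>t\<ge>0. x + projection_process A X t \<omega> \<in> B' - B)"
    by (simp only:)
  moreover have "(\<lambda>(x, \<omega>). (?p x, \<omega>)) \<in> measurable (\<kappa> \<Otimes>\<^sub>M M) (?R \<Otimes>\<^sub>M M)"
    using p by measurable
  ultimately have "AE z in \<kappa> \<Otimes>\<^sub>M M. case (case z of (x, \<omega>) \<Rightarrow> (?p x, \<omega>)) of (x, \<omega>) \<Rightarrow>
      \<not> (\<exists>t\<ge>0. x + projection_process A X t \<omega> \<in> B' - B)"
    by (rule AE_distrD[rotated])
  then have "AE (x, \<omega>) in \<kappa> \<Otimes>\<^sub>M M. \<not> (\<exists>t\<ge>0. x + X t \<omega> \<in> ?p -` B' - ?p -` B)"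
    by eventually_elim (auto simp: case_prod_beta projection_process_def linear_add[OF linear_orthogonal_projection[OF A]])
  moreover have "?p -` B \<in> sets (restrict_space borel UNIV)" "?p -` B' \<in> sets (restrict_space borel UNIV)"
    using measurable_sets[OF p0 B(1)] measurable_sets[OF p0 B(2)] by simp_all
  moreover have "?p -` B \<subseteq> ?p -` C" "?p -` C \<subseteq> ?p -` B'" using B(3,4) by auto
  ultimately show "\<exists>B\<in>sets (restrict_space borel UNIV). \<exists>B'\<in>sets (restrict_space borel UNIV). B \<subseteq> ?p -` C \<and>
      ?p -` C \<subseteq> B' \<and> (AE (x, \<omega>) in \<kappa> \<Otimes>\<^sub>M M. \<not> (\<exists>t\<ge>0. x + X t \<omega> \<in> B' - B))"
    by (intro bexI[of _ "?p -` B"] bexI[of _ "?p -` B'"] conjI)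
qed

lemma hypothesis_H_projection:
  assumes M: "prob_space M" and H: "hypothesis_H M UNIV X" and A: "subspace A"
  shows "hypothesis_H M A (projection_process A X)"
  unfolding hypothesis_H_def
proof (intro allI impI)
  let ?p = "orthogonal_projection A"
  fix D assume "semipolar_set M A (projection_process A X) D"
  then obtain \<C> where C: "countable \<C>" "D \<subseteq> \<Union>\<C>" "\<And>C. C \<in> \<C> \<Longrightarrow> nearly_borel M A (projection_process A X) C"
    "\<And>C x. C \<in> \<C> \<Longrightarrow> x \<in> A \<Longrightarrow> AE \<omega> in M. hitting_time C (\<lambda>t. x + projection_process A X t \<omega>) \<noteq> 0"
    by (rule semipolar_set_cover) blast
  have add: "?p (x + y) = ?p x + ?p y" for x y by (rule linear_add[OF linear_orthogonal_projection[OF A]])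
  have thin: "thin_set M UNIV X (?p -` C)" if "C \<in> \<C>" for C
  proof (rule thin_setI[OF nearly_borel_vimage_projection[OF M A C(3)[OF that]]])
    fix x
    show "AE \<omega> in M. hitting_time (?p -` C) (\<lambda>t. x + X t \<omega>) \<noteq> 0"
      using C(4)[OF that orthogonal_projection_in[OF A, of x]]
      by eventually_elim (simp add: hitting_time_def projection_process_def add)
  qed
  have "semipolar_set M UNIV X (?p -` \<Union>\<C>)"
    unfolding semipolar_set_def
    by (intro exI[of _ "(\<lambda>C. ?p -` C) ` \<C>"]) (use C(1) thin in auto)
  then have "polar_set M UNIV X (?p -` \<Union>\<C>)" using H by (simp add: hypothesis_H_def)
  then obtain C' where "?p -` \<Union>\<C> \<subseteq> C' \<and> (\<forall>x\<in>UNIV. AE \<omega> in M. \<not> hitting_time C' (\<lambda>t. x + X t \<omega>) < \<infinity>)"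
    unfolding polar_set_def by (elim exE conjE) (rule that, intro conjI)
  then have C': "?p -` \<Union>\<C> \<subseteq> C'" "\<And>x. AE \<omega> in M. \<not> hitting_time C' (\<lambda>t. x + X t \<omega>) < \<infinity>"
    by simp_all
  show "polar_set M A (projection_process A X) D"
    unfolding polar_set_def
  \<comment> \<open>The polar superset \<open>C'\<close> need not be a preimage, so it yields no set
    in \<open>A\<close>. The union of the cover is nearly Borel and serves as witness;
    \<open>C'\<close> only supplies that it is not hit.\<close>
  proof (intro exI[of _ "\<Union>\<C>"] conjI ballI)
    show "nearly_borel M A (projection_process A X) (\<Union>\<C>)" by (rule nearly_borel_Union[OF C(1,3)])
    fix x assume "x \<in> A"
    then have px: "?p x = x" by (rule orthogonal_projection_id[OF A])
    show "AE \<omega> in M. \<not> hitting_time (\<Union>\<C>) (\<lambda>t. x + projection_process A X t \<omega>) < \<infinity>"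
      using C'(2)[of x] unfolding hitting_time_infinite_iff
    proof eventually_elim
      case (elim \<omega>)
      have "?p (x + X t \<omega>) = x + projection_process A X t \<omega>" for t
        by (simp add: add px projection_process_def)
      then have "x + X t \<omega> \<in> C'" if "x + projection_process A X t \<omega> \<in> \<Union>\<C>" for t
        using C'(1) that by auto
      then show ?case using elim by blast
    qed
  qed (rule C(2))
qed

section \<open>From the projection on S to the whole process\<close>

lemma (in levy_step_process) frozen_start:
  assumes "good \<omega>"
  shows "\<exists>\<epsilon>>0. \<forall>t. 0 \<le> t \<and> t < \<epsilon> \<longrightarrow> w (X t \<omega>) = 0"
proof -
  obtain b where b: "0 < b" "\<And>s. 0 < s \<Longrightarrow> s < b \<Longrightarrow> w (X s \<omega>) = w (X 0 \<omega>)"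
    using assms unfolding good_def step_path_def eventually_at_right_field by blast
  have "w (X 0 \<omega>) = 0" using assms linear_0[OF linear_w] by (simp add: good_def)
  then have "w (X t \<omega>) = 0" if "0 \<le> t" "t < b" for t
    using b(2)[of t] that by (cases "t = 0") auto
  then show ?thesis using b(1) by blast
qed

lemma (in levy_step_process) hypothesis_H_of_projection:
  assumes H: "hypothesis_H M S (projection_process S X)"
  shows "hypothesis_H M UNIV X"
  unfolding hypothesis_H_def
proof (intro allI impI)
  let ?p = "orthogonal_projection S"
  fix D assume "semipolar_set M UNIV X D"
  then obtain \<C> where C: "countable \<C>" "D \<subseteq> \<Union>\<C>" "\<And>C. C \<in> \<C> \<Longrightarrow> nearly_borel M UNIV X C"
    "\<And>C x. C \<in> \<C> \<Longrightarrow> x \<in> UNIV \<Longrightarrow> AE \<omega> in M. hitting_time C (\<lambda>t. x + X t \<omega>) \<noteq> 0"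
    by (rule semipolar_set_cover) blast
  have E: "nearly_borel M UNIV X (\<Union>\<C>)" by (rule nearly_borel_Union[OF C(1,3)])
  have "avoids (\<Union>\<C>)"
    unfolding avoids_def
  proof
    fix z
    \<comment> \<open>While \<open>w (X)\<close> has not moved, \<open>z + X t\<close> stays in the
      translate \<open>y + S\<close>, so only the slices of the cover over \<open>y\<close>
      matter.\<close>
    define y where "y = w z"
    define sec where "sec C = {s \<in> S. y + s \<in> C}" for C
    have thin: "thin_set M S (projection_process S X) (sec C)" if "C \<in> \<C>" for C
      unfolding sec_def
    proof (rule thin_setI[OF nearly_borel_section[OF C(3)[OF that]]])
      fix x assume "x \<in> S"
      show "AE \<omega> in M. hitting_time {s \<in> S. y + s \<in> C} (\<lambda>t. x + projection_process S X t \<omega>) \<noteq> 0"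
        using C(4)[OF that UNIV_I, of "y + x"] AE_good
      proof eventually_elim
        case (elim \<omega>)
        obtain e1 where e1: "0 < e1" "\<And>t. 0 < t \<Longrightarrow> t < e1 \<Longrightarrow> y + x + X t \<omega> \<notin> C"
          using elim(1) unfolding hitting_time_neq_0_iff by blast
        obtain e2 where e2: "0 < e2" "\<And>t. 0 \<le> t \<Longrightarrow> t < e2 \<Longrightarrow> w (X t \<omega>) = 0"
          using frozen_start[OF elim(2)] by blast
        have "x + projection_process S X t \<omega> \<notin> {s \<in> S. y + s \<in> C}" if t: "0 < t" "t < min e1 e2" for t
        proof -
          have "projection_process S X t \<omega> = X t \<omega>"
            using e2(2)[of t] t by (simp add: projection_process_def w_def)
          then show ?thesis using e1(2)[of t] t by (simp add: add.assoc)
        qed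
        then show ?case
          unfolding hitting_time_neq_0_iff using e1(1) e2(1) by (intro exI[of _ "min e1 e2"]) auto
      qed
    qed
    have "semipolar_set M S (projection_process S X) (\<Union>(sec ` \<C>))"
      unfolding semipolar_set_def
      by (intro exI[of _ "sec ` \<C>"]) (use C(1) thin in auto)
    then have "polar_set M S (projection_process S X) (\<Union>(sec ` \<C>))" using H by (simp add: hypothesis_H_def)
    then obtain C' where C': "\<Union>(sec ` \<C>) \<subseteq> C'"
        "\<And>x. x \<in> S \<Longrightarrow> AE \<omega> in M. \<not> hitting_time C' (\<lambda>t. x + projection_process S X t \<omega>) < \<infinity>"
      unfolding polar_set_def by blast
    show "AE \<omega> in M. \<forall>t>0. frozen_until w (path_trace \<omega>) t \<longrightarrow> z + X t \<omega> \<notin> \<Union>\<C>"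
      using C'(2)[OF orthogonal_projection_in[OF subspace_S, of z]] AE_good
      unfolding hitting_time_infinite_iff
    proof eventually_elim
      case (elim \<omega>)
      show ?case
      proof (intro allI impI notI)
        fix t :: real assume t: "0 < t" "frozen_until w (path_trace \<omega>) t" "z + X t \<omega> \<in> \<Union>\<C>"
        then obtain C where C: "C \<in> \<C>" "z + X t \<omega> \<in> C" by blast
        have "w (X t \<omega>) = w (X 0 \<omega>)"
          using frozen_until_shiftD[OF linear_w, of "\<lambda>t. X t \<omega>" 0 t] t elim(2)
          by (simp add: path_trace_eq) (simp add: good_def)
        then have w0: "w (X t \<omega>) = 0" using elim(2) linear_0[OF linear_w] by (simp add: good_def)
        have "?p z + projection_process S X t \<omega> \<in> S"
          using subspace_S by (auto simp: projection_process_def intro!: subspace_add orthogonal_projection_in)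
        moreover have "y + (?p z + projection_process S X t \<omega>) = z + X t \<omega>"
          using w0 by (simp add: y_def w_def projection_process_def)
        ultimately have "?p z + projection_process S X t \<omega> \<in> sec C"
          using C(2) by (simp add: sec_def)
        then have "?p z + projection_process S X t \<omega> \<in> C'" using C(1) C'(1) by blast
        then show False using elim(1) t(1) by blast
      qed
    qed
  qed
  then have avoid: "AE \<omega> in M. \<forall>t>0. x + X t \<omega> \<notin> \<Union>\<C>" for x
    by (rule nearly_borel_avoids_AE[OF E])
  then show "polar_set M UNIV X D"
    unfolding polar_set_def hitting_time_infinite_iff using E C(2) by blast
qed

section \<open>Step paths and drift of the component outside S\<close>

lemma step_path_componentwise:
  fixes v :: "real \<Rightarrow> 'a::euclidean_space"
  assumes "\<And>b. b \<in> Basis \<Longrightarrow> step_path (\<lambda>t. v t \<bullet> b)"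
  shows "step_path v"
  unfolding step_path_def
proof (intro conjI allI impI)
  fix t :: real assume "0 \<le> t"
  then have "\<forall>b\<in>Basis. \<forall>\<^sub>F s in at_right t. v s \<bullet> b = v t \<bullet> b"
    using assms by (auto simp: step_path_def)
  then have "\<forall>\<^sub>F s in at_right t. \<forall>b\<in>Basis. v s \<bullet> b = v t \<bullet> b"
    by (intro eventually_ball_finite) auto
  then show "\<forall>\<^sub>F s in at_right t. v s = v t" by eventually_elim (rule euclidean_eqI, blast)
next
  fix t :: real assume "0 < t"
  then have "\<forall>b\<in>Basis. \<exists>c. \<forall>\<^sub>F s in at_left t. v s \<bullet> b = c"
    using assms by (auto simp: step_path_def)
  then obtain c where "\<forall>b\<in>Basis. \<forall>\<^sub>F s in at_left t. v s \<bullet> b = c b" by metis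
  then have "\<forall>\<^sub>F s in at_left t. \<forall>b\<in>Basis. v s \<bullet> b = c b"
    by (intro eventually_ball_finite) auto
  then have "\<forall>\<^sub>F s in at_left t. v s = (\<Sum>b\<in>Basis. c b *\<^sub>R b)"
    by eventually_elim (rule euclidean_eqI, simp)
  then show "\<exists>c. \<forall>\<^sub>F s in at_left t. v s = c" by blast
qed

lemma orthogonal_projection_selfadjoint:
  assumes A: "subspace A"
  shows "orthogonal_projection A x \<bullet> y = x \<bullet> orthogonal_projection A y"
proof -
  let ?p = "orthogonal_projection A"
  have "?p x \<bullet> (y - ?p y) = 0" "(x - ?p x) \<bullet> ?p y = 0"
    using orthogonal_projection[OF A, of x] orthogonal_projection[OF A, of y]
    by (auto simp: orthogonal_comp_def orthogonal_def inner_commute)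
  then show ?thesis by (simp add: inner_diff_left inner_diff_right)
qed

lemma AE_step_path_outside:
  fixes X :: "real \<Rightarrow> 'w \<Rightarrow> real^'n"
  assumes X: "levy_process M X" and LK: "has_levy_khintchine_exponent M X a Q \<mu>" and S: "subspace S"
    and Q: "range (\<lambda>y. matrix_sqrt Q *v y) \<subseteq> S" and \<mu>: "emeasure \<mu> (UNIV - S) < \<infinity>"
  shows "AE \<omega> in M. step_path (\<lambda>t. (X t \<omega> - orthogonal_projection S (X t \<omega>))
     - t *\<^sub>R (outer_drift a \<mu> S - orthogonal_projection S (outer_drift a \<mu> S)))"
proof -
  interpret levy_process M X by fact
  define w where "w x = x - orthogonal_projection S x" for x
  define d where "d = outer_drift a \<mu> S"
  have w_in: "w x \<in> S\<^sup>\<bottom>" for x using orthogonal_projection[OF S, of x] by (simp add: w_def)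
  have w_sym: "w x \<bullet> y = x \<bullet> w y" for x y
    using orthogonal_projection_selfadjoint[OF S, of x y] by (simp add: w_def inner_diff_left inner_diff_right)
  \<comment> \<open>The directions \<open>w b\<close> with \<open>b\<close> in the basis are
    orthogonal to \<open>S\<close>, and self-adjointness of \<open>w\<close> turns
    \<open>w b \<bullet> X t \<omega>\<close> into a coordinate of
    \<open>w (X t \<omega>)\<close>.\<close>
  have coord: "AE \<omega> in M. step_path (\<lambda>t. w b \<bullet> X t \<omega> - t * (w b \<bullet> d))" for b
  proof (rule AE_step_path_coordinate)
    let ?C = "2 * measure \<mu> (UNIV - S)"
    fix u h :: real assume h: "0 \<le> h" "h \<le> 1"
    show "1 - expectation (\<lambda>\<omega>. cos (u * (w b \<bullet> X h \<omega> - h * (w b \<bullet> d)))) \<le> (?C + ?C\<^sup>2) * h"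
    proof (rule one_minus_char_le[OF _ h])
      fix u h :: real assume h: "0 \<le> h"
      let ?z = "u *\<^sub>R w b"
      have z: "?z \<in> S\<^sup>\<bottom>" by (intro subspace_scale subspace_orthogonal_comp w_in)
      have psd: "pos_semidef Q" and lm: "levy_measure \<mu>" using LK by (auto simp: has_levy_khintchine_exponent_def)
      from levy_exponent_orthogonal[OF lm \<mu> S quadratic_form_zero_orthogonal[OF psd Q z] z, of a]
      obtain \<eta> where "levy_exponent a Q \<mu> ?z = - \<i> * complex_of_real (?z \<bullet> d) + \<eta>" "0 \<le> Re \<eta>" "norm \<eta> \<le> ?C"
        by (auto simp: d_def)
      moreover have "expectation (\<lambda>\<omega>. iexp (?z \<bullet> X h \<omega>)) = exp (- (complex_of_real h * levy_exponent a Q \<mu> ?z))"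
        using LK h unfolding has_levy_khintchine_exponent_def by blast
      ultimately show "\<exists>\<eta>. expectation (\<lambda>\<omega>. iexp (?z \<bullet> X h \<omega>))
          = exp (- (complex_of_real h * (- \<i> * complex_of_real (?z \<bullet> d) + \<eta>))) \<and> 0 \<le> Re \<eta> \<and> norm \<eta> \<le> ?C"
        by (intro exI[of _ \<eta>]) simp
    qed
  qed
  have "AE \<omega> in M. \<forall>b\<in>Basis. step_path (\<lambda>t. w b \<bullet> X t \<omega> - t * (w b \<bullet> d))"
    using coord by (subst AE_ball_countable) (auto intro: countable_finite)
  then have "AE \<omega> in M. step_path (\<lambda>t. w (X t \<omega>) - t *\<^sub>R w d)"
  proof eventually_elim
    case (elim \<omega>)
    show ?case
    proof (rule step_path_componentwise)
      fix b :: "real^'n" assume b: "b \<in> Basis"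
      have flip: "w b \<bullet> x = w x \<bullet> b" for x
        using w_sym[of x b] inner_commute[of x "w b"] by simp
      have "(w (X t \<omega>) - t *\<^sub>R w d) \<bullet> b = w b \<bullet> X t \<omega> - t * (w b \<bullet> d)" for t
        unfolding flip by (simp add: inner_diff_left)
      then show "step_path (\<lambda>t. (w (X t \<omega>) - t *\<^sub>R w d) \<bullet> b)" using elim b by simp
    qed
  qed
  then show ?thesis by (simp add: w_def d_def)
qed

text \<open>A nonzero drift outside \<open>S\<close> makes the origin a thin set that is hit at small times.\<close>

lemma drift_zero_of_hypothesis_H:
  fixes X :: "real \<Rightarrow> 'w \<Rightarrow> 'a::euclidean_space"
  assumes X: "levy_process M X" and S: "subspace S"
    and step: "AE \<omega> in M. step_path (\<lambda>t. (X t \<omega> - orthogonal_projection S (X t \<omega>)) - t *\<^sub>R e)"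
    and e: "e \<in> S\<^sup>\<bottom>"
    and H: "hypothesis_H M (S\<^sup>\<bottom>) (projection_process (S\<^sup>\<bottom>) X)"
  shows "e = 0"
proof (rule ccontr)
  assume "e \<noteq> 0"
  interpret levy_process M X by fact
  let ?Y = "projection_process (S\<^sup>\<bottom>) X"
  have Y: "?Y t \<omega> = X t \<omega> - orthogonal_projection S (X t \<omega>)" for t \<omega>
    by (simp add: projection_process_def orthogonal_projection_complement[OF S])
  note perp = subspace_orthogonal_comp[of S]
  have start: "AE \<omega> in M. \<exists>\<epsilon>>0. \<forall>t. 0 < t \<and> t < \<epsilon> \<longrightarrow> ?Y t \<omega> = t *\<^sub>R e"
    using step start_zero
  proof eventually_elim
    case (elim \<omega>)
    obtain b where b: "0 < b" "\<And>s. 0 < s \<Longrightarrow> s < b \<Longrightarrow> ?Y s \<omega> - s *\<^sub>R e = ?Y 0 \<omega> - 0 *\<^sub>R e"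
      using elim(1) unfolding step_path_def eventually_at_right_field Y by blast
    have "?Y 0 \<omega> = 0" using elim(2) by (simp add: Y linear_0[OF linear_orthogonal_projection[OF S]])
    then show ?case using b by (intro exI[of _ b]) auto
  qed
  have nb: "nearly_borel M (S\<^sup>\<bottom>) ?Y {0}"
  proof -
    have "{0} \<in> sets (restrict_space borel (S\<^sup>\<bottom>))"
      using subspace_0[OF perp] by (subst sets_restrict_space_iff) (auto simp: closed_subspace[OF perp] borel_closed)
    then show ?thesis unfolding nearly_borel_def by (intro allI impI bexI[of _ "{0}"]) auto
  qed
  have "thin_set M (S\<^sup>\<bottom>) ?Y {0}"
  proof (rule thin_setI[OF nb])
    fix x
    show "AE \<omega> in M. hitting_time {0} (\<lambda>t. x + ?Y t \<omega>) \<noteq> 0"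
      using start
    proof eventually_elim
      case (elim \<omega>)
      then obtain b where b: "0 < b" "\<And>t. 0 < t \<Longrightarrow> t < b \<Longrightarrow> ?Y t \<omega> = t *\<^sub>R e" by blast
      show ?case unfolding hitting_time_neq_0_iff
      \<comment> \<open>From \<open>x\<close> the early path is \<open>x + t e\<close>, on a line
        that meets the origin at most once; before that time the origin is avoided.\<close>
      proof (cases "\<exists>t. 0 < t \<and> t < b \<and> x + t *\<^sub>R e = 0")
        case True
        then obtain t0 where t0: "0 < t0" "t0 < b" "x + t0 *\<^sub>R e = 0" by blast
        have "x + ?Y t \<omega> \<notin> {0}" if t: "0 < t" "t < t0" for t
        proof
          assume "x + ?Y t \<omega> \<in> {0}"
          then have "x + t *\<^sub>R e = x + t0 *\<^sub>R e" using b(2)[of t] t t0 by simp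
          then show False using \<open>e \<noteq> 0\<close> t by simp
        qed
        then show "\<exists>\<epsilon>>0. \<forall>t. 0 < t \<and> t < \<epsilon> \<longrightarrow> x + ?Y t \<omega> \<notin> {0}" using t0(1) by blast
      next
        case False
        then show "\<exists>\<epsilon>>0. \<forall>t. 0 < t \<and> t < \<epsilon> \<longrightarrow> x + ?Y t \<omega> \<notin> {0}" using b by (intro exI[of _ b]) auto
      qed
    qed
  qed
  then have "semipolar_set M (S\<^sup>\<bottom>) ?Y {0}"
    unfolding semipolar_set_def by (intro exI[of _ "{{0}}"]) auto
  then have "polar_set M (S\<^sup>\<bottom>) ?Y {0}" using H by (simp add: hypothesis_H_def)
  then obtain C where "{0} \<subseteq> C \<and> (\<forall>x\<in>S\<^sup>\<bottom>. AE \<omega> in M. \<forall>t>0. x + ?Y t \<omega> \<notin> C)"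
    unfolding polar_set_def hitting_time_infinite_iff by (elim exE conjE) (rule that, intro conjI)
  then have C: "{0} \<subseteq> C" "\<And>x. x \<in> S\<^sup>\<bottom> \<Longrightarrow> AE \<omega> in M. \<forall>t>0. x + ?Y t \<omega> \<notin> C"
    by simp_all
  \<comment> \<open>Started at \<open>- e / (n + 1)\<close>, the path is at the origin at time
    \<open>1 / (n + 1)\<close> if it is still linear then. The length of the linear stretch is
    random, so countably many starts are used, of which one must succeed.\<close>
  have "AE \<omega> in M. ?Y (1 / real (Suc n)) \<omega> \<noteq> (1 / real (Suc n)) *\<^sub>R e" for n
  proof -
    have "- ((1 / real (Suc n)) *\<^sub>R e) \<in> S\<^sup>\<bottom>" by (intro subspace_neg subspace_scale perp e)
    from C(2)[OF this] show ?thesis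
    proof eventually_elim
      case (elim \<omega>)
      have "- ((1 / real (Suc n)) *\<^sub>R e) + ?Y (1 / real (Suc n)) \<omega> \<notin> C" using elim by simp
      then show ?case using C(1) by auto
    qed
  qed
  then have "AE \<omega> in M. \<forall>n. ?Y (1 / real (Suc n)) \<omega> \<noteq> (1 / real (Suc n)) *\<^sub>R e"
    by (subst AE_all_countable) blast
  then have "AE \<omega> in M. False"
    using start
  proof eventually_elim
    case (elim \<omega>)
    then obtain b where b: "0 < b" "\<And>t. 0 < t \<Longrightarrow> t < b \<Longrightarrow> ?Y t \<omega> = t *\<^sub>R e" by blast
    obtain n where "1 / real (Suc n) < b" using nat_approx_posE[OF b(1)] by auto
    moreover have "0 < 1 / real (Suc n)" by simp
    ultimately have "?Y (1 / real (Suc n)) \<omega> = (1 / real (Suc n)) *\<^sub>R e" by (intro b(2))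
    then show False using elim(1) by blast
  qed
  then show False by simp
qed

theorem theorem3p7:
  fixes M :: "'w measure" and X :: "real \<Rightarrow> 'w \<Rightarrow> real^'n"
    and a :: "real^'n" and Q :: "real^'n^'n" and \<mu> :: "(real^'n) measure"
    and S :: "(real^'n) set"
  assumes "CARD('n) > 1"
    and "levy_process M X"
    and "has_levy_khintchine_exponent M X a Q \<mu>"
    and "subspace S"
    and "range (\<lambda>y. matrix_sqrt Q *v y) \<subset> S" and "S \<subset> UNIV"
    and "emeasure \<mu> (UNIV - S) < \<infinity>"
  defines "claim_i \<equiv> hypothesis_H M UNIV X"
    and "claim_ii \<equiv> \<forall>A. subspace A \<and> A \<noteq> {} \<and> A \<noteq> UNIV \<longrightarrow>
           hypothesis_H M A (projection_process A X)"
    and "claim_iii \<equiv> \<forall>A\<in>{S, S\<^sup>\<bottom>}. hypothesis_H M A (projection_process A X)"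
  shows "(claim_i \<longleftrightarrow> claim_ii) \<and> (claim_ii \<longleftrightarrow> claim_iii)"
proof -
  interpret levy_process M X by fact
  note S = \<open>subspace S\<close>
  note perp = subspace_orthogonal_comp[of S]
  have i_ii: claim_ii if claim_i
    using that hypothesis_H_projection[OF prob_space_axioms] by (auto simp: claim_i_def claim_ii_def)
  have ii_iii: claim_iii if claim_ii
  proof -
    \<comment> \<open>The range of the root contains 0, so its strict inclusion in \<open>S\<close>
      provides a nonzero vector of \<open>S\<close>; the complement is then proper.\<close>
    have "matrix_sqrt Q *v 0 = 0" by simp
    then have "0 \<in> range (\<lambda>y. matrix_sqrt Q *v y)" by (metis rangeI)
    then obtain x where x: "x \<in> S" "x \<noteq> 0" using assms(5) by auto
    then have "x \<notin> S\<^sup>\<bottom>" by (auto simp: orthogonal_comp_def orthogonal_def intro!: bexI[of _ x])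
    then have "S\<^sup>\<bottom> \<noteq> UNIV" by blast
    moreover have "S \<noteq> {}" "S\<^sup>\<bottom> \<noteq> {}" using subspace_0[OF S] subspace_0[OF perp] by auto
    ultimately show ?thesis using that S perp assms(6) by (auto simp: claim_ii_def claim_iii_def)
  qed
  have iii_i: claim_i if claim_iii
  proof -
    define e where "e = outer_drift a \<mu> S - orthogonal_projection S (outer_drift a \<mu> S)"
    have step: "AE \<omega> in M. step_path (\<lambda>t. (X t \<omega> - orthogonal_projection S (X t \<omega>)) - t *\<^sub>R e)"
      unfolding e_def 
      by (rule AE_step_path_outside[OF assms(2,3,4) psubset_imp_subset[OF assms(5)] assms(7)])
    have "e \<in> S\<^sup>\<bottom>" using orthogonal_projection[OF S] by (simp add: e_def)
    with step have "e = 0"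
      by (rule drift_zero_of_hypothesis_H[OF \<open>levy_process M X\<close> S]) (use that in \<open>simp add: claim_iii_def\<close>)
    with step have "AE \<omega> in M. step_path (\<lambda>t. X t \<omega> - orthogonal_projection S (X t \<omega>))" by simp
    then interpret levy_step_process M X S by unfold_locales (use S in auto)
    show ?thesis
      using hypothesis_H_of_projection that by (simp add: claim_i_def claim_iii_def)
  qed
  show ?thesis using i_ii ii_iii iii_i by blast
qed

end
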